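(* Consider the quasi-static single-input multiple-output channel described in the context, with random fading vector $\mathbf{h}\in\mathbb{C}^{r}$, and fix $\epsilon\in(0,1)$. Assume the probability density function of $\|\mathbf{h}\|^2$ is continuously differentiable and that $F$ is differentiable at $C_\epsilon$ with $F'(C_\epsilon)>0$. Then, as $n\to\infty$, $$R^*_{\mathrm{no}}(n,\epsilon)=C_\epsilon+O\!\left(\frac{\log n}{n}\right)\quad\text{and}\quad R^*_{\mathrm{rx}}(n,\epsilon)=C_\epsilon+O\!\left(\frac{\log n}{n}\right).$$
   Context: Fix $r\ge1$ and $\rho>0$. For blocklength $n$, the channel maps $\mathbf{x}\in\mathbb{C}^{n}$ to $\mathbb{Y}=\mathbf{x}\mathbf{h}^T+\mathbb{W}\in\mathbb{C}^{n\times r}$, where $\mathbf{h}\in\mathbb{C}^r$ is random and constant over the block and $\mathbb{W}$ has i.i.d. $\mathcal{CN}(0,1)$ entries independent of $\mathbf{h}$ and the message. An $(n,M,\epsilon)_{\mathrm{no}}$ code: codewords $\mathbf{c}_1,\dots,\mathbf{c}_M\in\mathbb{C}^n$ with $\|\mathbf{c}_j\|^2\le n\rho$ and a decoder $g$ acting on $\mathbb{Y}$ with maximal error probability $\max_j\Pr[g(\mathbb{Y})\neq j\mid j]\le\epsilon$. An $(n,M,\epsilon)_{\mathrm{rx}}$ code is the same but the decoder acts on $(\mathbb{Y},\mathbf{h})$. $R^*_l(n,\epsilon)=\sup\{(\log M)/n:\exists\,(n,M,\epsilon)_l\text{ code}\}$. $F(R)=\Pr[\log(1+\|\mathbf{h}\|^2\rho)<R]$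 and $C_\epsilon=\sup\{R:F(R)\le\epsilon\}$. *)

theory Defs
  imports "HOL-Probability.Probability"
begin

text \<open>Fading vectors h live in complex^'r (r = CARD('r) receive antennas).
  Blocks of length n (codewords, channel outputs) are functions on {..<n}.\<close>

text \<open>Circularly-symmetric complex Gaussian vector with i.i.d. CN(0,1) entries:
  density pi^(-r) exp(-norm w ^ 2) w.r.t. Lebesgue measure on complex^'r.\<close>
definition cn_vec :: "(complex^'r::finite) measure" where
  "cn_vec = density lborel (\<lambda>w. ennreal (exp (- (norm w)\<^sup>2) / power pi CARD('r)))"

text \<open>Noise matrix W (n x r): rows i < n are i.i.d. CN(0,I_r) vectors.\<close>
definition noise_blk :: "nat \<Rightarrow> (nat \<Rightarrow> complex^'r::finite) measure" where
  "noise_blk n = PiM {..<n} (\<lambda>_. cn_vec)"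

text \<open>Measurable space of channel outputs Y (n x r matrices, row i = Y i).\<close>
definition out_space :: "nat \<Rightarrow> (nat \<Rightarrow> complex^'r::finite) measure" where
  "out_space n = PiM {..<n} (\<lambda>_. borel)"

definition chan_out :: "nat \<Rightarrow> (nat \<Rightarrow> complex) \<Rightarrow> complex^'r::finite \<Rightarrow> (nat \<Rightarrow> complex^'r) \<Rightarrow> (nat \<Rightarrow> complex^'r)" where
  "chan_out n x h W = (\<lambda>i\<in>{..<n}. (\<chi> k. x i * h$k) + W i)"

definition no_code :: "(complex^'r::finite) measure \<Rightarrow> real \<Rightarrow> nat \<Rightarrow> nat \<Rightarrow> real \<Rightarrow>
    (nat \<Rightarrow> nat \<Rightarrow> complex) \<Rightarrow> ((nat \<Rightarrow> complex^'r) \<Rightarrow> nat) \<Rightarrow> bool" where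
  "no_code H \<rho> n M \<epsilon> c g \<longleftrightarrow>
     M \<ge> 1 \<and>
     (\<forall>j<M. (\<Sum>i<n. (cmod (c j i))^2) \<le> real n * \<rho>) \<and>
     g \<in> measurable (out_space n) (count_space UNIV) \<and>
     (\<forall>j<M. measure (H \<Otimes>\<^sub>M noise_blk n)
        {p \<in> space (H \<Otimes>\<^sub>M noise_blk n). g (chan_out n (c j) (fst p) (snd p)) \<noteq> j} \<le> \<epsilon>)"

definition rx_code :: "(complex^'r::finite) measure \<Rightarrow> real \<Rightarrow> nat \<Rightarrow> nat \<Rightarrow> real \<Rightarrow>
    (nat \<Rightarrow> nat \<Rightarrow> complex) \<Rightarrow> ((nat \<Rightarrow> complex^'r) \<times> (complex^'r) \<Rightarrow> nat) \<Rightarrow> bool" where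
  "rx_code H \<rho> n M \<epsilon> c g \<longleftrightarrow>
     M \<ge> 1 \<and>
     (\<forall>j<M. (\<Sum>i<n. (cmod (c j i))^2) \<le> real n * \<rho>) \<and>
     g \<in> measurable (out_space n \<Otimes>\<^sub>M borel) (count_space UNIV) \<and>
     (\<forall>j<M. measure (H \<Otimes>\<^sub>M noise_blk n)
        {p \<in> space (H \<Otimes>\<^sub>M noise_blk n). g (chan_out n (c j) (fst p) (snd p), fst p) \<noteq> j} \<le> \<epsilon>)"

definition Rstar_no :: "(complex^'r::finite) measure \<Rightarrow> real \<Rightarrow> nat \<Rightarrow> real \<Rightarrow> ereal" where
  "Rstar_no H \<rho> n \<epsilon> = Sup {ereal (ln (real M) / real n) | M. \<exists>c g. no_code H \<rho> n M \<epsilon> c g}"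

definition Rstar_rx :: "(complex^'r::finite) measure \<Rightarrow> real \<Rightarrow> nat \<Rightarrow> real \<Rightarrow> ereal" where
  "Rstar_rx H \<rho> n \<epsilon> = Sup {ereal (ln (real M) / real n) | M. \<exists>c g. rx_code H \<rho> n M \<epsilon> c g}"

definition outage_F :: "(complex^'r::finite) measure \<Rightarrow> real \<Rightarrow> real \<Rightarrow> real" where
  "outage_F H \<rho> R = measure H {h \<in> space H. ln (1 + (norm h)^2 * \<rho>) < R}"

definition C_eps :: "(complex^'r::finite) measure \<Rightarrow> real \<Rightarrow> real \<Rightarrow> real" where
  "C_eps H \<rho> \<epsilon> = Sup {R. outage_F H \<rho> R \<le> \<epsilon>}"

end

theory Submission
  imports Defs
begin

text \<open>Write \<open>G = \<parallel>h\<parallel>\<^sup>2\<close>. By unitary invariance, the noise projected onto the direction of \<open>h\<close> is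
  standard complex Gaussian and independent of \<open>h\<close>. For the likelihood ratio test against the
  capacity-achieving output distribution (converse) and for the test of the angle between codeword
  and column space of the output (achievability without channel knowledge), the error event is
  compared with \<open>G - g0 + a \<alpha>(G) + b \<beta>(G) \<le> 0\<close>, where \<open>a\<close>, \<open>b\<close> are independent of \<open>G\<close> and have mean
  zero and variance \<open>O(1/n)\<close>. As the density of \<open>G\<close> is continuously differentiable, this event has
  probability \<open>P(G \<le> g0) + O(1/n)\<close>, without a \<open>1 / sqrt n\<close> term. Since \<open>F\<close> grows linearly at \<open>C\<^sub>\<epsilon>\<close>,
  moving the rate by \<open>ln n / n\<close> pays for all errors of order \<open>1/n\<close>. The angle test confuses an output
  with an independent Gaussian codeword with probability \<open>O(n\<^sup>r exp (-R (n - r)))\<close>.\<close>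

subsection \<open>Complex Gaussian vectors\<close>

text \<open>A decoder with channel knowledge may ignore it, so it suffices to bound
  \<open>Rstar_rx\<close> from above and \<open>Rstar_no\<close> from below. The obstacle is that
  each test compares a nonlinear function of the gain with noise terms of size 1 / sqrt n, and any
  loss of that size would destroy the rate ln n / n. One-sided inequalities give the error events
  the common form: in the converse, ln t \<le> t - 1 replaces the logarithm of the gain by an affine
  function of it; in the achievability part, the squared correlation of codeword and noise is
  dropped. The order of averaging then matters. With the noise held fixed and the fading averaged
  first, the smooth density of the gain acts on a deterministic perturbation whose coefficients can
  be frozen at \<open>g0\<close>; only afterwards is the noise averaged, and its linear part
  vanishes. The threshold \<open>g0\<close> moves with n, which is why all constants are proved
  uniform for \<open>g0\<close> near the gain belonging to \<open>C_eps\<close>.\<close>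

lemma nn_integral_lborel_translate:
  fixes g :: "'a::euclidean_space \<Rightarrow> ennreal"
  assumes [measurable]: "g \<in> borel_measurable borel"
  shows "(\<integral>\<^sup>+x. g (x + a) \<partial>lborel) = (\<integral>\<^sup>+x. g x \<partial>lborel)"
proof -
  have "(\<integral>\<^sup>+x. g x \<partial>lborel) = (\<integral>\<^sup>+x. g x \<partial>distr lborel borel ((+) a))"
    by (simp add: lborel_distr_plus)
  also have "\<dots> = (\<integral>\<^sup>+x. g (a + x) \<partial>lborel)"
    by (subst nn_integral_distr) auto
  finally show ?thesis by (simp add: add.commute)
qed

lemma measurable_orthogonal_transformation:
  fixes f :: "'a::euclidean_space \<Rightarrow> 'a"
  shows "orthogonal_transformation f \<Longrightarrow> f \<in> borel_measurable borel"
  by (intro borel_measurable_continuous_onI linear_continuous_on)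
     (simp add: orthogonal_transformation_linear flip: linear_conv_bounded_linear)

text \<open>Uniqueness of Haar measure: for translation invariant measures \<open>\<mu>\<close>, \<open>\<lambda>\<close>, evaluating
  \<open>\<mu> \<otimes> \<lambda>\<close> on \<open>{(x, y). x \<in> A \<and> x - y \<in> B}\<close> in both orders gives \<open>\<mu> A * \<lambda> B = \<mu> B * \<lambda> A\<close>; take
  for \<open>\<mu>\<close> the image of Lebesgue measure and for \<open>B\<close> the unit ball.\<close>
lemma lborel_distr_orthogonal_transformation:
  fixes f :: "'a::euclidean_space \<Rightarrow> 'a"
  assumes f: "orthogonal_transformation f"
  shows "distr lborel borel f = lborel"
proof (rule measure_eqI)
  let ?\<mu> = "distr lborel borel f"
  show "sets ?\<mu> = sets lborel" by simp
  have lin: "linear f" and nf: "norm (f x) = norm x" for x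
    using f by (auto simp: orthogonal_transformation)
  note measurable_orthogonal_transformation[OF f, measurable]
  have surj: "surj f" using f by (rule orthogonal_transformation_surj)
  have \<mu>_trans: "(\<integral>\<^sup>+x. g (x + a) \<partial>?\<mu>) = (\<integral>\<^sup>+x. g x \<partial>?\<mu>)"
    if [measurable]: "g \<in> borel_measurable borel" for g :: "'a \<Rightarrow> ennreal" and a
  proof -
    obtain b where b: "a = f b" using surj by (metis surjD)
    have "(\<integral>\<^sup>+x. g (x + a) \<partial>?\<mu>) = (\<integral>\<^sup>+x. g (f (x + b)) \<partial>lborel)"
      by (subst nn_integral_distr) (auto simp: b linear_add[OF lin])
    also have "\<dots> = (\<integral>\<^sup>+x. g (f x) \<partial>lborel)"
      by (rule nn_integral_lborel_translate) measurable
    also have "\<dots> = (\<integral>\<^sup>+x. g x \<partial>?\<mu>)" by (subst nn_integral_distr) auto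
    finally show ?thesis .
  qed
  \<comment> \<open>Fubini needs sigma-finiteness of the image measure. Since \<open>f\<close>
    preserves norms, every centred ball is its own preimage, so it keeps its finite measure.\<close>
  interpret mu: sigma_finite_measure ?\<mu>
  proof (standard, intro exI conjI)
    let ?A = "range (\<lambda>n::nat. ball (0::'a) (real n))"
    show "countable ?A" "?A \<subseteq> sets ?\<mu>" by auto
    show "\<Union>?A = space ?\<mu>"
      by (auto simp: space_borel) (metis reals_Archimedean2)
    show "\<forall>a\<in>?A. emeasure ?\<mu> a \<noteq> \<infinity>"
    proof safe
      fix n :: nat assume "emeasure ?\<mu> (ball 0 (real n)) = \<infinity>"
      moreover have "f -` ball 0 (real n) = ball 0 (real n)" by (auto simp: nf)
      ultimately show False
        using emeasure_lborel_ball_finite[of "0::'a" "real n"] by (simp add: emeasure_distr)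
    qed
  qed
  interpret P: pair_sigma_finite ?\<mu> "lborel :: 'a measure" ..
  define B where "B = ball (0::'a) 1"
  have B[measurable]: "B \<in> sets borel" by (simp add: B_def)
  have \<mu>B: "emeasure ?\<mu> B = emeasure lborel B"
  proof -
    have "f -` B = B" by (auto simp: nf B_def)
    then show ?thesis by (simp add: emeasure_distr)
  qed
  fix A assume "A \<in> sets ?\<mu>"
  then have A[measurable]: "A \<in> sets borel" by simp
  have "emeasure ?\<mu> A * emeasure lborel B = (\<integral>\<^sup>+x. indicator A x * emeasure lborel B \<partial>?\<mu>)"
    by (simp add: nn_integral_multc)
  also have "\<dots> = (\<integral>\<^sup>+x. (\<integral>\<^sup>+y. indicator A x * indicator B (x - y) \<partial>lborel) \<partial>?\<mu>)"
  proof (rule nn_integral_cong)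
    \<comment> \<open>The ball \<open>B\<close> is symmetric, so \<open>x - y\<close> may be
      replaced by \<open>y - x\<close>, a translate of \<open>y\<close>.\<close>
    fix x
    have "(\<integral>\<^sup>+y. indicator A x * indicator B (x - y) \<partial>lborel)
        = indicator A x * (\<integral>\<^sup>+y. indicator B (y + (-x)) \<partial>lborel)"
      by (subst nn_integral_cmult[symmetric]) (auto simp: indicator_def B_def dist_norm norm_minus_commute intro!: nn_integral_cong)
    also have "(\<integral>\<^sup>+y. indicator B (y + (-x)) \<partial>lborel) = (\<integral>\<^sup>+y. indicator B y \<partial>lborel)"
      by (rule nn_integral_lborel_translate) (rule borel_measurable_indicator, simp)
    also have "(\<integral>\<^sup>+y. indicator B y \<partial>lborel) = emeasure lborel B"
      by (rule nn_integral_indicator) simp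
    finally show "indicator A x * emeasure lborel B = (\<integral>\<^sup>+y. indicator A x * indicator B (x - y) \<partial>lborel)" by simp
  qed
  also have "\<dots> = (\<integral>\<^sup>+y. (\<integral>\<^sup>+x. indicator A x * indicator B (x - y) \<partial>?\<mu>) \<partial>lborel)"
    by (rule P.Fubini'[symmetric]) measurable
  also have "\<dots> = (\<integral>\<^sup>+y. (\<integral>\<^sup>+x. indicator A (x + y) * indicator B x \<partial>?\<mu>) \<partial>lborel)"
  proof (rule nn_integral_cong)
    fix y
    show "(\<integral>\<^sup>+x. indicator A x * indicator B (x - y) \<partial>?\<mu>) = (\<integral>\<^sup>+x. indicator A (x + y) * indicator B x \<partial>?\<mu>)"
      using \<mu>_trans[of "\<lambda>x. indicator A x * indicator B (x - y)" y] by simp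
  qed
  also have "\<dots> = (\<integral>\<^sup>+x. (\<integral>\<^sup>+y. indicator A (x + y) * indicator B x \<partial>lborel) \<partial>?\<mu>)"
    by (rule P.Fubini') measurable
  also have "\<dots> = (\<integral>\<^sup>+x. emeasure lborel A * indicator B x \<partial>?\<mu>)"
  proof (rule nn_integral_cong)
    fix x
    have "(\<integral>\<^sup>+y. indicator A (x + y) * indicator B x \<partial>lborel) = (\<integral>\<^sup>+y. indicator A (y + x) \<partial>lborel) * indicator B x"
      by (subst nn_integral_multc) (auto simp: add.commute)
    then show "(\<integral>\<^sup>+y. indicator A (x + y) * indicator B x \<partial>lborel) = emeasure lborel A * indicator B x"
      by (subst (asm) nn_integral_lborel_translate) auto
  qed
  also have "\<dots> = emeasure lborel A * emeasure lborel B"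
    by (subst nn_integral_cmult_indicator) (auto simp: \<mu>B)
  finally have *: "emeasure lborel B * emeasure ?\<mu> A = emeasure lborel B * emeasure lborel A"
    by (simp add: mult.commute)
  have "emeasure lborel B \<noteq> 0" "emeasure lborel B \<noteq> \<top>"
    using emeasure_lborel_ball_finite[of "0::'a" 1]
    by (auto simp: B_def emeasure_ball ennreal_eq_0_iff not_le unit_ball_vol_pos)
  with * show "emeasure ?\<mu> A = emeasure lborel A"
    by (simp add: ennreal_mult_cancel_left)
qed

text \<open>The Hermitian form, conjugate linear in the first argument. The inner product of the
  type class on \<open>complex^'r\<close> is only its real part.\<close>

definition cinner :: "complex^'r::finite \<Rightarrow> complex^'r \<Rightarrow> complex" where
  "cinner u w = (\<Sum>k\<in>UNIV. cnj (u$k) * w$k)"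

lemma cinner_simps:
  "cinner u (v + w) = cinner u v + cinner u w" "cinner u (v - w) = cinner u v - cinner u w"
  "cinner (v + w) u = cinner v u + cinner w u" "cinner (v - w) u = cinner v u - cinner w u"
  "cinner u (c *\<^sub>R v) = of_real c * cinner u v" "cinner (c *\<^sub>R u) v = of_real c * cinner u v"
  "cinner u (\<chi> k. z * v$k) = z * cinner u v" "cinner (\<chi> k. z * u$k) v = cnj z * cinner u v"
  by (simp_all add: cinner_def sum.distrib sum_subtractf algebra_simps sum_distrib_left scaleR_conv_of_real[where 'a=complex])

lemma cnj_cinner: "cnj (cinner u v) = cinner v u"
  by (simp add: cinner_def mult.commute)

lemma cinner_self: "cinner u u = of_real ((norm u)^2)"
  by (simp add: cinner_def norm_vec_def L2_set_def real_sqrt_pow2 sum_nonneg complex_norm_square[symmetric] mult.commute)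

lemma inner_eq_Re_cinner: "v \<bullet> w = Re (cinner v w)"
  by (simp add: cinner_def inner_vec_def inner_complex_def)

lemma measurable_vec_component [measurable (raw)]:
  fixes f :: "'b \<Rightarrow> ('c::real_normed_vector)^'r::finite"
  assumes [measurable]: "f \<in> borel_measurable M"
  shows "(\<lambda>x. f x $ k) \<in> borel_measurable M"
proof -
  have [measurable]: "(\<lambda>w::'c^'r. w $ k) \<in> borel_measurable borel"
    by (intro borel_measurable_continuous_onI continuous_intros)
  show ?thesis by measurable
qed

lemma measurable_sgn_vec [measurable]: "sgn \<in> borel_measurable (borel :: (complex^'r::finite) measure)"
  unfolding sgn_div_norm[abs_def] by measurable

lemma continuous_on_cinner [continuous_intros]:
  "continuous_on S f \<Longrightarrow> continuous_on S g \<Longrightarrow> continuous_on S (\<lambda>x. cinner (f x) (g x))"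
  unfolding cinner_def by (intro continuous_intros)

lemma measurable_cinner [measurable (raw)]:
  fixes f g :: "'b \<Rightarrow> complex^'r::finite"
  assumes [measurable]: "f \<in> borel_measurable M" "g \<in> borel_measurable M"
  shows "(\<lambda>x. cinner (f x) (g x)) \<in> borel_measurable M"
proof -
  have "(\<lambda>p. cinner (fst p) (snd p)) \<in> borel_measurable (borel :: ((complex^'r) \<times> (complex^'r)) measure)"
    by (intro borel_measurable_continuous_onI continuous_intros)
  then have [measurable]: "(\<lambda>p. cinner (fst p) (snd p)) \<in> borel_measurable ((borel :: (complex^'r) measure) \<Otimes>\<^sub>M borel)"
    by (simp add: borel_prod)
  have "(\<lambda>x. (\<lambda>p. cinner (fst p) (snd p)) (f x, g x)) \<in> borel_measurable M"
    by measurable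
  then show ?thesis by simp
qed

text \<open>The complex reflection \<open>w \<mapsto> w - v (v\<^sup>* w) / (v\<^sup>* u)\<close> with \<open>v = u - u'\<close> is unitary and maps \<open>u\<close>
  to \<open>u'\<close>.\<close>
lemma ex_orthogonal_transformation_cinner:
  fixes u u' :: "complex^'r::finite"
  assumes u: "norm u = 1" "norm u' = 1"
  shows "\<exists>f. orthogonal_transformation f \<and> (\<forall>w. cinner u' (f w) = cinner u w)"
proof (cases "u = u'")
  case True
  then show ?thesis by (intro exI[of _ id]) (auto simp: orthogonal_transformation linear_id)
next
  case False
  define v where "v = u - u'"
  define d where "d = cinner v u"
  define f where "f = (\<lambda>w. w - (\<chi> k. (cinner v w / d) * v$k))"
  have uu: "cinner u u = 1" "cinner u' u' = 1" using u by (simp_all add: cinner_self)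
  have d: "d = 1 - cinner u' u" by (simp add: d_def v_def cinner_simps uu)
  \<comment> \<open>This relation, read as \<open>d + cnj d\<close>, is what cancels the cross terms
    in \<open>norm (f w)\<close>; it also shows that the denominator \<open>d\<close> is
    nonzero.\<close>
  have vv: "(norm v)^2 = 2 * Re d"
  proof -
    have "complex_of_real ((norm v)^2) = 2 - cinner u' u - cinner u u'"
      unfolding cinner_self[symmetric] by (simp add: v_def cinner_simps uu)
    also have "cinner u u' = cnj (cinner u' u)" by (simp add: cnj_cinner)
    finally have "Re (complex_of_real ((norm v)^2)) = 2 - 2 * Re (cinner u' u)" by simp
    then show ?thesis by (simp add: d)
  qed
  have "v \<noteq> 0" using False by (simp add: v_def)
  then have d0: "d \<noteq> 0" using vv by force
  have "linear f"
    by (rule linearI) (auto simp: f_def cinner_simps vec_eq_iff algebra_simps add_divide_distrib scaleR_conv_of_real[where 'a=complex])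
  moreover have "norm (f w) = norm w" for w
  proof -
    define t where "t = cinner v w"
    have "complex_of_real ((norm (f w))^2) = cinner (f w) (f w)" by (simp add: cinner_self)
    also have "\<dots> = cinner w w - cnj (t/d) * t - (t/d) * cnj t + cnj (t/d) * (t/d) * of_real ((norm v)^2)"
      unfolding f_def cinner_simps t_def[symmetric] cinner_self[of v] cnj_cinner[of v w, symmetric]
      by (simp add: t_def algebra_simps)
    also have "of_real ((norm v)^2) = d + cnj d"
      by (simp add: vv complex_eq_iff)
    also have "cinner w w - cnj (t/d) * t - (t/d) * cnj t + cnj (t/d) * (t/d) * (d + cnj d) = cinner w w"
      using d0 by (simp add: field_simps)
    finally have "(norm (f w))^2 = (norm w)^2" unfolding cinner_self of_real_eq_iff .
    then show ?thesis by simp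
  qed
  moreover have "cinner u' (f w) = cinner u w" for w
  proof -
    have "cinner u' v = - d" by (simp add: d v_def cinner_simps uu)
    then show ?thesis using d0 unfolding f_def cinner_simps by (simp add: v_def cinner_simps)
  qed
  ultimately show ?thesis by (auto simp: orthogonal_transformation)
qed

text \<open>Law of the real or the imaginary part of a CN(0,1) variable, each of which has variance
  1/2.\<close>

definition gauss1 :: "real measure" where
  "gauss1 = density lborel (\<lambda>x. ennreal (normal_density 0 (1 / sqrt 2) x))"

lemma space_gauss1 [simp]: "space gauss1 = UNIV"
  and sets_gauss1 [simp, measurable_cong]: "sets gauss1 = sets borel"
  by (simp_all add: gauss1_def)

lemma prob_space_gauss1: "prob_space gauss1"
  unfolding gauss1_def by (rule prob_space_normal_density) simp

lemma normal_density_half: "normal_density 0 (1 / sqrt 2) x = exp (- x\<^sup>2) / sqrt pi"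
  by (simp add: normal_density_def power_divide)

text \<open>Completing the square turns the tilted density into a normal density with mean
  \<open>c / (2 * (1 + \<nu>))\<close> and variance \<open>1 / (2 * (1 + \<nu>))\<close>; the value
  is the factor left over.\<close>

lemma gauss1_tilt:
  assumes "\<nu> > -1"
  shows "(\<integral>\<^sup>+x. ennreal (exp (c * x - \<nu> * x\<^sup>2)) \<partial>gauss1) = ennreal (exp (c\<^sup>2 / (4 * (1 + \<nu>))) / sqrt (1 + \<nu>))"
proof -
  define s where "s = 1 + \<nu>"
  have s: "s > 0" using assms by (simp add: s_def)
  have *: "exp (- x\<^sup>2) / sqrt pi * exp (c * x - \<nu> * x\<^sup>2)
      = exp (c\<^sup>2 / (4 * s)) / sqrt s * normal_density (c / (2 * s)) (1 / sqrt (2 * s)) x" for x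
  proof -
    define E where "E = (x - c / (2 * s))^2 * s"
    have 1: "- x\<^sup>2 + (c * x - \<nu> * x\<^sup>2) = c\<^sup>2 / (4 * s) - E"
      unfolding E_def using s by (simp add: power2_eq_square field_simps) (simp add: s_def algebra_simps)
    have 2: "normal_density (c / (2 * s)) (1 / sqrt (2 * s)) x = sqrt s / sqrt pi * exp (- E)"
      unfolding E_def using s by (simp add: normal_density_def power_divide real_sqrt_divide)
    have 3: "exp (- x\<^sup>2) / sqrt pi * exp (c * x - \<nu> * x\<^sup>2) = exp (- x\<^sup>2 + (c * x - \<nu> * x\<^sup>2)) / sqrt pi"
      by (simp only: exp_add) simp
    have 4: "P / Q / sqrt pi = P / sqrt s * (sqrt s / sqrt pi * inverse Q)" for P Q :: real
      using s by (simp add: divide_inverse)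
    show ?thesis
      unfolding 3 1 2 unfolding exp_diff exp_minus by (rule 4)
  qed
  have "(\<integral>\<^sup>+x. ennreal (exp (c * x - \<nu> * x\<^sup>2)) \<partial>gauss1)
     = (\<integral>\<^sup>+x. ennreal (exp (- x\<^sup>2) / sqrt pi * exp (c * x - \<nu> * x\<^sup>2)) \<partial>lborel)"
    by (simp add: gauss1_def nn_integral_density normal_density_half ennreal_mult''[symmetric])
  also have "\<dots> = (\<integral>\<^sup>+x. ennreal (exp (c\<^sup>2 / (4 * s)) / sqrt s) * ennreal (normal_density (c / (2 * s)) (1 / sqrt (2 * s)) x) \<partial>lborel)"
    unfolding * using s by (intro nn_integral_cong, subst ennreal_mult''[symmetric]) simp_all
  also have "\<dots> = ennreal (exp (c\<^sup>2 / (4 * s)) / sqrt s) * (\<integral>\<^sup>+x. ennreal (normal_density (c / (2 * s)) (1 / sqrt (2 * s)) x) \<partial>lborel)"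
    by (rule nn_integral_cmult) simp
  also have "(\<integral>\<^sup>+x. ennreal (normal_density (c / (2 * s)) (1 / sqrt (2 * s)) x) \<partial>lborel) = 1"
    using s prob_space.emeasure_space_1[OF prob_space_normal_density[of "1 / sqrt (2 * s)" "c / (2 * s)"]]
    by (simp add: emeasure_density)
  finally show ?thesis by (simp add: s_def)
qed

lemma gauss1_moments:
  "integrable gauss1 (\<lambda>x. x ^ k)" "integral\<^sup>L gauss1 (\<lambda>x. x) = 0" "integral\<^sup>L gauss1 (\<lambda>x. x\<^sup>2) = 1/2"
proof -
  have *: "0 < 1 / sqrt 2" by simp
  show "integrable gauss1 (\<lambda>x. x ^ k)"
    using integrable_normal_moment[OF *, of 0 k] by (simp add: gauss1_def integrable_density)
  show "integral\<^sup>L gauss1 (\<lambda>x. x) = 0"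
    using integral_normal_moment_nz_1[OF *, of 0] by (simp add: gauss1_def integral_density)
  show "integral\<^sup>L gauss1 (\<lambda>x. x\<^sup>2) = 1/2"
    using integral_normal_moment_even[OF *, of 0 1] by (simp add: gauss1_def integral_density power_divide)
qed

text \<open>Built from independent real and imaginary parts so that integrals factor.
  \<open>distr_cn_vec_component\<close> identifies it with the law of each entry of
  \<open>cn_vec\<close>.\<close>

definition cn1 :: "complex measure" where
  "cn1 = distr (gauss1 \<Otimes>\<^sub>M gauss1) borel (\<lambda>(x, y). Complex x y)"

lemma measurable_Complex [measurable (raw)]:
  assumes [measurable]: "f \<in> borel_measurable M" "g \<in> borel_measurable M"
  shows "(\<lambda>x. Complex (f x) (g x)) \<in> borel_measurable M"
  unfolding Complex_eq by measurable

lemma space_cn1 [simp]: "space cn1 = UNIV"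
  and sets_cn1 [simp, measurable_cong]: "sets cn1 = sets borel"
  by (simp_all add: cn1_def)

lemma prob_space_cn1: "prob_space cn1"
proof -
  interpret g: prob_space gauss1 by (rule prob_space_gauss1)
  interpret gg: pair_prob_space gauss1 gauss1 ..
  show ?thesis unfolding cn1_def by (rule gg.prob_space_distr) measurable
qed

lemma nn_integral_cn1_prod:
  assumes [measurable]: "f \<in> borel_measurable borel" "g \<in> borel_measurable borel"
  shows "(\<integral>\<^sup>+z. f (Re z) * g (Im z) \<partial>cn1) = (\<integral>\<^sup>+x. f x \<partial>gauss1) * (\<integral>\<^sup>+x. g x \<partial>gauss1)"
proof -
  interpret g: prob_space gauss1 by (rule prob_space_gauss1)
  interpret gg: pair_prob_space gauss1 gauss1 ..
  have "(\<integral>\<^sup>+z. f (Re z) * g (Im z) \<partial>cn1) = (\<integral>\<^sup>+p. f (fst p) * g (snd p) \<partial>(gauss1 \<Otimes>\<^sub>M gauss1))"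
    unfolding cn1_def by (subst nn_integral_distr) (auto simp: split_beta)
  also have "\<dots> = (\<integral>\<^sup>+x. \<integral>\<^sup>+y. f x * g y \<partial>gauss1 \<partial>gauss1)"
    by (subst g.nn_integral_fst[symmetric]) auto
  finally show ?thesis by (simp add: nn_integral_cmult nn_integral_multc)
qed

text \<open>The one Gaussian integral behind both bounds: with \<open>w = 0\<close> it normalizes
  the output density of the converse, in general it evaluates the exponential moments of the angle
  test.\<close>

lemma cn1_tilt:
  assumes "\<nu> > -1"
  shows "(\<integral>\<^sup>+z. ennreal (exp (Re (cnj w * z) - \<nu> * (cmod z)^2)) \<partial>cn1) = ennreal (exp ((cmod w)^2 / (4 * (1 + \<nu>))) / (1 + \<nu>))"
proof -
  have "(\<integral>\<^sup>+z. ennreal (exp (Re (cnj w * z) - \<nu> * (cmod z)^2)) \<partial>cn1)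
     = (\<integral>\<^sup>+z. ennreal (exp (Re w * Re z - \<nu> * (Re z)^2)) * ennreal (exp (Im w * Im z - \<nu> * (Im z)^2)) \<partial>cn1)"
    by (rule nn_integral_cong) (simp add: ennreal_mult[symmetric] exp_add[symmetric] cmod_power2 algebra_simps)
  also have "\<dots> = ennreal (exp ((Re w)^2 / (4 * (1 + \<nu>))) / sqrt (1 + \<nu>)) * ennreal (exp ((Im w)^2 / (4 * (1 + \<nu>))) / sqrt (1 + \<nu>))"
    by (subst nn_integral_cn1_prod) (simp_all add: gauss1_tilt[OF assms])
  also have "\<dots> = ennreal (exp ((cmod w)^2 / (4 * (1 + \<nu>))) / (1 + \<nu>))"
    using assms by (simp add: ennreal_mult[symmetric] exp_add[symmetric] cmod_power2 add_divide_distrib)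
  finally show ?thesis .
qed

lemma cn1_moments:
  "integrable cn1 (\<lambda>z. Re z ^ k)" "integrable cn1 (\<lambda>z. Im z ^ k)"
  "integral\<^sup>L cn1 Re = 0" "integral\<^sup>L cn1 Im = 0"
  "integral\<^sup>L cn1 (\<lambda>z. (Re z)^2) = 1/2" "integral\<^sup>L cn1 (\<lambda>z. (Im z)^2) = 1/2"
proof -
  interpret g: prob_space gauss1 by (rule prob_space_gauss1)
  interpret gg: pair_prob_space gauss1 gauss1 ..
  have r: "distr cn1 gauss1 Re = gauss1"
  proof (rule measure_eqI)
    fix A assume "A \<in> sets (distr cn1 gauss1 Re)"
    then have [measurable]: "A \<in> sets borel" by simp
    have "emeasure (distr cn1 gauss1 Re) A = (\<integral>\<^sup>+z. indicator A (Re z) * (\<lambda>_. 1) (Im z) \<partial>cn1)"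
      by (subst nn_integral_indicator[symmetric], simp, subst nn_integral_distr) simp_all
    then show "emeasure (distr cn1 gauss1 Re) A = emeasure gauss1 A"
      by (subst (asm) nn_integral_cn1_prod) (simp_all add: g.emeasure_space_1[simplified])
  qed simp
  have i: "distr cn1 gauss1 Im = gauss1"
  proof (rule measure_eqI)
    fix A assume "A \<in> sets (distr cn1 gauss1 Im)"
    then have [measurable]: "A \<in> sets borel" by simp
    have "emeasure (distr cn1 gauss1 Im) A = (\<integral>\<^sup>+z. (\<lambda>_. 1) (Re z) * indicator A (Im z) \<partial>cn1)"
      by (subst nn_integral_indicator[symmetric], simp, subst nn_integral_distr) simp_all
    then show "emeasure (distr cn1 gauss1 Im) A = emeasure gauss1 A"
      by (subst (asm) nn_integral_cn1_prod) (simp_all add: g.emeasure_space_1[simplified])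
  qed simp
  have ri: "integrable cn1 (\<lambda>z. F (Re z)) = integrable gauss1 F" "integrable cn1 (\<lambda>z. F (Im z)) = integrable gauss1 F"
    "integral\<^sup>L cn1 (\<lambda>z. F (Re z)) = integral\<^sup>L gauss1 F" "integral\<^sup>L cn1 (\<lambda>z. F (Im z)) = integral\<^sup>L gauss1 F"
    if [measurable]: "F \<in> borel_measurable borel" for F :: "real \<Rightarrow> real"
    using integrable_distr_eq[of Re cn1 gauss1 F] integrable_distr_eq[of Im cn1 gauss1 F]
      integral_distr[of Re cn1 gauss1 F] integral_distr[of Im cn1 gauss1 F] by (simp_all add: r i)
  show "integrable cn1 (\<lambda>z. Re z ^ k)" "integrable cn1 (\<lambda>z. Im z ^ k)"
    using ri(1,2)[of "\<lambda>x. x ^ k"] gauss1_moments by auto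
  show "integral\<^sup>L cn1 Re = 0" "integral\<^sup>L cn1 Im = 0"
    using ri(3,4)[of "\<lambda>x. x"] gauss1_moments by auto
  show "integral\<^sup>L cn1 (\<lambda>z. (Re z)^2) = 1/2" "integral\<^sup>L cn1 (\<lambda>z. (Im z)^2) = 1/2"
    using ri(3,4)[of "\<lambda>x. x\<^sup>2"] gauss1_moments by auto
qed

section \<open>Entries and projections of the Gaussian vector law\<close>

lemma space_cn_vec [simp]: "space cn_vec = UNIV"
  and sets_cn_vec [simp, measurable_cong]: "sets cn_vec = sets borel"
  by (simp_all add: cn_vec_def)

lemma norm_vec_complex_square:
  "(norm (w::complex^'r::finite))^2 = (\<Sum>k\<in>UNIV. (Re (w$k))^2 + (Im (w$k))^2)"
  by (simp add: norm_vec_def L2_set_def real_sqrt_pow2 sum_nonneg cmod_power2)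

lemma prod_Basis_complex_vec:
  fixes F :: "complex^'r::finite \<Rightarrow> 'b::comm_monoid_mult"
  shows "(\<Prod>b\<in>Basis. F b) = (\<Prod>k\<in>UNIV. F (axis k 1) * F (axis k \<i>))"
proof -
  have "(Basis :: (complex^'r) set) = (\<Union>k\<in>UNIV. {axis k 1, axis k \<i>})"
    by (auto simp: Basis_vec_def Basis_complex_def)
  then have "(\<Prod>b\<in>Basis. F b) = prod F (\<Union>k\<in>UNIV. {axis k 1, axis k \<i>})"
    by simp
  also have "\<dots> = (\<Prod>k\<in>UNIV. \<Prod>b\<in>{axis k 1, axis k \<i>}. F b)"
    by (rule prod.UNION_disjoint) (auto simp: axis_eq_axis)
  also have "\<dots> = (\<Prod>k\<in>UNIV. F (axis k 1) * F (axis k \<i>))"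
    by (intro prod.cong refl) (simp add: axis_eq_axis)
  finally show ?thesis .
qed

lemma nn_integral_cn_vec_prod:
  fixes f g :: "'r::finite \<Rightarrow> real \<Rightarrow> ennreal"
  assumes [measurable]: "\<And>k. f k \<in> borel_measurable borel" "\<And>k. g k \<in> borel_measurable borel"
  shows "(\<integral>\<^sup>+w. (\<Prod>k\<in>UNIV. f k (Re (w$k)) * g k (Im (w$k))) \<partial>(cn_vec :: (complex^'r) measure))
      = (\<Prod>k\<in>UNIV. (\<integral>\<^sup>+x. f k x \<partial>gauss1) * (\<integral>\<^sup>+x. g k x \<partial>gauss1))"
proof -
  define D where "D = (\<lambda>x::real. ennreal (exp (- x\<^sup>2) / sqrt pi))"
  have [measurable]: "D \<in> borel_measurable borel" by (simp add: D_def)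
  \<comment> \<open>The product rule for Lebesgue measure expects a family indexed by basis vectors.
    The index \<open>k\<close> is recovered from the vector, and the two kinds of basis vectors
    carry the real and the imaginary factor.\<close>
  define F where "F = (\<lambda>b::complex^'r. if \<exists>k. b = axis k 1 then (\<lambda>x. D x * f (THE k. b = axis k 1) x) else (\<lambda>x. D x * g (THE k. b = axis k \<i>) x))"
  have F: "F (axis k 1) = (\<lambda>x. D x * f k x)" "F (axis k \<i>) = (\<lambda>x. D x * g k x)" for k
    by (auto simp: F_def axis_eq_axis)
  have [measurable]: "F b \<in> borel_measurable borel" for b by (simp add: F_def)
  have dens: "ennreal (exp (- (norm w)\<^sup>2) / pi ^ CARD('r)) = (\<Prod>k\<in>UNIV. D (Re (w$k)) * D (Im (w$k)))" for w :: "complex^'r"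
  proof -
    have "(\<Prod>k\<in>UNIV. D (Re (w$k)) * D (Im (w$k))) = (\<Prod>k\<in>UNIV. ennreal (exp (- ((Re (w$k))^2 + (Im (w$k))^2)) / pi))"
      by (intro prod.cong refl) (simp add: D_def ennreal_mult[symmetric] exp_add[symmetric])
    also have "\<dots> = ennreal (\<Prod>k\<in>UNIV. exp (- ((Re (w$k))^2 + (Im (w$k))^2)) / pi)"
      by (rule prod_ennreal) simp
    also have "(\<Prod>k\<in>UNIV. exp (- ((Re (w$k))^2 + (Im (w$k))^2)) / pi) = exp (- (norm w)\<^sup>2) / pi ^ CARD('r)"
      by (simp add: prod_dividef exp_sum[symmetric] norm_vec_complex_square sum_negf[symmetric])
    finally show ?thesis by simp
  qed
  have [measurable]: "(\<lambda>w::complex^'r. \<Prod>k\<in>UNIV. D (Re (w $ k)) * D (Im (w $ k))) \<in> borel_measurable borel"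
    "(\<lambda>w::complex^'r. \<Prod>k\<in>UNIV. f k (Re (w $ k)) * g k (Im (w $ k))) \<in> borel_measurable borel"
    by measurable
  have "(\<integral>\<^sup>+w. (\<Prod>k\<in>UNIV. f k (Re (w$k)) * g k (Im (w$k))) \<partial>(cn_vec :: (complex^'r) measure))
     = (\<integral>\<^sup>+w. (\<Prod>b\<in>Basis. F b (w \<bullet> b)) \<partial>lborel)"
    unfolding cn_vec_def
    by (subst nn_integral_density)
       (auto simp: dens prod_Basis_complex_vec F inner_axis inner_complex_def prod.distrib[symmetric] mult_ac intro!: nn_integral_cong prod.cong)
  also have "\<dots> = (\<Prod>b\<in>Basis. \<integral>\<^sup>+x. F b x \<partial>lborel)"
    by (rule nn_integral_lborel_prod) auto
  also have "\<dots> = (\<Prod>k\<in>UNIV. (\<integral>\<^sup>+x. D x * f k x \<partial>lborel) * (\<integral>\<^sup>+x. D x * g k x \<partial>lborel))"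
    by (simp add: prod_Basis_complex_vec F)
  finally show ?thesis
    by (simp add: gauss1_def nn_integral_density normal_density_half D_def)
qed

lemma prob_space_cn_vec: "prob_space (cn_vec :: (complex^'r::finite) measure)"
proof
  have "emeasure (cn_vec :: (complex^'r) measure) UNIV = (\<integral>\<^sup>+w. (\<Prod>k\<in>UNIV. (\<lambda>_. 1) (Re (w$k)) * (\<lambda>_. 1) (Im (w$k))) \<partial>(cn_vec :: (complex^'r) measure))"
    by simp
  also have "\<dots> = 1"
    by (subst nn_integral_cn_vec_prod) (simp_all add: prob_space.emeasure_space_1[OF prob_space_gauss1, simplified])
  finally show "emeasure (cn_vec :: (complex^'r) measure) (space cn_vec) = 1" by simp
qed

lemma distr_cn_vec_component: "distr cn_vec borel (\<lambda>w::complex^'r::finite. w $ j) = cn1"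
proof -
  interpret g: prob_space gauss1 by (rule prob_space_gauss1)
  interpret c: prob_space "cn_vec :: (complex^'r) measure" by (rule prob_space_cn_vec)
  let ?N = "distr cn_vec (borel \<Otimes>\<^sub>M borel) (\<lambda>w::complex^'r. (Re (w $ j), Im (w $ j)))"
  have "gauss1 \<Otimes>\<^sub>M gauss1 = ?N"
  proof (rule pair_measure_eqI)
    show "sigma_finite_measure gauss1" "sigma_finite_measure gauss1" by unfold_locales
    show "sets (gauss1 \<Otimes>\<^sub>M gauss1) = sets ?N" by (simp cong: sets_pair_measure_cong)
    fix A B assume "A \<in> sets gauss1" "B \<in> sets gauss1"
    then have [measurable]: "A \<in> sets borel" "B \<in> sets borel" by auto
    \<comment> \<open>Factors equal to 1 integrate out all entries other than
      \<open>j\<close>.\<close>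
    define f g :: "'r \<Rightarrow> real \<Rightarrow> ennreal" where "f k = (if k = j then indicator A else (\<lambda>_. 1))" and "g k = (if k = j then indicator B else (\<lambda>_. 1))" for k
    have [measurable]: "f k \<in> borel_measurable borel" "g k \<in> borel_measurable borel" for k by (simp_all add: f_def g_def)
    have "emeasure ?N (A \<times> B) = (\<integral>\<^sup>+w. indicator (A \<times> B) (Re (w $ j), Im (w $ j)) \<partial>cn_vec)"
      by (subst nn_integral_indicator[symmetric], simp, subst nn_integral_distr) simp_all
    also have "\<dots> = (\<integral>\<^sup>+w. (\<Prod>k\<in>UNIV. f k (Re (w$k)) * g k (Im (w$k))) \<partial>cn_vec)"
    proof (intro nn_integral_cong)
      fix w :: "complex^'r"
      have "(\<Prod>k\<in>UNIV. f k (Re (w$k)) * g k (Im (w$k))) = (\<Prod>k\<in>{j}. f k (Re (w$k)) * g k (Im (w$k)))"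
        by (rule prod.mono_neutral_right) (auto simp: f_def g_def)
      then show "indicator (A \<times> B) (Re (w $ j), Im (w $ j)) = (\<Prod>k\<in>UNIV. f k (Re (w$k)) * g k (Im (w$k)))"
        by (simp add: f_def g_def indicator_times)
    qed
    also have "\<dots> = (\<Prod>k\<in>UNIV. (\<integral>\<^sup>+x. f k x \<partial>gauss1) * (\<integral>\<^sup>+x. g k x \<partial>gauss1))"
      by (rule nn_integral_cn_vec_prod) auto
    also have "\<dots> = (\<Prod>k\<in>{j}. (\<integral>\<^sup>+x. f k x \<partial>gauss1) * (\<integral>\<^sup>+x. g k x \<partial>gauss1))"
      by (rule prod.mono_neutral_right) (auto simp: f_def g_def g.emeasure_space_1[simplified])
    also have "\<dots> = emeasure gauss1 A * emeasure gauss1 B" by (simp add: f_def g_def)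
    finally show "emeasure gauss1 A * emeasure gauss1 B = emeasure ?N (A \<times> B)" by simp
  qed
  then have "cn1 = distr ?N borel (\<lambda>(x, y). Complex x y)" by (simp add: cn1_def)
  also have "\<dots> = distr cn_vec borel (\<lambda>w::complex^'r. w $ j)"
    by (subst distr_distr) (auto simp: comp_def)
  finally show ?thesis by simp
qed

lemma distr_cn_vec_orthogonal_transformation:
  fixes f :: "complex^'r::finite \<Rightarrow> complex^'r"
  assumes f: "orthogonal_transformation f"
  shows "distr cn_vec borel f = (cn_vec :: (complex^'r::finite) measure)"
proof -
  note measurable_orthogonal_transformation[OF f, measurable]
  have nf: "norm (f x) = norm x" for x using f by (simp add: orthogonal_transformation)
  define D where "D = (\<lambda>w::complex^'r. ennreal (exp (- (norm w)\<^sup>2) / pi ^ CARD('r)))"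
  have [measurable]: "D \<in> borel_measurable borel" by (simp add: D_def)
  have "cn_vec = density (distr lborel borel f) D"
    by (simp add: cn_vec_def D_def lborel_distr_orthogonal_transformation[OF f])
  also have "\<dots> = distr (density lborel (\<lambda>x. D (f x))) borel f"
    by (rule density_distr) auto
  finally show ?thesis by (simp add: D_def nf cn_vec_def)
qed

text \<open>Some unitary map preserving \<open>cn_vec\<close> turns the projection onto
  \<open>u\<close> into a coordinate, so the projection has the law of a single entry.\<close>

lemma distr_cn_vec_cinner:
  fixes u :: "complex^'r::finite"
  assumes "norm u = 1"
  shows "distr cn_vec borel (cinner u) = cn1"
proof -
  obtain k :: 'r where True by blast
  define e :: "complex^'r" where "e = axis k 1"
  have ce: "cinner e w = w $ k" for w
  proof -
    have "cinner e w = (\<Sum>j\<in>{k}. cnj (e$j) * w$j)"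
      unfolding cinner_def by (rule sum.mono_neutral_right) (auto simp: e_def axis_def)
    then show ?thesis by (simp add: e_def)
  qed
  obtain f where f: "orthogonal_transformation f" "\<And>w. cinner e (f w) = cinner u w"
    using ex_orthogonal_transformation_cinner[of u e] assms by (auto simp: e_def)
  note measurable_orthogonal_transformation[OF f(1), measurable]
  have "cn1 = distr cn_vec borel (cinner e)" by (subst ce[abs_def]) (rule distr_cn_vec_component[symmetric])
  also have "\<dots> = distr (distr cn_vec borel f) borel (cinner e)"
    by (simp add: distr_cn_vec_orthogonal_transformation[OF f(1)])
  also have "\<dots> = distr cn_vec borel (cinner u)"
    by (subst distr_distr) (auto simp: comp_def f(2))
  finally show ?thesis by simp
qed

subsection \<open>Blocks of channel uses\<close>

abbreviation cn_blk :: "nat \<Rightarrow> (nat \<Rightarrow> complex) measure" where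
  "cn_blk n \<equiv> PiM {..<n} (\<lambda>_. cn1)"

lemma product_prob_space_cn1: "product_prob_space (\<lambda>_. cn1)"
  and product_prob_space_cn_vec: "product_prob_space (\<lambda>_. cn_vec :: (complex^'r::finite) measure)"
  using prob_space_cn1 prob_space_cn_vec
  by (auto intro!: product_prob_space.intro product_sigma_finite.intro product_prob_space_axioms.intro prob_space_imp_sigma_finite)

lemma prob_space_cn_blk: "prob_space (cn_blk n)"
  by (intro prob_space_PiM prob_space_cn1)

lemma prob_space_noise_blk: "prob_space (noise_blk n)"
  unfolding noise_blk_def by (intro prob_space_PiM prob_space_cn_vec)

lemma sets_noise_blk [measurable_cong]: "sets (noise_blk n) = sets (out_space n)"
  unfolding noise_blk_def out_space_def by (intro sets_PiM_cong) auto

text \<open>With \<open>u = sgn h\<close> this is the only part of the noise that enters the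
  threshold events. The restriction to indices below \<open>n\<close> makes it a point of the
  extensional product space.\<close>

definition rows_dir :: "nat \<Rightarrow> complex^'r::finite \<Rightarrow> (nat \<Rightarrow> complex^'r) \<Rightarrow> nat \<Rightarrow> complex" where
  "rows_dir n u W = (\<lambda>i\<in>{..<n}. cinner u (W i))"

lemma rows_dir_apply: "i < n \<Longrightarrow> rows_dir n u W i = cinner u (W i)"
  by (simp add: rows_dir_def)

lemma measurable_out_component [measurable (raw)]:
  "i < n \<Longrightarrow> (\<lambda>Y. Y i) \<in> borel_measurable (out_space n)"
  unfolding out_space_def by (rule measurable_component_singleton) simp

lemma measurable_out_dest:
  "f \<in> measurable M (out_space n) \<Longrightarrow> i < n \<Longrightarrow> (\<lambda>x. f x i) \<in> borel_measurable M"
  by (rule measurable_compose[OF _ measurable_out_component])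

lemma measurable_rows_dir [measurable (raw)]:
  fixes f :: "'b \<Rightarrow> complex^'r::finite"
  assumes [measurable]: "f \<in> borel_measurable M" "g \<in> measurable M (out_space n)"
  shows "(\<lambda>x. rows_dir n (f x) (g x)) \<in> measurable M (cn_blk n)"
proof -
  note measurable_out_dest[OF assms(2), measurable]
  show ?thesis unfolding rows_dir_def by measurable
qed

lemma distr_noise_blk_rows_dir:
  fixes u :: "complex^'r::finite"
  assumes u: "norm u = 1"
  shows "distr (noise_blk n) (cn_blk n) (rows_dir n u) = cn_blk n"
proof -
  have "distr (noise_blk n) (cn_blk n) (compose {..<n} (cinner u)) = PiM {..<n} (\<lambda>_. distr (cn_vec :: (complex^'r) measure) cn1 (cinner u))"
    unfolding noise_blk_def
    by (rule distr_PiM_finite_prob_space) (auto intro: product_prob_space_cn1 product_prob_space_cn_vec)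
  also have "distr (cn_vec :: (complex^'r) measure) cn1 (cinner u) = cn1"
    using distr_cn_vec_cinner[OF u] by (simp cong: distr_cong)
  also have "compose {..<n} (cinner u) = rows_dir n u"
    by (simp add: fun_eq_iff compose_def rows_dir_def)
  finally show ?thesis .
qed

lemma nn_integral_rows_dir:
  assumes u: "norm u = 1" and [measurable]: "F \<in> borel_measurable (cn_blk n)"
  shows "(\<integral>\<^sup>+W. F (rows_dir n u W) \<partial>noise_blk n) = (\<integral>\<^sup>+z. F z \<partial>cn_blk n)"
  using nn_integral_distr[of "rows_dir n u" "noise_blk n" "cn_blk n" F]
  by (simp add: distr_noise_blk_rows_dir[OF u])

lemma measurable_chan_out [measurable (raw)]:
  fixes f :: "'b \<Rightarrow> complex^'r::finite"
  assumes [measurable]: "f \<in> borel_measurable M" "g \<in> measurable M (out_space n)"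
  shows "(\<lambda>p. chan_out n x (f p) (g p)) \<in> measurable M (out_space n)"
proof -
  have [measurable]: "(\<lambda>h::complex^'r. (\<chi> k. x i * h $ k)) \<in> borel_measurable borel" for i
    by (intro borel_measurable_continuous_onI continuous_intros)
  note measurable_out_dest[OF assms(2), measurable]
  have "(\<lambda>p. chan_out n x (f p) (g p)) \<in> measurable M (PiM {..<n} (\<lambda>_. borel))"
    unfolding chan_out_def by measurable
  then show ?thesis by (simp add: out_space_def)
qed

text \<open>The Gaussian shift formula. The factor 2 in the exponent reflects variance 1/2 per real
  coordinate.\<close>

lemma cn_vec_translate:
  fixes m :: "complex^'r::finite"
  shows "distr cn_vec cn_vec ((+) m) = density cn_vec (\<lambda>y. ennreal (exp (2 * (m \<bullet> y) - (norm m)^2)))"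
proof (rule measure_eqI)
  fix A assume "A \<in> sets (distr cn_vec cn_vec ((+) m))"
  then have A[measurable]: "A \<in> sets borel" by simp
  let ?D = "\<lambda>y::complex^'r. ennreal (exp (- (norm y)\<^sup>2) / pi ^ CARD('r))"
  have "emeasure (distr cn_vec cn_vec ((+) m)) A = (\<integral>\<^sup>+w. indicator A (m + w) \<partial>cn_vec)"
    by (subst nn_integral_indicator[symmetric], simp, subst nn_integral_distr)
       (simp, rule borel_measurable_indicator, simp_all)
  also have "\<dots> = (\<integral>\<^sup>+w. ?D w * indicator A (m + w) \<partial>lborel)"
    by (simp add: cn_vec_def nn_integral_density)
  also have "\<dots> = (\<integral>\<^sup>+w. (\<lambda>y. ?D (y - m) * indicator A y) (w + m) \<partial>lborel)"
    by (simp add: add.commute)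
  also have "\<dots> = (\<integral>\<^sup>+y. ?D (y - m) * indicator A y \<partial>lborel)"
    by (rule nn_integral_lborel_translate) measurable
  also have "\<dots> = (\<integral>\<^sup>+y. ?D y * (ennreal (exp (2 * (m \<bullet> y) - (norm m)^2)) * indicator A y) \<partial>lborel)"
  proof (intro nn_integral_cong)
    fix y
    have "- (norm (y - m))\<^sup>2 = - (norm y)\<^sup>2 + (2 * (m \<bullet> y) - (norm m)^2)"
      by (simp add: power2_norm_eq_inner inner_diff_left inner_diff_right inner_commute)
    then show "?D (y - m) * indicator A y = ?D y * (ennreal (exp (2 * (m \<bullet> y) - (norm m)^2)) * indicator A y)"
      by (simp only: exp_add) (simp add: ennreal_mult[symmetric] mult.assoc[symmetric])
  qed
  also have "\<dots> = emeasure (density cn_vec (\<lambda>y. ennreal (exp (2 * (m \<bullet> y) - (norm m)^2)))) A"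
    by (simp add: emeasure_density cn_vec_def nn_integral_density)
  finally show "emeasure (distr cn_vec cn_vec ((+) m)) A = emeasure (density cn_vec (\<lambda>y. ennreal (exp (2 * (m \<bullet> y) - (norm m)^2)))) A" .
qed simp

text \<open>Likelihood ratio of the output for input \<open>x\<close> and fading \<open>h\<close> to
  pure noise. Pure noise is the common reference law for all codewords and for the output law used
  in the converse.\<close>

definition shift_dens :: "nat \<Rightarrow> (nat \<Rightarrow> complex) \<Rightarrow> complex^'r::finite \<Rightarrow> (nat \<Rightarrow> complex^'r) \<Rightarrow> real" where
  "shift_dens n x h Y = (\<Prod>i<n. exp (2 * ((\<chi> k. x i * h $ k) \<bullet> Y i) - (norm (\<chi> k. x i * h $ k))^2))"

lemma measurable_shift_dens [measurable (raw)]: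
  fixes f :: "'b \<Rightarrow> complex^'r::finite"
  assumes [measurable]: "f \<in> borel_measurable M" "g \<in> measurable M (out_space n)"
  shows "(\<lambda>p. shift_dens n x (f p) (g p)) \<in> borel_measurable M"
proof -
  have [measurable]: "(\<lambda>h::complex^'r. (\<chi> k. x i * h $ k)) \<in> borel_measurable borel" for i
    by (intro borel_measurable_continuous_onI continuous_intros)
  note measurable_out_dest[OF assms(2), measurable]
  have [measurable]: "(\<lambda>p. (\<chi> k. x i * f p $ k)) \<in> borel_measurable M" for i
    by measurable
  show ?thesis unfolding shift_dens_def by measurable
qed

lemma nn_integral_chan_out:
  fixes h :: "complex^'r::finite"
  assumes [measurable]: "f \<in> borel_measurable (out_space n)"
  shows "(\<integral>\<^sup>+W. f (chan_out n x h W) \<partial>noise_blk n) = (\<integral>\<^sup>+Y. ennreal (shift_dens n x h Y) * f Y \<partial>noise_blk n)"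
proof -
  define m where "m = (\<lambda>i. \<chi> k. x i * h $ k)"
  define d where "d = (\<lambda>i y. ennreal (exp (2 * (m i \<bullet> y) - (norm (m i))^2)))"
  have [measurable]: "d i \<in> borel_measurable borel" for i by (simp add: d_def)
  have dm: "d i \<in> borel_measurable cn_vec" for i by measurable
  let ?M = "\<lambda>i. density (cn_vec :: (complex^'r) measure) (d i)"
  interpret c: prob_space "cn_vec :: (complex^'r) measure" by (rule prob_space_cn_vec)
  interpret N: product_prob_space "\<lambda>_::nat. cn_vec :: (complex^'r) measure" by (rule product_prob_space_cn_vec)
  have M: "?M i = distr cn_vec cn_vec ((+) (m i))" for i by (simp add: cn_vec_translate d_def)
  have pM: "prob_space (?M i)" for i unfolding M by (rule c.prob_space_distr) simp
  interpret M: product_prob_space ?M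
    using pM by (auto intro!: product_prob_space.intro product_sigma_finite.intro product_prob_space_axioms.intro prob_space_imp_sigma_finite)
  have sets_M [measurable_cong]: "sets (PiM {..<n} ?M) = sets (out_space n)"
    unfolding out_space_def by (intro sets_PiM_cong) auto
  have sh: "shift_dens n x h Y = (\<Prod>i<n. exp (2 * (m i \<bullet> Y i) - (norm (m i))^2))" for Y
    by (simp add: shift_dens_def m_def)
  \<comment> \<open>The law of the output and the noise law reweighted by \<open>shift_dens\<close>
    are both identified, on rectangles, with the product of the shifted row laws.\<close>
  have 1: "distr (noise_blk n) (out_space n) (chan_out n x h) = PiM {..<n} ?M"
  proof (rule M.PiM_eqI)
    fix A assume A: "\<And>i. i \<in> {..<n} \<Longrightarrow> A i \<in> sets (?M i)"
    have "emeasure (distr (noise_blk n) (out_space n) (chan_out n x h)) (Pi\<^sub>E {..<n} A)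
      = emeasure (noise_blk n) (chan_out n x h -` (Pi\<^sub>E {..<n} A) \<inter> space (noise_blk n))"
    proof (rule emeasure_distr)
      show "chan_out n x h \<in> measurable (noise_blk n) (out_space n)"
        using measurable_chan_out[of "\<lambda>_. h" "noise_blk n" "\<lambda>W. W" n x] by simp
      show "Pi\<^sub>E {..<n} A \<in> sets (out_space n)"
        unfolding out_space_def using A by (auto intro!: sets_PiM_I_finite)
    qed
    also have "chan_out n x h -` (Pi\<^sub>E {..<n} A) \<inter> space (noise_blk n) = (\<Pi>\<^sub>E i\<in>{..<n}. (+) (m i) -` A i)"
      by (auto simp: chan_out_def m_def noise_blk_def space_PiM PiE_iff)
    also have "emeasure (noise_blk n) \<dots> = (\<Prod>i<n. emeasure cn_vec ((+) (m i) -` A i))"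
      unfolding noise_blk_def using A
      by (subst N.emeasure_PiM) (auto intro!: measurable_sets_borel[of _ borel] prod.cong)
    also have "\<dots> = (\<Prod>i<n. emeasure (?M i) (A i))"
      unfolding M using A by (intro prod.cong refl) (simp add: emeasure_distr)
    finally show "emeasure (distr (noise_blk n) (out_space n) (chan_out n x h)) (Pi\<^sub>E {..<n} A) = (\<Prod>i\<in>{..<n}. emeasure (?M i) (A i))" by simp
  qed (simp_all add: sets_M)
  have 2: "density (noise_blk n) (\<lambda>Y. ennreal (shift_dens n x h Y)) = PiM {..<n} ?M"
  proof (rule M.PiM_eqI)
    fix A assume A: "\<And>i. i \<in> {..<n} \<Longrightarrow> A i \<in> sets (?M i)"
    then have [measurable]: "i < n \<Longrightarrow> A i \<in> sets borel" for i by simp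
    have E: "Pi\<^sub>E {..<n} A \<in> sets (out_space n)" unfolding out_space_def using A by (auto intro!: sets_PiM_I_finite)
    have "emeasure (density (noise_blk n) (\<lambda>Y. ennreal (shift_dens n x h Y))) (Pi\<^sub>E {..<n} A)
       = (\<integral>\<^sup>+Y. ennreal (shift_dens n x h Y) * indicator (Pi\<^sub>E {..<n} A) Y \<partial>noise_blk n)"
      using E by (subst emeasure_density) (auto simp: sets_noise_blk)
    also have "\<dots> = (\<integral>\<^sup>+Y. (\<Prod>i<n. d i (Y i) * indicator (A i) (Y i)) \<partial>noise_blk n)"
    proof (rule nn_integral_cong)
      fix Y :: "nat \<Rightarrow> complex^'r" assume "Y \<in> space (noise_blk n)"
      then have "indicator (Pi\<^sub>E {..<n} A) Y = (\<Prod>i<n. indicator (A i) (Y i) :: ennreal)"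
        by (auto simp: noise_blk_def space_PiM PiE_iff indicator_def prod_zero_iff)
      then show "ennreal (shift_dens n x h Y) * indicator (Pi\<^sub>E {..<n} A) Y = (\<Prod>i<n. d i (Y i) * indicator (A i) (Y i))"
        by (simp add: sh d_def prod.distrib prod_ennreal)
    qed
    also have "\<dots> = (\<Prod>i<n. \<integral>\<^sup>+y. d i y * indicator (A i) y \<partial>cn_vec)"
      unfolding noise_blk_def
    proof (rule N.product_nn_integral_prod)
      fix i assume "i \<in> {..<n}"
      then have "A i \<in> sets (cn_vec :: (complex^'r) measure)" using A by simp
      then show "(\<lambda>y. d i y * indicator (A i) y) \<in> borel_measurable cn_vec"
        by (intro borel_measurable_times_ennreal borel_measurable_indicator dm)
    qed simp
    also have "\<dots> = (\<Prod>i<n. emeasure (?M i) (A i))"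
      using A by (intro prod.cong refl) (simp add: emeasure_density[OF dm])
    finally show "emeasure (density (noise_blk n) (\<lambda>Y. ennreal (shift_dens n x h Y))) (Pi\<^sub>E {..<n} A) = (\<Prod>i\<in>{..<n}. emeasure (?M i) (A i))" by simp
  qed (simp_all add: sets_M sets_noise_blk)
  have "(\<integral>\<^sup>+W. f (chan_out n x h W) \<partial>noise_blk n) = (\<integral>\<^sup>+Y. f Y \<partial>distr (noise_blk n) (out_space n) (chan_out n x h))"
    by (subst nn_integral_distr) simp_all
  also have "\<dots> = (\<integral>\<^sup>+Y. f Y \<partial>density (noise_blk n) (\<lambda>Y. ennreal (shift_dens n x h Y)))"
    by (simp only: 1 2)
  finally show ?thesis by (simp add: nn_integral_density)
qed

text \<open>Normalization of the auxiliary output law: its ratio to pure noise is a probability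
  density. Only the projections onto \<open>u\<close> occur, so scalar Gaussian integrals
  suffice.\<close>

lemma nn_integral_output_dens:
  fixes u :: "complex^'r::finite"
  assumes u: "norm u = 1" and c: "c < 1"
  shows "(\<integral>\<^sup>+Y. (\<Prod>i<n. ennreal ((1 - c) * exp (c * (cmod (cinner u (Y i)))^2))) \<partial>noise_blk n) = 1"
proof -
  interpret N: product_prob_space "\<lambda>_::nat. cn1" by (rule product_prob_space_cn1)
  have one: "(\<integral>\<^sup>+z. ennreal ((1 - c) * exp (c * (cmod z)^2)) \<partial>cn1) = 1"
  proof -
    have "(\<integral>\<^sup>+z. ennreal ((1 - c) * exp (c * (cmod z)^2)) \<partial>cn1) = ennreal (1 - c) * (\<integral>\<^sup>+z. ennreal (exp (c * (cmod z)^2)) \<partial>cn1)"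
      using c by (subst nn_integral_cmult[symmetric]) (auto simp: ennreal_mult)
    also have "\<dots> = ennreal (1 - c) * ennreal (1 / (1 - c))"
      using cn1_tilt[of "- c" 0] c by simp
    finally show ?thesis using c by (simp add: ennreal_mult[symmetric])
  qed
  have "(\<integral>\<^sup>+Y. (\<Prod>i<n. ennreal ((1 - c) * exp (c * (cmod (cinner u (Y i)))^2))) \<partial>noise_blk n)
     = (\<integral>\<^sup>+Y. (\<lambda>z. \<Prod>i<n. ennreal ((1 - c) * exp (c * (cmod (z i))^2))) (rows_dir n u Y) \<partial>noise_blk n)"
    by (simp add: rows_dir_apply)
  also have "\<dots> = (\<integral>\<^sup>+z. (\<Prod>i<n. ennreal ((1 - c) * exp (c * (cmod (z i))^2))) \<partial>cn_blk n)"
    by (rule nn_integral_rows_dir[OF u]) measurable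
  also have "\<dots> = 1"
    by (subst N.product_nn_integral_prod) (simp_all add: one)
  finally show ?thesis .
qed

text \<open>Cross terms factor by independence and vanish because the summands are centred, so
  second moments add.\<close>

lemma PiM_sum_moments:
  fixes f :: "nat \<Rightarrow> 'a \<Rightarrow> real"
  assumes "prob_space M" "finite I"
    and f: "\<And>i. i \<in> I \<Longrightarrow> integrable M (f i)" "\<And>i. i \<in> I \<Longrightarrow> integral\<^sup>L M (f i) = 0"
      "\<And>i. i \<in> I \<Longrightarrow> integrable M (\<lambda>x. (f i x)^2)"
  shows "integrable (PiM I (\<lambda>_. M)) (\<lambda>z. \<Sum>i\<in>I. f i (z i))"
    "integral\<^sup>L (PiM I (\<lambda>_. M)) (\<lambda>z. \<Sum>i\<in>I. f i (z i)) = 0"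
    "integrable (PiM I (\<lambda>_. M)) (\<lambda>z. (\<Sum>i\<in>I. f i (z i))^2)"
    "integral\<^sup>L (PiM I (\<lambda>_. M)) (\<lambda>z. (\<Sum>i\<in>I. f i (z i))^2) = (\<Sum>i\<in>I. integral\<^sup>L M (\<lambda>x. (f i x)^2))"
proof -
  interpret M: prob_space M by fact
  interpret P: product_prob_space "\<lambda>_::nat. M" ..
  let ?P = "PiM I (\<lambda>_. M)"
  have dist: "distr ?P M (\<lambda>z. z i) = M" if "i \<in> I" for i
    using distr_PiM_component[of I "\<lambda>_. M" i] that M.prob_space_axioms by simp
  have meas: "(\<lambda>z. z i) \<in> measurable ?P M" if "i \<in> I" for i
    using that by (rule measurable_component_singleton)
  have single: "integrable ?P (\<lambda>z. g (z i)) \<and> integral\<^sup>L ?P (\<lambda>z. g (z i)) = integral\<^sup>L M g"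
    if "i \<in> I" "integrable M g" for i and g :: "'a \<Rightarrow> real"
    using integrable_distr_eq[OF meas[OF that(1)], of g] integral_distr[OF meas[OF that(1)], of g] that dist by auto
  have cross: "integrable ?P (\<lambda>z. f i (z i) * f j (z j)) \<and> integral\<^sup>L ?P (\<lambda>z. f i (z i) * f j (z j)) = (if i = j then integral\<^sup>L M (\<lambda>x. (f i x)^2) else 0)"
    if ij: "i \<in> I" "j \<in> I" for i j
  proof (cases "i = j")
    case True
    then show ?thesis using single[OF ij(1) f(3)[OF ij(1)]] by (simp add: power2_eq_square)
  next
    case False
    \<comment> \<open>Writing the cross term as a product over all of \<open>I\<close>, with factors
      1 elsewhere, brings it into the form of the product integral rule.\<close>
    define g where "g k = (if k = i \<or> k = j then f k else (\<lambda>_. 1))" for k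
    have g: "integrable M (g k)" if "k \<in> I" for k using f(1) that by (simp add: g_def)
    have *: "(\<Prod>k\<in>I. g k (z k)) = f i (z i) * f j (z j)" for z
    proof -
      have "(\<Prod>k\<in>I. g k (z k)) = (\<Prod>k\<in>{i,j}. g k (z k))"
        using ij \<open>finite I\<close> by (intro prod.mono_neutral_right) (auto simp: g_def)
      then show ?thesis using False by (simp add: g_def)
    qed
    have "(\<Prod>k\<in>I. integral\<^sup>L M (g k)) = 0"
      using ij \<open>finite I\<close> f(2) by (intro prod_zero) (auto simp: g_def)
    with P.product_integrable_prod[where f = g, OF \<open>finite I\<close> g] P.product_integral_prod[where f = g, OF \<open>finite I\<close> g] False
    show ?thesis by (simp add: *)
  qed
  show "integrable ?P (\<lambda>z. \<Sum>i\<in>I. f i (z i))" using single f(1) by auto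
  show "integral\<^sup>L ?P (\<lambda>z. \<Sum>i\<in>I. f i (z i)) = 0" using single f by (subst Bochner_Integration.integral_sum) auto
  have sq: "(\<Sum>i\<in>I. f i (z i))^2 = (\<Sum>i\<in>I. \<Sum>j\<in>I. f i (z i) * f j (z j))" for z
    by (simp add: power2_eq_square sum_product)
  show "integrable ?P (\<lambda>z. (\<Sum>i\<in>I. f i (z i))^2)" unfolding sq using cross by auto
  show "integral\<^sup>L ?P (\<lambda>z. (\<Sum>i\<in>I. f i (z i))^2) = (\<Sum>i\<in>I. integral\<^sup>L M (\<lambda>x. (f i x)^2))"
    unfolding sq using cross \<open>finite I\<close> by (simp add: Bochner_Integration.integral_sum)
qed

text \<open>The two centred quantities in the received energy: the average of |r x_i + z_i|^2 over
  the block is r^2 times the average of |x_i|^2, plus r times \<open>fluct_lin\<close>, plus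
  \<open>fluct_energy\<close>, plus 1.\<close>

definition fluct_lin :: "nat \<Rightarrow> (nat \<Rightarrow> complex) \<Rightarrow> (nat \<Rightarrow> complex) \<Rightarrow> real" where
  "fluct_lin n x z = 2 * (\<Sum>i<n. Re (cnj (x i) * z i)) / n"

definition fluct_energy :: "nat \<Rightarrow> (nat \<Rightarrow> complex) \<Rightarrow> real" where
  "fluct_energy n z = (\<Sum>i<n. (cmod (z i))^2 - 1) / n"

text \<open>Both second moments are of order 1/n uniformly over codewords, because \<open>x\<close>
  enters only through its total energy.\<close>

lemma fluct_moments:
  assumes n: "n > 0" and x: "(\<Sum>i<n. (cmod (x i))^2) \<le> n * \<rho>"
  shows "integrable (cn_blk n) (fluct_lin n x)" "integral\<^sup>L (cn_blk n) (fluct_lin n x) = 0"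
    "integrable (cn_blk n) (\<lambda>z. (fluct_lin n x z)^2)" "integral\<^sup>L (cn_blk n) (\<lambda>z. (fluct_lin n x z)^2) \<le> 4 * \<rho> / n"
    "integrable (cn_blk n) (fluct_energy n)" "integral\<^sup>L (cn_blk n) (fluct_energy n) = 0"
    "integrable (cn_blk n) (\<lambda>z. (fluct_energy n z)^2)"
    "integral\<^sup>L (cn_blk n) (\<lambda>z. (fluct_energy n z)^2) = integral\<^sup>L cn1 (\<lambda>z. ((cmod z)^2 - 1)^2) / n"
proof -
  interpret c: prob_space cn1 by (rule prob_space_cn1)
  note m = cn1_moments
  have re: "integrable cn1 Re" "integrable cn1 Im" using m(1,2)[of 1] by auto
  define f where "f i z = Re (cnj (x i) * z)" for i z
  have sqle: "(f i z)^2 \<le> (cmod (x i))^2 * ((Re z)^2 + (Im z)^2)" for i z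
  proof -
    have "\<bar>f i z\<bar> \<le> cmod (x i) * cmod z" unfolding f_def using abs_Re_le_cmod[of "cnj (x i) * z"] by (simp add: norm_mult)
    then have "(f i z)^2 \<le> (cmod (x i) * cmod z)^2" by (simp add: abs_le_square_iff[symmetric] abs_mult)
    then show ?thesis by (simp add: power_mult_distrib cmod_power2)
  qed
  have f1: "integrable cn1 (f i)" "integral\<^sup>L cn1 (f i) = 0" for i
    using re m by (auto simp: f_def[abs_def])
  have int2: "integrable cn1 (\<lambda>z. (cmod (x i))^2 * ((Re z)^2 + (Im z)^2))" for i using m(1,2)[of 2] by auto
  have f2: "integrable cn1 (\<lambda>z. (f i z)^2)" for i
  proof (rule Bochner_Integration.integrable_bound[OF int2[of i]])
    show "(\<lambda>z. (f i z)^2) \<in> borel_measurable cn1" unfolding f_def by measurable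
    show "AE z in cn1. norm ((f i z)^2) \<le> norm ((cmod (x i))^2 * ((Re z)^2 + (Im z)^2))"
      using sqle[of i] by (intro AE_I2) simp
  qed
  have f2': "integral\<^sup>L cn1 (\<lambda>z. (f i z)^2) \<le> (cmod (x i))^2" for i
  proof -
    have "integral\<^sup>L cn1 (\<lambda>z. (f i z)^2) \<le> integral\<^sup>L cn1 (\<lambda>z. (cmod (x i))^2 * ((Re z)^2 + (Im z)^2))"
      by (intro integral_mono f2 int2 sqle)
    also have "\<dots> = (cmod (x i))^2" using m(1,2)[of 2] m(5,6) by simp
    finally show ?thesis .
  qed
  note F = PiM_sum_moments[OF c.prob_space_axioms, of "{..<n}" f, OF finite_lessThan f1 f2]
  have fl: "fluct_lin n x = (\<lambda>z. (2 / n) * (\<Sum>i<n. f i (z i)))" by (simp add: fluct_lin_def f_def fun_eq_iff)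
  show "integrable (cn_blk n) (fluct_lin n x)" "integral\<^sup>L (cn_blk n) (fluct_lin n x) = 0"
    "integrable (cn_blk n) (\<lambda>z. (fluct_lin n x z)^2)"
    unfolding fl power_mult_distrib using F by auto
  have "integral\<^sup>L (cn_blk n) (\<lambda>z. (fluct_lin n x z)^2) = (2 / n)^2 * (\<Sum>i<n. integral\<^sup>L cn1 (\<lambda>x. (f i x)^2))"
    unfolding fl power_mult_distrib using F by simp
  also have "\<dots> \<le> (2 / n)^2 * (n * \<rho>)"
    using x by (intro mult_left_mono order_trans[OF sum_mono[OF f2']]) auto
  also have "\<dots> = 4 * \<rho> / n" using n by (simp add: power2_eq_square)
  finally show "integral\<^sup>L (cn_blk n) (\<lambda>z. (fluct_lin n x z)^2) \<le> 4 * \<rho> / n" .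
  define g where "g z = (cmod z)^2 - 1" for z
  have gdef: "g = (\<lambda>z. (Re z)^2 + (Im z)^2 - 1)" by (simp add: g_def cmod_power2 fun_eq_iff)
  have g1: "integrable cn1 g" "integral\<^sup>L cn1 g = 0"
    unfolding gdef using m(1,2)[of 2] m(5,6) by (auto simp: c.prob_space[simplified])
  have int4: "integrable cn1 (\<lambda>z. 2 * (Re z)^4 + 2 * (Im z)^4 + 1)" using m(1,2)[of 4] by auto
  have g2: "integrable cn1 (\<lambda>z. (g z)^2)"
  proof (rule Bochner_Integration.integrable_bound[OF int4])
    show "(\<lambda>z. (g z)^2) \<in> borel_measurable cn1" unfolding g_def by measurable
    \<comment> \<open>Domination by fourth moments of the real and imaginary parts gives
      integrability of the squared centred energy.\<close>
    have "(a + b - 1)^2 \<le> 2 * a\<^sup>2 + 2 * b\<^sup>2 + 1" if "a \<ge> 0" "b \<ge> 0" for a b :: real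
      using that sum_squares_ge_zero[of "a - b" 0] by (simp add: power2_eq_square algebra_simps)
    from this[of "(Re z)^2" "(Im z)^2" for z]
    show "AE z in cn1. norm ((g z)^2) \<le> norm (2 * (Re z)^4 + 2 * (Im z)^4 + 1)"
      by (intro AE_I2) (simp add: gdef power_mult[symmetric])
  qed
  note G = PiM_sum_moments[OF c.prob_space_axioms, of "{..<n}" "\<lambda>_. g", OF finite_lessThan g1 g2]
  have fe: "fluct_energy n = (\<lambda>z. (1 / n) * (\<Sum>i<n. g (z i)))" by (simp add: fluct_energy_def g_def fun_eq_iff)
  show "integrable (cn_blk n) (fluct_energy n)" "integral\<^sup>L (cn_blk n) (fluct_energy n) = 0"
    "integrable (cn_blk n) (\<lambda>z. (fluct_energy n z)^2)"
    unfolding fe power_mult_distrib using G by auto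
  show "integral\<^sup>L (cn_blk n) (\<lambda>z. (fluct_energy n z)^2) = integral\<^sup>L cn1 (\<lambda>z. ((cmod z)^2 - 1)^2) / n"
    unfolding fe power_mult_distrib using G n by (simp add: g_def power2_eq_square)
qed

subsection \<open>Confusion with a Gaussian codeword\<close>

definition cdot :: "nat \<Rightarrow> (nat \<Rightarrow> complex) \<Rightarrow> (nat \<Rightarrow> complex) \<Rightarrow> complex" where
  "cdot n x y = (\<Sum>i<n. cnj (x i) * y i)"

definition energy :: "nat \<Rightarrow> (nat \<Rightarrow> complex) \<Rightarrow> real" where
  "energy n x = (\<Sum>i<n. (cmod (x i))^2)"

lemma energy_nonneg [simp]: "0 \<le> energy n x"
  by (simp add: energy_def sum_nonneg)

lemma cdot_self: "cdot n x x = of_real (energy n x)"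
  by (simp add: cdot_def energy_def complex_norm_square[symmetric] mult.commute)

lemma cnj_cdot: "cnj (cdot n x y) = cdot n y x"
  by (simp add: cdot_def mult.commute)

lemma cdot_simps:
  "cdot n x (\<lambda>i. y i + z i) = cdot n x y + cdot n x z"
  "cdot n x (\<lambda>i. y i - z i) = cdot n x y - cdot n x z"
  "cdot n x (\<lambda>i. c * y i) = c * cdot n x y"
  "cdot n (\<lambda>i. c * x i) y = cnj c * cdot n x y"
  "cdot n x (\<lambda>i. \<Sum>l\<in>L. w l i) = (\<Sum>l\<in>L. cdot n x (w l))"
proof -
  show "cdot n x (\<lambda>i. \<Sum>l\<in>L. w l i) = (\<Sum>l\<in>L. cdot n x (w l))"
    unfolding cdot_def sum_distrib_left by (rule sum.swap)
qed (simp_all add: cdot_def sum.distrib sum_subtractf distrib_left right_diff_distrib sum_distrib_left mult_ac)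

lemma cdot_cong: "(\<And>i. i < n \<Longrightarrow> x i = x' i) \<Longrightarrow> (\<And>i. i < n \<Longrightarrow> y i = y' i) \<Longrightarrow> cdot n x y = cdot n x' y'"
  by (simp add: cdot_def)

lemma energy_eq_0_iff: "energy n x = 0 \<longleftrightarrow> (\<forall>i<n. x i = 0)"
  by (auto simp: energy_def sum_nonneg_eq_0_iff)

text \<open>Gram--Schmidt; linearly dependent vectors are tolerated by admitting zero vectors in \<open>e\<close>.\<close>
lemma ex_orthonormal_expansion:
  fixes y :: "nat \<Rightarrow> nat \<Rightarrow> complex"
  shows "\<exists>e. (\<forall>l<m. \<forall>l'<m. l \<noteq> l' \<longrightarrow> cdot n (e l) (e l') = 0) \<and> (\<forall>l<m. energy n (e l) \<in> {0, 1})
    \<and> (\<forall>k<m. \<forall>i<n. y k i = (\<Sum>l<m. cdot n (e l) (y k) * e l i))"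
proof (induction m)
  case 0
  then show ?case by simp
next
  case (Suc m)
  from Suc.IH obtain e where E: "\<forall>l<m. \<forall>l'<m. l \<noteq> l' \<longrightarrow> cdot n (e l) (e l') = 0" "\<forall>l<m. energy n (e l) \<in> {0, 1}"
    "\<forall>k<m. \<forall>i<n. y k i = (\<Sum>l<m. cdot n (e l) (y k) * e l i)"
    by (elim exE conjE)
  have orth: "cdot n (e l) (e l') = 0" if "l < m" "l' < m" "l \<noteq> l'" for l l'
    using E(1) that by simp
  have unit: "energy n (e l) \<in> {0, 1}" if "l < m" for l using E(2) that by simp
  have exp: "y k i = (\<Sum>l<m. cdot n (e l) (y k) * e l i)" if "k < m" "i < n" for k i
    using E(3) that by blast
  define p where "p i = (\<Sum>l<m. cdot n (e l) (y m) * e l i)" for i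
  define z where "z i = y m i - p i" for i
  define r where "r = sqrt (energy n z)"
  \<comment> \<open>If \<open>z\<close> vanishes on the block, then \<open>inverse 0 = 0\<close>
    makes \<open>f\<close> the zero vector, the degenerate case with energy 0.\<close>
  define f where "f i = inverse (of_real r) * z i" for i
  have ip: "cdot n (e l) p = cdot n (e l) (y m)" if "l < m" for l
  proof -
    have "cdot n (e l) p = (\<Sum>l'<m. cdot n (e l') (y m) * cdot n (e l) (e l'))"
      unfolding p_def by (simp add: cdot_simps)
    also have "\<dots> = (\<Sum>l'\<in>{l}. cdot n (e l') (y m) * cdot n (e l) (e l'))"
      using that orth by (intro sum.mono_neutral_right) auto
    also have "\<dots> = cdot n (e l) (y m) * energy n (e l)" by (simp add: cdot_self)
    also have "\<dots> = cdot n (e l) (y m)"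
    proof (cases "energy n (e l) = 0")
      case True
      then show ?thesis by (simp add: energy_eq_0_iff cdot_def)
    next
      case False
      then show ?thesis using unit[OF that] by simp
    qed
    finally show ?thesis .
  qed
  have ez: "cdot n (e l) z = 0" if "l < m" for l
    unfolding z_def using ip[OF that] by (simp add: cdot_simps)
  have ef: "cdot n (e l) f = 0" if "l < m" for l
    unfolding f_def using ez[OF that] by (simp add: cdot_simps)
  have fe: "cdot n f (e l) = 0" if "l < m" for l
    using ef[OF that] cnj_cdot[of n "e l" f] by simp
  have fenergy: "energy n f \<in> {0, 1}"
  proof -
    have "energy n f = (inverse r)^2 * energy n z"
      by (simp add: energy_def f_def norm_mult power_mult_distrib sum_distrib_left norm_inverse power_inverse)
    also have "\<dots> = (inverse r)^2 * r\<^sup>2" by (simp add: r_def)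
    also have "\<dots> \<in> {0, 1}" by (cases "r = 0") (auto simp: power_mult_distrib[symmetric])
    finally show ?thesis .
  qed
  have zz: "cdot n z (y m) = r\<^sup>2"
  proof -
    have zp: "cdot n z p = 0"
    proof -
      have "cdot n z (e l) = 0" if "l < m" for l
        using ez[OF that] cnj_cdot[of n "e l" z] by simp
      then show ?thesis unfolding p_def by (simp add: cdot_simps)
    qed
    have "cdot n z (y m) = cdot n z (\<lambda>i. z i + p i)" by (simp add: z_def)
    also have "\<dots> = cdot n z z" by (simp add: cdot_simps zp)
    finally show ?thesis by (simp add: cdot_self r_def)
  qed
  have fy: "cdot n f (y m) * f i = z i" if "i < n" for i
  proof (cases "r = 0")
    case True
    then have "z i = 0" using that energy_eq_0_iff[of n z] by (simp add: r_def)
    then show ?thesis by (simp add: f_def)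
  next
    case False
    then show ?thesis unfolding f_def by (simp add: cdot_simps zz power2_eq_square)
  qed
  have fyk: "cdot n f (y k) = 0" if "k < m" for k
  proof -
    have "cdot n f (y k) = cdot n f (\<lambda>i. \<Sum>l<m. cdot n (e l) (y k) * e l i)"
      by (rule cdot_cong) (auto simp: exp[OF that, symmetric])
    then show ?thesis by (simp add: cdot_simps fe)
  qed
  define e' where "e' = e(m := f)"
  have s: "(\<Sum>l<Suc m. cdot n (e' l) (y k) * e' l i) = (\<Sum>l<m. cdot n (e l) (y k) * e l i) + cdot n f (y k) * f i" for k i
    by (simp add: e'_def)
  show ?case
  proof (intro exI[of _ e'] conjI allI impI)
    fix l l' assume "l < Suc m" "l' < Suc m" "l \<noteq> l'"
    then show "cdot n (e' l) (e' l') = 0"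
      by (auto simp: e'_def less_Suc_eq orth ef fe)
  next
    fix l assume "l < Suc m"
    then show "energy n (e' l) \<in> {0, 1}" using unit fenergy by (auto simp: e'_def less_Suc_eq)
  next
    fix k i assume "k < Suc m" and i: "i < n"
    then consider "k < m" | "k = m" by (auto simp: less_Suc_eq)
    then show "y k i = (\<Sum>l<Suc m. cdot n (e' l) (y k) * e' l i)"
    proof cases
      case 1
      then show ?thesis unfolding s using exp[OF 1 i] fyk[OF 1] by simp
    next
      case 2
      then show ?thesis unfolding s using fy[OF i] by (simp add: z_def p_def)
    qed
  qed
qed

text \<open>The vectors with entries \<open>cinner u (Y i)\<close> are the linear combinations of
  the columns of \<open>Y\<close>. The coefficients in an orthonormal expansion are linear in the
  expanded vector, so a family that expands the columns expands all combinations.\<close>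

lemma ex_orthonormal_columns:
  fixes Y :: "nat \<Rightarrow> complex^'r::finite"
  shows "\<exists>e. (\<forall>l<CARD('r). \<forall>l'<CARD('r). l \<noteq> l' \<longrightarrow> cdot n (e l) (e l') = 0) \<and> (\<forall>l<CARD('r). energy n (e l) \<in> {0, 1})
    \<and> (\<forall>u. \<forall>i<n. cinner u (Y i) = (\<Sum>l<CARD('r). cdot n (e l) (\<lambda>i. cinner u (Y i)) * e l i))"
proof -
  obtain \<phi> where \<phi>: "bij_betw \<phi> {..<CARD('r)} (UNIV :: 'r set)"
    using ex_bij_betw_nat_finite[of "UNIV :: 'r set"] by (auto simp: atLeast0LessThan)
  obtain e where e: "\<forall>l<CARD('r). \<forall>l'<CARD('r). l \<noteq> l' \<longrightarrow> cdot n (e l) (e l') = 0" "\<forall>l<CARD('r). energy n (e l) \<in> {0, 1}"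
    "\<forall>k<CARD('r). \<forall>i<n. Y i $ \<phi> k = (\<Sum>l<CARD('r). cdot n (e l) (\<lambda>i. Y i $ \<phi> k) * e l i)"
    using ex_orthonormal_expansion[where y = "\<lambda>k i. Y i $ \<phi> k" and m = "CARD('r)" and n = n] by blast
  have col: "Y i $ k = (\<Sum>l<CARD('r). cdot n (e l) (\<lambda>i. Y i $ k) * e l i)" if "i < n" for i k
  proof -
    obtain j where "j < CARD('r)" "k = \<phi> j" using \<phi> by (metis UNIV_I bij_betw_imp_surj_on imageE lessThan_iff)
    then show ?thesis using e(3) that by blast
  qed
  have 3: "cinner u (Y i) = (\<Sum>l<CARD('r). cdot n (e l) (\<lambda>i. cinner u (Y i)) * e l i)" if i: "i < n" for u i
  proof -
    have "cinner u (Y i) = (\<Sum>k\<in>UNIV. cnj (u $ k) * (\<Sum>l<CARD('r). cdot n (e l) (\<lambda>i. Y i $ k) * e l i))"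
      unfolding cinner_def by (intro sum.cong refl) (subst col[OF i, symmetric], rule refl)
    also have "\<dots> = (\<Sum>l<CARD('r). (\<Sum>k\<in>UNIV. cnj (u $ k) * cdot n (e l) (\<lambda>i. Y i $ k)) * e l i)"
      by (simp add: sum_distrib_left sum_distrib_right mult.assoc) (rule sum.swap)
    also have "\<dots> = (\<Sum>l<CARD('r). cdot n (e l) (\<lambda>i. cinner u (Y i)) * e l i)"
      unfolding cinner_def by (simp add: cdot_simps)
    finally show ?thesis .
  qed
  show ?thesis
    by (intro exI[of _ e] conjI e(1) e(2) allI impI) (rule 3)
qed

text \<open>The squared sine of the angle between \<open>x\<close> and the column space of
  \<open>Y\<close> is below \<open>s\<close>. The strict inequality excludes combinations that
  vanish on the block, and makes the set of witnesses \<open>u\<close> open.\<close>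

definition blk_match :: "nat \<Rightarrow> real \<Rightarrow> (nat \<Rightarrow> complex) \<Rightarrow> (nat \<Rightarrow> complex^'r::finite) \<Rightarrow> bool" where
  "blk_match n s x Y \<longleftrightarrow> (\<exists>u. (1 - s) * energy n x * energy n (\<lambda>i. cinner u (Y i)) < (cmod (cdot n x (\<lambda>i. cinner u (Y i))))^2)"

text \<open>Cauchy-Schwarz for the coefficients with respect to \<open>e\<close> removes the
  quantifier over \<open>u\<close>: a match forces the projection of \<open>x\<close> onto the span
  to carry at least the fraction \<open>1 - s\<close> of its energy.\<close>

lemma blk_match_imp:
  fixes Y :: "nat \<Rightarrow> complex^'r::finite"
  assumes m: "blk_match n s x Y"
    and e: "\<And>u i. i < n \<Longrightarrow> cinner u (Y i) = (\<Sum>l<m. cdot n (e l) (\<lambda>i. cinner u (Y i)) * e l i)"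
  shows "(1 - s) * energy n x \<le> (\<Sum>l<m. (cmod (cdot n (e l) x))^2)"
proof -
  obtain u where u: "(1 - s) * energy n x * energy n (\<lambda>i. cinner u (Y i)) < (cmod (cdot n x (\<lambda>i. cinner u (Y i))))^2"
    using m by (auto simp: blk_match_def)
  define v where "v i = cinner u (Y i)" for i
  define c where "c l = cdot n (e l) v" for l
  have v: "v i = (\<Sum>l<m. c l * e l i)" if "i < n" for i using e[OF that, of u] by (simp only: v_def[abs_def] c_def)
  have xv: "cdot n w v = (\<Sum>l<m. c l * cdot n w (e l))" for w
  proof -
    have "cdot n w v = cdot n w (\<lambda>i. \<Sum>l<m. c l * e l i)"
      by (rule cdot_cong) (auto simp: v)
    then show ?thesis by (simp add: cdot_simps)
  qed
  \<comment> \<open>Parseval's identity for \<open>v\<close>: pairing its expansion with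
    \<open>v\<close> itself gives back the conjugate coefficients.\<close>
  have "complex_of_real (energy n v) = (\<Sum>l<m. c l * cnj (c l))"
    unfolding cdot_self[symmetric] by (subst xv) (simp add: c_def cnj_cdot)
  also have "\<dots> = complex_of_real (\<Sum>l<m. (cmod (c l))^2)"
    by (simp add: complex_norm_square del: of_real_power)
  finally have ev: "energy n v = (\<Sum>l<m. (cmod (c l))^2)" by (simp only: of_real_eq_iff)
  have "cmod (cdot n x v) \<le> (\<Sum>l<m. cmod (c l) * cmod (cdot n (e l) x))"
    unfolding xv by (rule order_trans[OF norm_sum]) (simp add: norm_mult flip: cnj_cdot[of n x])
  then have "(cmod (cdot n x v))^2 \<le> (\<Sum>l<m. cmod (c l) * cmod (cdot n (e l) x))^2"
    by (rule power_mono) simp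
  also have "\<dots> \<le> (\<Sum>l<m. (cmod (c l))^2) * (\<Sum>l<m. (cmod (cdot n (e l) x))^2)"
    by (rule Cauchy_Schwarz_ineq_sum)
  finally have "(1 - s) * energy n x * energy n v < (\<Sum>l<m. (cmod (cdot n (e l) x))^2) * energy n v"
    using u by (simp add: v_def[abs_def, symmetric] ev mult.commute)
  moreover have "energy n v \<ge> 0" by simp
  ultimately show ?thesis by (simp add: mult_less_cancel_right)
qed

section \<open>Measurability of the angle test\<close>

lemma measurable_energy_gen:
  assumes "\<And>i. i < n \<Longrightarrow> (\<lambda>w. f w i) \<in> borel_measurable M"
  shows "(\<lambda>w. energy n (f w)) \<in> borel_measurable M"
  unfolding energy_def using assms by (intro borel_measurable_sum borel_measurable_power borel_measurable_norm) auto

lemma measurable_cdot_gen: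
  assumes "\<And>i. i < n \<Longrightarrow> (\<lambda>w. f w i) \<in> borel_measurable M" "\<And>i. i < n \<Longrightarrow> (\<lambda>w. g w i) \<in> borel_measurable M"
  shows "(\<lambda>w. cdot n (f w) (g w)) \<in> borel_measurable M"
  unfolding cdot_def using assms
  by (intro borel_measurable_sum borel_measurable_times) (auto intro!: measurable_compose[of _ M borel cnj] borel_measurable_continuous_onI continuous_intros)

text \<open>The witness condition is open in \<open>u\<close>, so \<open>u\<close> may be restricted
  to a countable dense set and the uncountable union becomes a countable one.\<close>

lemma measurable_blk_match:
  fixes g :: "'b \<Rightarrow> nat \<Rightarrow> complex^'r::finite"
  assumes f: "\<And>i. i < n \<Longrightarrow> (\<lambda>w. f w i) \<in> borel_measurable M" and [measurable]: "g \<in> measurable M (out_space n)"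
  shows "Measurable.pred M (\<lambda>w. blk_match n s (f w) (g w))"
proof -
  obtain D :: "(complex^'r) set" where D: "countable D" "\<And>X. open X \<Longrightarrow> X \<noteq> {} \<Longrightarrow> \<exists>d\<in>D. d \<in> X"
    using countable_dense_exists by blast
  let ?P = "\<lambda>x Y u. (1 - s) * energy n x * energy n (\<lambda>i. cinner u (Y i)) < (cmod (cdot n x (\<lambda>i. cinner u (Y i :: complex^'r))))^2"
  have eq: "blk_match n s x Y \<longleftrightarrow> (\<exists>u\<in>D. ?P x Y u)" for x Y
  proof -
    have "open {u. ?P x Y u}"
      unfolding energy_def cdot_def by (intro open_Collect_less continuous_intros)
    with D(2)[of "{u. ?P x Y u}"] show ?thesis unfolding blk_match_def by blast
  qed
  have "Measurable.pred M (\<lambda>w. ?P (f w) (g w) u)" for u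
  proof -
    have [measurable]: "(\<lambda>w. energy n (f w)) \<in> borel_measurable M"
      by (rule measurable_energy_gen) (rule f)
    have [measurable]: "(\<lambda>w. energy n (\<lambda>i. cinner u (g w i))) \<in> borel_measurable M"
      by (rule measurable_energy_gen) (intro measurable_cinner measurable_const measurable_out_dest, simp_all)
    have [measurable]: "(\<lambda>w. cdot n (f w) (\<lambda>i. cinner u (g w i))) \<in> borel_measurable M"
      by (rule measurable_cdot_gen) (rule f, assumption, intro measurable_cinner measurable_const measurable_out_dest, simp_all)
    show ?thesis by measurable
  qed
  then show ?thesis unfolding eq using D(1) by (intro measurable_pred_countable) auto
qed

section \<open>Exponential moments of projections and the Chernoff bound\<close>

lemma nn_integral_exp_linear_cn_blk:
  assumes \<nu>: "\<nu> > -1"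
  shows "(\<integral>\<^sup>+x. ennreal (exp (Re (cdot n w x) - \<nu> * energy n x)) \<partial>cn_blk n)
     = ennreal (exp (energy n w / (4 * (1 + \<nu>))) / (1 + \<nu>) ^ n)"
proof -
  interpret N: product_prob_space "\<lambda>_::nat. cn1" by (rule product_prob_space_cn1)
  have "exp (Re (cdot n w x) - \<nu> * energy n x) = (\<Prod>i<n. exp (Re (cnj (w i) * x i) - \<nu> * (cmod (x i))^2))" for x
    by (simp add: exp_sum[symmetric] cdot_def energy_def sum_subtractf sum_distrib_left)
  then have "(\<integral>\<^sup>+x. ennreal (exp (Re (cdot n w x) - \<nu> * energy n x)) \<partial>cn_blk n)
     = (\<integral>\<^sup>+x. (\<Prod>i<n. ennreal (exp (Re (cnj (w i) * x i) - \<nu> * (cmod (x i))^2))) \<partial>cn_blk n)"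
    by (simp add: prod_ennreal)
  also have "\<dots> = (\<Prod>i<n. \<integral>\<^sup>+z. ennreal (exp (Re (cnj (w i) * z) - \<nu> * (cmod z)^2)) \<partial>cn1)"
    by (rule N.product_nn_integral_prod) auto
  also have "\<dots> = (\<Prod>i<n. ennreal (exp ((cmod (w i))^2 / (4 * (1 + \<nu>))) / (1 + \<nu>)))"
    by (simp only: cn1_tilt[OF \<nu>])
  also have "\<dots> = ennreal (\<Prod>i<n. exp ((cmod (w i))^2 / (4 * (1 + \<nu>))) / (1 + \<nu>))"
    using \<nu> by (intro prod_ennreal) simp
  also have "(\<Prod>i<n. exp ((cmod (w i))^2 / (4 * (1 + \<nu>))) / (1 + \<nu>)) = exp (energy n w / (4 * (1 + \<nu>))) / (1 + \<nu>) ^ n"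
    by (simp add: prod_dividef exp_sum[symmetric] energy_def sum_divide_distrib)
  finally show ?thesis .
qed

lemma measurable_blk_component:
  "i < n \<Longrightarrow> (\<lambda>x. x i) \<in> borel_measurable (cn_blk n)"
  using measurable_component_singleton[of i "{..<n}" "\<lambda>_. cn1"] by simp

lemma measurable_energy [measurable]: "energy n \<in> borel_measurable (cn_blk n)"
  by (rule measurable_energy_gen) (rule measurable_blk_component)

lemma measurable_cdot [measurable]: "cdot n w \<in> borel_measurable (cn_blk n)"
  by (rule measurable_cdot_gen) (auto intro: measurable_blk_component)

text \<open>The Gaussian tilt \<open>exp (\<mu> \<parallel>P x\<parallel>\<^sup>2)\<close> with \<open>P\<close> the projection onto the span of \<open>e\<close> is linearized by an
  auxiliary Gaussian \<open>\<xi>\<close>: \<open>exp \<bar>w\<bar>\<^sup>2 = E (exp (2 Re (cnj w * \<xi>)))\<close>. After exchanging the integrals only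
  one-dimensional Gaussian integrals remain.\<close>
lemma nn_integral_exp_projection_cn_blk:
  assumes orth: "\<And>l l'. l < m \<Longrightarrow> l' < m \<Longrightarrow> l \<noteq> l' \<Longrightarrow> cdot n (e l) (e l') = 0"
    and unit: "\<And>l. l < m \<Longrightarrow> energy n (e l) \<le> 1"
    and \<mu>: "0 \<le> \<mu>" "0 \<le> \<nu>" "\<mu> < 1 + \<nu>"
  shows "(\<integral>\<^sup>+x. ennreal (exp (\<mu> * (\<Sum>l<m. (cmod (cdot n (e l) x))^2) - \<nu> * energy n x)) \<partial>cn_blk n)
     \<le> ennreal (1 / (1 + \<nu>) ^ n / (1 - \<mu> / (1 + \<nu>)) ^ m)"
proof -
  interpret X: prob_space "cn_blk n" by (rule prob_space_cn_blk)
  interpret Xi: prob_space "cn_blk m" by (rule prob_space_cn_blk)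
  interpret P: pair_sigma_finite "cn_blk n" "cn_blk m" ..
  \<comment> \<open>The factor \<open>2 * sqrt \<mu>\<close> makes \<open>energy m (w x) / 4\<close>
    the exponent to be linearized, as produced by integrating the linear form over the auxiliary
    block with \<nu> = 0.\<close>
  define \<eta> where "\<eta> \<xi> i = complex_of_real (2 * sqrt \<mu>) * (\<Sum>l<m. \<xi> l * e l i)" for \<xi> i
  define w where "w x l = complex_of_real (2 * sqrt \<mu>) * cdot n (e l) x" for x l
  have wx: "energy m (w x) / 4 = \<mu> * (\<Sum>l<m. (cmod (cdot n (e l) x))^2)" for x
    using \<mu> by (simp add: energy_def w_def norm_mult power_mult_distrib sum_distrib_left sum_divide_distrib)
  have w\<eta>: "Re (cdot m (w x) \<xi>) = Re (cdot n (\<eta> \<xi>) x)" for x \<xi>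
  proof -
    have "cdot n x (\<eta> \<xi>) = complex_of_real (2 * sqrt \<mu>) * (\<Sum>l<m. \<xi> l * cdot n x (e l))"
      unfolding \<eta>_def by (simp add: cdot_simps)
    also have "\<dots> = cdot m (w x) \<xi>"
      unfolding cdot_def[of m] w_def by (simp add: cnj_cdot sum_distrib_left mult_ac)
    finally have "Re (cdot m (w x) \<xi>) = Re (cnj (cdot n x (\<eta> \<xi>)))" by simp
    then show ?thesis by (simp only: cnj_cdot)
  qed
  \<comment> \<open>An inequality rather than Parseval's identity, because members of
    \<open>e\<close> may have energy below 1, in particular be zero.\<close>
  have en: "energy n (\<eta> \<xi>) \<le> 4 * \<mu> * energy m \<xi>" for \<xi>
  proof -
    define s where "s i = (\<Sum>l<m. \<xi> l * e l i)" for i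
    have se: "cdot n (e l) s = \<xi> l * energy n (e l)" if "l < m" for l
    proof -
      have "cdot n (e l) s = (\<Sum>l'<m. \<xi> l' * cdot n (e l) (e l'))"
        unfolding s_def by (simp add: cdot_simps)
      also have "\<dots> = (\<Sum>l'\<in>{l}. \<xi> l' * cdot n (e l) (e l'))"
        using that orth by (intro sum.mono_neutral_right) auto
      finally show ?thesis by (simp add: cdot_self)
    qed
    have "complex_of_real (energy n s) = (\<Sum>l<m. \<xi> l * cdot n s (e l))"
    proof -
      have "cdot n s s = cdot n s (\<lambda>i. \<Sum>l<m. \<xi> l * e l i)"
        by (rule cdot_cong) (simp_all add: s_def)
      then show ?thesis by (simp add: cdot_simps cdot_self)
    qed
    also have "\<dots> = (\<Sum>l<m. \<xi> l * cnj (\<xi> l * energy n (e l)))"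
      by (intro sum.cong refl) (simp add: se[symmetric] cnj_cdot del: complex_cnj_mult)
    also have "\<dots> = complex_of_real (\<Sum>l<m. (cmod (\<xi> l))^2 * energy n (e l))"
      by (simp add: complex_norm_square del: of_real_power) (simp add: mult_ac)
    finally have "energy n s = (\<Sum>l<m. (cmod (\<xi> l))^2 * energy n (e l))" by (simp only: of_real_eq_iff)
    also have "\<dots> \<le> (\<Sum>l<m. (cmod (\<xi> l))^2 * 1)" using unit by (intro sum_mono mult_left_mono) auto
    finally have "energy n s \<le> energy m \<xi>" by (simp add: energy_def)
    moreover have "energy n (\<eta> \<xi>) = 4 * \<mu> * energy n s"
    proof -
      have "(cmod (\<eta> \<xi> i))^2 = 4 * \<mu> * (cmod (s i))^2" for i
        using \<mu> by (simp add: \<eta>_def s_def norm_mult power_mult_distrib)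
      then show ?thesis by (simp add: energy_def sum_distrib_left)
    qed
    ultimately show ?thesis using \<mu> by (simp add: mult_left_mono)
  qed
  have [measurable]: "(\<lambda>p. cdot n (\<eta> (snd p)) (fst p)) \<in> borel_measurable (cn_blk n \<Otimes>\<^sub>M cn_blk m)"
  proof (rule measurable_cdot_gen)
    fix i assume "i < n"
    then show "(\<lambda>p. fst p i) \<in> borel_measurable (cn_blk n \<Otimes>\<^sub>M cn_blk m)"
      by (intro measurable_compose[OF measurable_fst measurable_blk_component])
    have "(\<lambda>p. snd p l) \<in> borel_measurable (cn_blk n \<Otimes>\<^sub>M cn_blk m)" if "l < m" for l
      using that by (intro measurable_compose[OF measurable_snd measurable_blk_component])
    then show "(\<lambda>p. \<eta> (snd p) i) \<in> borel_measurable (cn_blk n \<Otimes>\<^sub>M cn_blk m)"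
      unfolding \<eta>_def by (intro borel_measurable_times borel_measurable_sum measurable_const) auto
  qed
  let ?J = "\<lambda>x \<xi>. ennreal (exp (Re (cdot n (\<eta> \<xi>) x) - \<nu> * energy n x))"
  let ?pr = "\<lambda>x. ennreal (exp (\<mu> * (\<Sum>l<m. (cmod (cdot n (e l) x))^2) - \<nu> * energy n x))"
  have meas: "(\<lambda>(x, \<xi>). ?J x \<xi>) \<in> borel_measurable (cn_blk n \<Otimes>\<^sub>M cn_blk m)"
    by (simp add: split_beta)
  have "(\<integral>\<^sup>+x. ?pr x \<partial>cn_blk n)
     = (\<integral>\<^sup>+x. (\<integral>\<^sup>+\<xi>. ?J x \<xi> \<partial>cn_blk m) \<partial>cn_blk n)"
  proof (rule nn_integral_cong)
    fix x
    have "(\<integral>\<^sup>+\<xi>. ?J x \<xi> \<partial>cn_blk m)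
       = (\<integral>\<^sup>+\<xi>. ennreal (exp (- \<nu> * energy n x)) * ennreal (exp (Re (cdot m (w x) \<xi>) - 0 * energy m \<xi>)) \<partial>cn_blk m)"
      by (intro nn_integral_cong) (simp add: w\<eta> ennreal_mult[symmetric] exp_add[symmetric])
    also have "\<dots> = ennreal (exp (- \<nu> * energy n x)) * ennreal (exp (energy m (w x) / (4 * (1 + 0))) / (1 + 0) ^ m)"
      by (subst nn_integral_cmult, measurable) (subst nn_integral_exp_linear_cn_blk, simp_all)
    also have "\<dots> = ?pr x"
      by (simp add: ennreal_mult[symmetric] exp_add[symmetric] wx)
    finally show "?pr x = (\<integral>\<^sup>+\<xi>. ?J x \<xi> \<partial>cn_blk m)" by simp
  qed
  also have "\<dots> = (\<integral>\<^sup>+\<xi>. (\<integral>\<^sup>+x. ?J x \<xi> \<partial>cn_blk n) \<partial>cn_blk m)"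
    by (rule P.Fubini'[symmetric, OF meas])
  also have "\<dots> = (\<integral>\<^sup>+\<xi>. ennreal (exp (energy n (\<eta> \<xi>) / (4 * (1 + \<nu>))) / (1 + \<nu>) ^ n) \<partial>cn_blk m)"
    using \<mu> by (intro nn_integral_cong nn_integral_exp_linear_cn_blk) simp
  \<comment> \<open>The remaining integral over \<open>\<xi>\<close> is again a Gaussian tilt,
    without linear term and with parameter \<open>- (\<mu> / (1 + \<nu>))\<close>. It converges
    because \<open>\<mu> < 1 + \<nu>\<close>.\<close>
  also have "\<dots> \<le> (\<integral>\<^sup>+\<xi>. ennreal (1 / (1 + \<nu>) ^ n) * ennreal (exp (Re (cdot m (\<lambda>_. 0) \<xi>) - (- (\<mu> / (1 + \<nu>))) * energy m \<xi>)) \<partial>cn_blk m)"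
  proof (rule nn_integral_mono)
    fix \<xi>
    have "energy n (\<eta> \<xi>) / (4 * (1 + \<nu>)) \<le> 4 * \<mu> * energy m \<xi> / (4 * (1 + \<nu>))"
      using \<mu> by (intro divide_right_mono en) simp
    also have "\<dots> = \<mu> / (1 + \<nu>) * energy m \<xi>" using \<mu> by (simp add: field_simps)
    finally have "exp (energy n (\<eta> \<xi>) / (4 * (1 + \<nu>))) / (1 + \<nu>) ^ n \<le> exp (\<mu> / (1 + \<nu>) * energy m \<xi>) / (1 + \<nu>) ^ n"
      using \<mu> by (intro divide_right_mono) auto
    moreover have "Re (cdot m (\<lambda>_. 0) \<xi>) = 0" by (simp add: cdot_def)
    ultimately show "ennreal (exp (energy n (\<eta> \<xi>) / (4 * (1 + \<nu>))) / (1 + \<nu>) ^ n)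
        \<le> ennreal (1 / (1 + \<nu>) ^ n) * ennreal (exp (Re (cdot m (\<lambda>_. 0) \<xi>) - (- (\<mu> / (1 + \<nu>))) * energy m \<xi>))"
      using \<mu> by (simp add: ennreal_mult[symmetric] ennreal_leI)
  qed
  also have "\<dots> = ennreal (1 / (1 + \<nu>) ^ n) * ennreal (exp (energy m (\<lambda>_. 0) / (4 * (1 + - (\<mu> / (1 + \<nu>))))) / (1 + - (\<mu> / (1 + \<nu>))) ^ m)"
    using \<mu> by (subst nn_integral_cmult, measurable) (subst nn_integral_exp_linear_cn_blk, simp_all add: field_simps)
  also have "\<dots> = ennreal (1 / (1 + \<nu>) ^ n / (1 - \<mu> / (1 + \<nu>)) ^ m)"
    using \<mu> by (simp add: ennreal_mult[symmetric] energy_def)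
  finally show ?thesis .
qed

text \<open>A Chernoff bound: a match makes \<open>\<mu>\<close> times the projected energy at least
  \<open>\<nu>\<close> times the total energy, where \<open>\<nu> = \<mu> * (1 - s)\<close>. It then
  remains to choose \<open>\<mu>\<close>.\<close>

lemma emeasure_blk_match_le:
  fixes Y :: "nat \<Rightarrow> complex^'r::finite"
  assumes s: "0 < s" "s < 1" and n: "CARD('r) < n"
  shows "emeasure (cn_blk n) {x \<in> space (cn_blk n). blk_match n s x Y} \<le> ennreal (3 * real n ^ CARD('r) * s ^ (n - CARD('r)))"
proof -
  let ?m = "CARD('r)"
  have m1: "?m \<ge> 1" by (simp add: Suc_leI)
  have n2: "n \<ge> 2" using n m1 by linarith
  obtain e where e: "\<forall>l<?m. \<forall>l'<?m. l \<noteq> l' \<longrightarrow> cdot n (e l) (e l') = 0" "\<forall>l<?m. energy n (e l) \<in> {0, 1}"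
    "\<forall>u. \<forall>i<n. cinner u (Y i) = (\<Sum>l<?m. cdot n (e l) (\<lambda>i. cinner u (Y i)) * e l i)"
    using ex_orthonormal_columns[of n Y] by (elim exE conjE)
  \<comment> \<open>At \<open>\<mu> = 1 / s\<close> one would have \<open>1 + \<nu> = 1 / s\<close>,
    the wanted exponential rate, but \<open>1 + \<nu> - \<mu>\<close>, whose power is divided by,
    would be 0. Backing off by the factor \<open>q\<close> makes this gap exactly 1/n: it costs the
    polynomial factor and a constant.\<close>
  define q where "q = 1 - 1 / real n"
  define \<mu> where "\<mu> = q / s"
  define \<nu> where "\<nu> = \<mu> * (1 - s)"
  have q: "0 < q" "q < 1" using n2 by (simp_all add: q_def)
  have \<mu>: "0 \<le> \<mu>" "0 \<le> \<nu>" "\<mu> < 1 + \<nu>" using q s by (simp_all add: \<mu>_def \<nu>_def field_simps)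
  have \<mu>s: "\<mu> * s = q" using s by (simp add: \<mu>_def)
  have nm: "1 + \<nu> - \<mu> = 1 / n" by (simp add: \<nu>_def right_diff_distrib \<mu>s) (simp add: q_def)
  let ?A = "{x \<in> space (cn_blk n). blk_match n s x Y}"
  have A[measurable]: "?A \<in> sets (cn_blk n)"
  proof -
    \<comment> \<open>The restriction is a point of the extensional output space, and the test reads
      only the rows below \<open>n\<close>.\<close>
    have *: "(\<lambda>i\<in>{..<n}. Y i) \<in> space (out_space n)" by (simp add: out_space_def space_PiM)
    have "Measurable.pred (cn_blk n) (\<lambda>x. blk_match n s x (\<lambda>i\<in>{..<n}. Y i))"
      using * by (intro measurable_blk_match measurable_const measurable_blk_component)
    moreover have "blk_match n s x (\<lambda>i\<in>{..<n}. Y i) = blk_match n s x Y" for x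
      by (simp add: blk_match_def energy_def cdot_def)
    ultimately show ?thesis by (simp add: pred_def)
  qed
  let ?pr = "\<lambda>x. ennreal (exp (\<mu> * (\<Sum>l<?m. (cmod (cdot n (e l) x))^2) - \<nu> * energy n x))"
  have "emeasure (cn_blk n) ?A = (\<integral>\<^sup>+x. indicator ?A x \<partial>cn_blk n)" by (simp add: A)
  also have "\<dots> \<le> (\<integral>\<^sup>+x. ?pr x \<partial>cn_blk n)"
  proof (rule nn_integral_mono)
    fix x
    show "indicator ?A x \<le> ?pr x"
    proof (cases "x \<in> ?A")
      case True
      then have "(1 - s) * energy n x \<le> (\<Sum>l<?m. (cmod (cdot n (e l) x))^2)"
        using e(3) by (intro blk_match_imp[where Y = Y and e = e and m = ?m]) auto
      then have "\<mu> * ((1 - s) * energy n x) \<le> \<mu> * (\<Sum>l<?m. (cmod (cdot n (e l) x))^2)"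
        using \<mu> by (intro mult_left_mono) auto
      then show ?thesis using True by (simp add: \<nu>_def mult.assoc)
    qed simp
  qed
  also have "\<dots> \<le> ennreal (1 / (1 + \<nu>) ^ n / (1 - \<mu> / (1 + \<nu>)) ^ ?m)"
    using e(1,2) \<mu> by (intro nn_integral_exp_projection_cn_blk) force+
  also have "\<dots> \<le> ennreal (3 * real n ^ ?m * s ^ (n - ?m))"
  proof (rule ennreal_leI)
    have "(1 - \<mu> / (1 + \<nu>)) = (1 / n) / (1 + \<nu>)" using \<mu> by (simp add: nm[symmetric] field_simps)
    then have "1 / (1 + \<nu>) ^ n / (1 - \<mu> / (1 + \<nu>)) ^ ?m = real n ^ ?m * (1 + \<nu>) ^ ?m / (1 + \<nu>) ^ n"
      by (simp only:) (simp add: power_divide power_mult_distrib)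
    also have "\<dots> = real n ^ ?m * (1 / (1 + \<nu>)) ^ (n - ?m)"
      using \<mu> n by (simp add: power_diff power_divide)
    also have "\<dots> \<le> real n ^ ?m * (s / q) ^ (n - ?m)"
    proof (intro mult_left_mono power_mono)
      have "q \<le> s * (1 + \<nu>)"
      proof -
        have "s * (1 + \<nu>) = s + q * (1 - s)" using s by (simp add: \<nu>_def \<mu>_def field_simps)
        moreover have "s + q * (1 - s) - q = s * (1 - q)" by (simp add: algebra_simps)
        moreover have "s * (1 - q) \<ge> 0" using s q by simp
        ultimately show ?thesis by linarith
      qed
      then show "1 / (1 + \<nu>) \<le> s / q" using q \<mu> by (simp add: field_simps)
    qed (use \<mu> in auto)
    also have "\<dots> = real n ^ ?m * s ^ (n - ?m) * (1 / q) ^ (n - ?m)" by (simp add: power_divide)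
    also have "\<dots> \<le> real n ^ ?m * s ^ (n - ?m) * 3"
    proof (intro mult_left_mono)
      \<comment> \<open>The loss in the exponential rate is at most (1 + 1/(n-1))^(n-1), hence at
        most e and so at most 3.\<close>
      have q1: "1 / q = 1 + 1 / (real n - 1)" using n2 by (simp add: q_def field_simps)
      have "(1 / q) ^ (n - ?m) \<le> (1 / q) ^ (n - 1)"
        using q m1 by (intro power_increasing) (auto simp: diff_le_mono2)
      also have "(1 / q) ^ (n - 1) \<le> exp (1 / (real n - 1)) ^ (n - 1)"
        unfolding q1 using n2 by (intro power_mono exp_ge_add_one_self) auto
      also have "\<dots> = exp 1" using n2 by (simp add: exp_of_nat_mult[symmetric] of_nat_diff)
      also have "exp 1 \<le> (3::real)" using exp_le by simp
      finally show "(1 / q) ^ (n - ?m) \<le> 3" .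
    qed (use s in auto)
    finally show "1 / (1 + \<nu>) ^ n / (1 - \<mu> / (1 + \<nu>)) ^ ?m \<le> 3 * real n ^ ?m * s ^ (n - ?m)" by (simp add: mult_ac)
  qed
  finally show ?thesis .
qed

subsection \<open>Threshold events for the fading gain\<close>

locale fading =
  fixes H :: "(complex^'r::finite) measure" and f f' :: "real \<Rightarrow> real"
  assumes prob_H: "prob_space H" and sets_H [measurable_cong]: "sets H = sets borel"
    and f_nonneg: "\<And>x. f x \<ge> 0"
    and f_dist: "distributed H lborel (\<lambda>h. (norm h)^2) (\<lambda>x. ennreal (f x))"
    and f_deriv: "\<And>x. x > 0 \<Longrightarrow> (f has_real_derivative f' x) (at x)"
    and f'_cont: "continuous_on {0<..} f'"
begin

sublocale H: prob_space H by (rule prob_H)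

lemma space_H [simp]: "space H = UNIV"
  using sets_H by (metis sets_eq_imp_space_eq space_borel)

definition gain_cdf :: "real \<Rightarrow> real" where
  "gain_cdf y = measure H {h. (norm h)^2 \<le> y}"

lemma gain_interval:
  assumes "x \<le> y"
  shows "emeasure H {h. x < (norm h)^2 \<and> (norm h)^2 \<le> y} = (\<integral>\<^sup>+t. ennreal (f t) * indicator {x<..y} t \<partial>lborel)"
proof -
  have "emeasure H ((\<lambda>h. (norm h)^2) -` {x<..y} \<inter> space H) = (\<integral>\<^sup>+t. ennreal (f t) * indicator {x<..y} t \<partial>lborel)"
    by (rule distributed_emeasure[OF f_dist]) simp
  moreover have "(\<lambda>h. (norm h)^2) -` {x<..y} \<inter> space H = {h. x < (norm h)^2 \<and> (norm h)^2 \<le> y}" by auto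
  ultimately show ?thesis by simp
qed

lemma gain_cdf_diff:
  assumes "x \<le> y"
  shows "gain_cdf y - gain_cdf x = measure H {h. x < (norm h)^2 \<and> (norm h)^2 \<le> y}"
proof -
  have "{h::complex^'r. x < (norm h)^2 \<and> (norm h)^2 \<le> y} = {h. (norm h)^2 \<le> y} - {h. (norm h)^2 \<le> x}" by auto
  moreover have "measure H ({h. (norm h)^2 \<le> y} - {h. (norm h)^2 \<le> x})
      = measure H {h. (norm h)^2 \<le> y} - measure H {h. (norm h)^2 \<le> x}"
    using assms by (intro H.finite_measure_Diff) (measurable, auto)
  ultimately show ?thesis by (simp only: gain_cdf_def)
qed

lemma gain_no_atom: "emeasure H {h. (norm h)^2 = y} = 0"
proof -
  have "emeasure H ((\<lambda>h. (norm h)^2) -` {y} \<inter> space H) = (\<integral>\<^sup>+t. ennreal (f t) * indicator {y} t \<partial>lborel)"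
    by (rule distributed_emeasure[OF f_dist]) simp
  also have "\<dots> = 0" by (subst nn_integral_indicator_singleton) auto
  finally show ?thesis by (simp add: vimage_def)
qed

text \<open>Off this null event the direction \<open>sgn h\<close> is a unit vector.\<close>

lemma AE_nonzero: "AE h in H. h \<noteq> 0"
  using gain_no_atom[of 0] by (intro AE_I[of _ _ "{h. (norm h)^2 = 0}"]) (simp_all add: subset_iff)

lemma gain_cdf_bounds: "0 \<le> gain_cdf y" "gain_cdf y \<le> 1"
  by (auto simp: gain_cdf_def)

lemma gain_cdf_diff_bounds:
  assumes "x \<le> y" and b: "\<And>t. x < t \<Longrightarrow> t \<le> y \<Longrightarrow> lo \<le> f t \<and> f t \<le> hi" and "0 \<le> hi"
  shows "lo * (y - x) \<le> gain_cdf y - gain_cdf x" "gain_cdf y - gain_cdf x \<le> hi * (y - x)"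
proof -
  let ?E = "{h::complex^'r. x < (norm h)^2 \<and> (norm h)^2 \<le> y}"
  have c: "(\<integral>\<^sup>+t. ennreal c * indicator {x<..y} t \<partial>lborel) = ennreal c * ennreal (y - x)" for c
    using assms(1) by (simp add: nn_integral_cmult_indicator)
  have "ennreal (measure H ?E) = (\<integral>\<^sup>+t. ennreal (f t) * indicator {x<..y} t \<partial>lborel)"
    using gain_interval[OF assms(1)] by (simp add: H.emeasure_eq_measure)
  also have "\<dots> \<le> (\<integral>\<^sup>+t. ennreal hi * indicator {x<..y} t \<partial>lborel)"
    using b by (intro nn_integral_mono) (auto simp: indicator_def intro!: ennreal_leI)
  finally have "ennreal (measure H ?E) \<le> ennreal (hi * (y - x))"
    using assms by (simp add: c ennreal_mult)
  then show "gain_cdf y - gain_cdf x \<le> hi * (y - x)"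
    using assms by (simp add: gain_cdf_diff ennreal_le_iff)
  show "lo * (y - x) \<le> gain_cdf y - gain_cdf x"
  \<comment> \<open>Lower bounds obtained by subtracting a Lipschitz error may be negative, and
    \<open>ennreal\<close> would truncate them to 0.\<close>
  proof (cases "lo \<ge> 0")
    case True
    have "(\<integral>\<^sup>+t. ennreal lo * indicator {x<..y} t \<partial>lborel) \<le> (\<integral>\<^sup>+t. ennreal (f t) * indicator {x<..y} t \<partial>lborel)"
      using b by (intro nn_integral_mono) (auto simp: indicator_def intro!: ennreal_leI)
    also have "\<dots> = ennreal (measure H ?E)"
      using gain_interval[OF assms(1)] by (simp add: H.emeasure_eq_measure)
    finally have "ennreal (lo * (y - x)) \<le> ennreal (measure H ?E)"
      using assms True by (simp add: c ennreal_mult)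
    then show ?thesis using assms by (simp add: gain_cdf_diff ennreal_le_iff)
  next
    case False
    then have "lo * (y - x) \<le> 0" using assms(1) by (simp add: mult_nonpos_nonneg)
    also have "0 \<le> gain_cdf y - gain_cdf x" using assms(1) by (simp add: gain_cdf_diff)
    finally show ?thesis .
  qed
qed

text \<open>First-order expansion of the distribution function of the gain. The error bound holds
  for every \<open>v\<close>, so fluctuations of any size can be inserted without
  truncation.\<close>

definition quadratic_at :: "real \<Rightarrow> real \<Rightarrow> bool" where
  "quadratic_at L g0 \<longleftrightarrow> 0 \<le> f g0 \<and> f g0 \<le> L \<and> (\<forall>v. \<bar>gain_cdf (g0 + v) - gain_cdf g0 - f g0 * v\<bar> \<le> L * v\<^sup>2)"

text \<open>One \<open>L\<close> serves a whole neighbourhood of \<open>g\<close>. For small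
  \<open>v\<close> the density is Lipschitz on a compact interval; for large \<open>v\<close> the
  factor \<open>v\<^sup>2\<close> dominates trivial bounds.\<close>

lemma ex_quadratic_at:
  assumes g: "g > 0"
  shows "\<exists>L. \<forall>g0. \<bar>g0 - g\<bar> \<le> g / 4 \<longrightarrow> quadratic_at L g0"
proof -
  let ?I = "{g / 2..2 * g}"
  \<comment> \<open>Points within \<open>\<delta>\<close> of some \<open>g0\<close> that is itself
    within \<open>g / 4\<close> of \<open>g\<close> stay in the compact interval
    \<open>?I\<close>.\<close>
  define \<delta> where "\<delta> = g / 4"
  have \<delta>: "\<delta> > 0" using g by (simp add: \<delta>_def)
  have pos: "t > 0" if "t \<in> ?I" for t using that g by (auto intro: less_le_trans[of 0 "g/2"])
  have "continuous_on ?I f'" by (rule continuous_on_subset[OF f'_cont]) (auto intro: pos)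
  then have "compact (f' ` ?I)" by (intro compact_continuous_image) auto
  then obtain B where "\<forall>y\<in>f' ` ?I. norm y \<le> B" using compact_imp_bounded bounded_iff by blast
  then have B: "\<bar>f' t\<bar> \<le> B" if "t \<in> ?I" for t using that by auto
  have "continuous_on ?I f"
    using f_deriv pos by (intro continuous_at_imp_continuous_on ballI DERIV_isCont) blast
  then have "compact (f ` ?I)" by (intro compact_continuous_image) auto
  then obtain C where "\<forall>y\<in>f ` ?I. norm y \<le> C" using compact_imp_bounded bounded_iff by blast
  then have C: "\<bar>f t\<bar> \<le> C" if "t \<in> ?I" for t using that by auto
  have B0: "B \<ge> 0" using B[of g] g by force
  have C0: "C \<ge> 0" using C[of g] g by force
  have lip: "\<bar>f s - f t\<bar> \<le> B * \<bar>s - t\<bar>" if "s \<in> ?I" "t \<in> ?I" for s t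
  proof -
    have "norm (f s - f t) \<le> B * norm (s - t)"
    proof (rule field_differentiable_bound[of ?I f f'])
      fix z assume "z \<in> ?I"
      show "(f has_real_derivative f' z) (at z within ?I)"
        by (rule has_field_derivative_at_within[OF f_deriv[OF pos[OF \<open>z \<in> ?I\<close>]]])
      show "norm (f' z) \<le> B" using B[OF \<open>z \<in> ?I\<close>] by simp
    qed (use that in auto)
    then show ?thesis by simp
  qed
  \<comment> \<open>\<open>C\<close> bounds the density, \<open>B\<close> its Lipschitz constant for
    \<open>\<bar>v\<bar> \<le> \<delta>\<close>; the last two terms cover larger \<open>v\<close>,
    the probability difference by \<open>v\<^sup>2 / \<delta>\<^sup>2\<close> and the linear term by
    \<open>C * v\<^sup>2 / \<delta>\<close>.\<close>
  define L where "L = C + B + 1 / \<delta>\<^sup>2 + C / \<delta>"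
  have "quadratic_at L g0" if g0: "\<bar>g0 - g\<bar> \<le> g / 4" for g0
    unfolding quadratic_at_def
  proof (intro conjI allI)
    have g0I: "g0 \<in> ?I" using g0 g by (simp, linarith)
    show "0 \<le> f g0" by (rule f_nonneg)
    have "0 \<le> 1 / \<delta>\<^sup>2" "0 \<le> C / \<delta>" using C0 \<delta> by simp_all
    then show "f g0 \<le> L" using C[OF g0I] B0 unfolding L_def by linarith
    fix v
    show "\<bar>gain_cdf (g0 + v) - gain_cdf g0 - f g0 * v\<bar> \<le> L * v\<^sup>2"
    proof (cases "\<bar>v\<bar> \<le> \<delta>")
      case True
      have near: "f g0 - B * \<bar>v\<bar> \<le> f t \<and> f t \<le> f g0 + B * \<bar>v\<bar>" if "\<bar>t - g0\<bar> \<le> \<bar>v\<bar>" for t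
      proof -
        have "g / 2 \<le> t" "t \<le> 2 * g" using that True g0 unfolding \<delta>_def by linarith+
        then have "t \<in> ?I" by simp
        then have "\<bar>f t - f g0\<bar> \<le> B * \<bar>t - g0\<bar>" using lip g0I by blast
        also have "\<dots> \<le> B * \<bar>v\<bar>" using that B0 by (intro mult_left_mono) auto
        finally show ?thesis by linarith
      qed
      have hi0: "0 \<le> f g0 + B * \<bar>v\<bar>" using f_nonneg B0 by simp
      have "\<bar>gain_cdf (g0 + v) - gain_cdf g0 - f g0 * v\<bar> \<le> B * v\<^sup>2"
      proof (cases "v \<ge> 0")
        case v: True
        have "f g0 - B * \<bar>v\<bar> \<le> f t \<and> f t \<le> f g0 + B * \<bar>v\<bar>" if "g0 < t" "t \<le> g0 + v" for t
          by (rule near) (use that in linarith)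
        from gain_cdf_diff_bounds[OF _ this hi0, of g0 "g0 + v"]
        have "(f g0 - B * \<bar>v\<bar>) * (g0 + v - g0) \<le> gain_cdf (g0 + v) - gain_cdf g0"
          "gain_cdf (g0 + v) - gain_cdf g0 \<le> (f g0 + B * \<bar>v\<bar>) * (g0 + v - g0)"
          using v by simp_all
        then show ?thesis using v by (simp add: abs_le_iff algebra_simps power2_eq_square)
      next
        case v: False
        have "f g0 - B * \<bar>v\<bar> \<le> f t \<and> f t \<le> f g0 + B * \<bar>v\<bar>" if "g0 + v < t" "t \<le> g0" for t
          by (rule near) (use that in linarith)
        from gain_cdf_diff_bounds[OF _ this hi0, of "g0 + v" g0]
        have "(f g0 - B * \<bar>v\<bar>) * (g0 - (g0 + v)) \<le> gain_cdf g0 - gain_cdf (g0 + v)"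
          "gain_cdf g0 - gain_cdf (g0 + v) \<le> (f g0 + B * \<bar>v\<bar>) * (g0 - (g0 + v))"
          using v by simp_all
        then show ?thesis using v by (simp add: abs_le_iff algebra_simps power2_eq_square)
      qed
      also have "\<dots> \<le> L * v\<^sup>2" using C0 \<delta> by (intro mult_right_mono) (auto simp: L_def)
      finally show ?thesis .
    next
      case False
      then have v: "1 \<le> \<bar>v\<bar> / \<delta>" using \<delta> by simp
      have "1 \<le> (\<bar>v\<bar> / \<delta>)^2" using v by (simp add: one_le_power)
      then have 1: "1 \<le> 1 / \<delta>\<^sup>2 * v\<^sup>2" by (simp add: power_divide)
      have "f g0 * \<bar>v\<bar> \<le> C * \<bar>v\<bar>" using C[OF g0I] by (intro mult_right_mono) auto
      also have "C * \<bar>v\<bar> * 1 \<le> C * \<bar>v\<bar> * (\<bar>v\<bar> / \<delta>)" using v C0 by (intro mult_left_mono) auto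
      finally have 2: "f g0 * \<bar>v\<bar> \<le> C / \<delta> * v\<^sup>2" by (simp add: power2_eq_square mult.assoc)
      have "\<bar>gain_cdf (g0 + v) - gain_cdf g0 - f g0 * v\<bar> \<le> 1 + f g0 * \<bar>v\<bar>"
      proof -
        have "\<bar>f g0 * v\<bar> = f g0 * \<bar>v\<bar>" using f_nonneg by (simp add: abs_mult)
        moreover have "\<bar>gain_cdf (g0 + v) - gain_cdf g0\<bar> \<le> 1"
          using gain_cdf_bounds[of "g0 + v"] gain_cdf_bounds[of g0] by linarith
        ultimately show ?thesis by linarith
      qed
      also have "\<dots> \<le> (1 / \<delta>\<^sup>2 + C / \<delta>) * v\<^sup>2" using 1 2 by (simp add: distrib_right)
      also have "\<dots> \<le> L * v\<^sup>2" using B0 C0 by (intro mult_right_mono) (auto simp: L_def)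
      finally show ?thesis .
    qed
  qed
  then show ?thesis by blast
qed

text \<open>Linearizing the threshold event at \<open>g0\<close> costs only a quadratic error, because the perturbation
  \<open>a * \<alpha> + b * \<beta>\<close> varies by \<open>O((\<bar>a\<bar> + \<bar>b\<bar>) * \<bar>g - g0\<bar>)\<close>.\<close>
lemma perturbed_threshold:
  assumes Q: "quadratic_at L g0" and K: "0 \<le> K"
    and \<alpha>: "\<And>g. g \<ge> 0 \<Longrightarrow> \<bar>\<alpha> g - \<alpha> g0\<bar> \<le> K * \<bar>g - g0\<bar>" "\<bar>\<alpha> g0\<bar> \<le> K"
    and \<beta>: "\<And>g. g \<ge> 0 \<Longrightarrow> \<bar>\<beta> g - \<beta> g0\<bar> \<le> K * \<bar>g - g0\<bar>" "\<bar>\<beta> g0\<bar> \<le> K"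
    and [measurable]: "\<alpha> \<in> borel_measurable borel" "\<beta> \<in> borel_measurable borel"
  shows "\<bar>measure H {h. (norm h)^2 - g0 + (a * \<alpha> ((norm h)^2) + b * \<beta> ((norm h)^2)) \<le> 0}
      - (gain_cdf g0 - f g0 * (a * \<alpha> g0 + b * \<beta> g0))\<bar> \<le> (6 * L * K\<^sup>2 + 4 * K\<^sup>2) * (\<bar>a\<bar> + \<bar>b\<bar>)^2"
proof -
  define w where "w = \<bar>a\<bar> + \<bar>b\<bar>"
  \<comment> \<open>\<open>u\<close> is the perturbation frozen at \<open>g0\<close>;
    \<open>\<kappa>\<close> bounds both its size and the Lipschitz constant of the perturbation at
    \<open>g0\<close>.\<close>
  define \<kappa> where "\<kappa> = K * w"
  define u where "u = a * \<alpha> g0 + b * \<beta> g0"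
  define p where "p g = a * \<alpha> g + b * \<beta> g" for g
  let ?E = "{h::complex^'r. (norm h)^2 - g0 + p ((norm h)^2) \<le> 0}"
  have [measurable]: "p \<in> borel_measurable borel" unfolding p_def by measurable
  have w0: "w \<ge> 0" by (simp add: w_def)
  have \<kappa>0: "\<kappa> \<ge> 0" using w0 K by (simp add: \<kappa>_def)
  have f0: "0 \<le> f g0" "f g0 \<le> L" using Q by (auto simp: quadratic_at_def)
  have u: "\<bar>u\<bar> \<le> \<kappa>"
  proof -
    have "\<bar>u\<bar> \<le> \<bar>a\<bar> * \<bar>\<alpha> g0\<bar> + \<bar>b\<bar> * \<bar>\<beta> g0\<bar>" unfolding u_def by (metis abs_mult abs_triangle_ineq)
    also have "\<dots> \<le> \<bar>a\<bar> * K + \<bar>b\<bar> * K" using \<alpha> \<beta> by (intro add_mono mult_left_mono) auto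
    finally show ?thesis by (simp add: \<kappa>_def w_def algebra_simps)
  qed
  have pu: "\<bar>p g - u\<bar> \<le> \<kappa> * \<bar>g - g0\<bar>" if "g \<ge> 0" for g
  proof -
    have "p g - u = a * (\<alpha> g - \<alpha> g0) + b * (\<beta> g - \<beta> g0)" by (simp add: p_def u_def algebra_simps)
    then have "\<bar>p g - u\<bar> \<le> \<bar>a\<bar> * \<bar>\<alpha> g - \<alpha> g0\<bar> + \<bar>b\<bar> * \<bar>\<beta> g - \<beta> g0\<bar>" by (metis abs_mult abs_triangle_ineq)
    also have "\<dots> \<le> \<bar>a\<bar> * (K * \<bar>g - g0\<bar>) + \<bar>b\<bar> * (K * \<bar>g - g0\<bar>)"
      using \<alpha> \<beta> that by (intro add_mono mult_left_mono) auto
    finally show ?thesis by (simp add: \<kappa>_def w_def algebra_simps)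
  qed
  have "\<bar>measure H ?E - (gain_cdf g0 - f g0 * u)\<bar> \<le> (6 * L + 4) * \<kappa>\<^sup>2"
  proof (cases "\<kappa> \<le> 1 / 2")
    case True
    have fk: "f g0 * (2 * \<kappa> * \<bar>u\<bar>) \<le> L * (2 * \<kappa> * \<kappa>)"
      using f0 \<kappa>0 u by (intro mult_mono mult_left_mono) auto
    have sq: "(- u + c * (2 * \<kappa> * \<bar>u\<bar>))^2 \<le> (2 * \<kappa>)^2" if "\<bar>c\<bar> = 1" for c
    proof -
      have "\<bar>- u + c * (2 * \<kappa> * \<bar>u\<bar>)\<bar> \<le> \<bar>u\<bar> + \<bar>c\<bar> * (2 * \<kappa> * \<bar>u\<bar>)"
        using \<kappa>0 abs_triangle_ineq[of "-u" "c * (2 * \<kappa> * \<bar>u\<bar>)"] by (simp add: abs_mult)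
      also have "2 * \<kappa> * \<bar>u\<bar> \<le> 1 * \<bar>u\<bar>" using True by (intro mult_right_mono) auto
      finally have "\<bar>- u + c * (2 * \<kappa> * \<bar>u\<bar>)\<bar> \<le> 2 * \<kappa>" using u that by (simp add: mult_left_mono)
      then have "\<bar>- u + c * (2 * \<kappa> * \<bar>u\<bar>)\<bar> \<le> \<bar>2 * \<kappa>\<bar>" using \<kappa>0 by simp
      then show ?thesis by (simp only: abs_le_square_iff)
    qed
    have ab: "\<bar>gain_cdf (g0 + v) - gain_cdf g0 - f g0 * v\<bar> \<le> L * v\<^sup>2" for v
      using Q by (auto simp: quadratic_at_def)
    have quad: "L * (- u + c * (2 * \<kappa> * \<bar>u\<bar>))^2 \<le> 4 * L * \<kappa>\<^sup>2" if "\<bar>c\<bar> = 1" for c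
      using mult_left_mono[OF sq[OF that], of L] f0 by (simp add: power_mult_distrib)
    \<comment> \<open>Replacing the perturbation by \<open>u\<close> plus or minus
      \<open>\<kappa> * \<bar>t\<bar>\<close>, with \<open>t\<close> the gain minus
      \<open>g0\<close>, moves the threshold from \<open>- u\<close> to \<open>- u\<close> divided
      by 1 plus or minus \<open>\<kappa>\<close>. For \<open>\<kappa> \<le> 1 / 2\<close> this
      divisor changes it by at most \<open>2 * \<kappa> * \<bar>u\<bar>\<close>.\<close>
    let ?lo = "- u + (-1) * (2 * \<kappa> * \<bar>u\<bar>)" and ?hi = "- u + 1 * (2 * \<kappa> * \<bar>u\<bar>)"
    have "{h::complex^'r. (norm h)^2 \<le> g0 + ?lo} \<subseteq> ?E"
    proof (intro subsetI CollectI)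
      fix h :: "complex^'r"
      define t where "t = (norm h)^2 - g0"
      assume "h \<in> {h. (norm h)^2 \<le> g0 + ?lo}"
      then have t: "t \<le> - u - 2 * \<kappa> * \<bar>u\<bar>" by (simp add: t_def)
      have "t + u + \<kappa> * \<bar>t\<bar> \<le> 0"
      proof (cases "t \<ge> 0")
        case pos: True
        have "2 * \<kappa> * \<bar>u\<bar> \<ge> 0" using \<kappa>0 by simp
        then have un: "u \<le> 0" using t pos by linarith
        then have "t \<le> (1 - 2 * \<kappa>) * \<bar>u\<bar>" using t by (simp add: algebra_simps)
        then have "(1 + \<kappa>) * t \<le> (1 + \<kappa>) * ((1 - 2 * \<kappa>) * \<bar>u\<bar>)" using \<kappa>0 by (intro mult_left_mono) auto
        also have "\<dots> = \<bar>u\<bar> - (\<kappa> + 2 * \<kappa>\<^sup>2) * \<bar>u\<bar>" by (simp add: algebra_simps power2_eq_square)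
        also have "\<dots> \<le> \<bar>u\<bar>" using \<kappa>0 by simp
        finally show ?thesis using pos un by (simp add: algebra_simps)
      next
        case neg: False
        show ?thesis
        proof (cases "u \<ge> 0")
          case True
          have "(1 - \<kappa>) * t \<le> (1 - \<kappa>) * (- u - 2 * \<kappa> * u)"
            using t True \<open>\<kappa> \<le> 1/2\<close> by (intro mult_left_mono) auto
          also have "\<dots> = - u - \<kappa> * (1 - 2 * \<kappa>) * u" by (simp add: algebra_simps)
          also have "\<dots> \<le> - u" using \<kappa>0 \<open>\<kappa> \<le> 1/2\<close> True by (simp add: mult_nonneg_nonneg)
          finally show ?thesis using neg by (simp add: algebra_simps)
        next
          case False
          have "(1 - \<kappa>) * t \<le> 0" using neg \<open>\<kappa> \<le> 1/2\<close> by (intro mult_nonneg_nonpos) auto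
          moreover have "t + \<kappa> * \<bar>t\<bar> = (1 - \<kappa>) * t" using neg by (simp add: algebra_simps)
          ultimately show ?thesis using False by linarith
        qed
      qed
      moreover have "p ((norm h)^2) \<le> u + \<kappa> * \<bar>t\<bar>" using pu[of "(norm h)^2"] by (simp add: t_def abs_le_iff)
      ultimately show "(norm h)^2 - g0 + p ((norm h)^2) \<le> 0" by (simp add: t_def)
    qed
    then have 1: "gain_cdf (g0 + ?lo) \<le> measure H ?E"
      unfolding gain_cdf_def by (intro H.finite_measure_mono) measurable
    have "?E \<subseteq> {h::complex^'r. (norm h)^2 \<le> g0 + ?hi}"
    proof (intro subsetI CollectI)
      fix h :: "complex^'r"
      define t where "t = (norm h)^2 - g0"
      assume "h \<in> ?E"
      then have "(norm h)^2 - g0 + p ((norm h)^2) \<le> 0" by simp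
      moreover have "p ((norm h)^2) \<ge> u - \<kappa> * \<bar>t\<bar>" using pu[of "(norm h)^2"] by (simp add: t_def abs_le_iff)
      ultimately have t: "t + u - \<kappa> * \<bar>t\<bar> \<le> 0" by (simp add: t_def)
      have "t \<le> - u + 2 * \<kappa> * \<bar>u\<bar>"
      proof (cases "t \<ge> 0")
        case pos: True
        have t': "(1 - \<kappa>) * t \<le> - u" using t pos by (simp add: algebra_simps)
        moreover have "(1 - \<kappa>) * t \<ge> 0" using pos True by simp
        ultimately have un: "u \<le> 0" by linarith
        have "(1 + 2 * \<kappa>) * ((1 - \<kappa>) * t) \<le> (1 + 2 * \<kappa>) * (- u)" using t' \<kappa>0 by (intro mult_left_mono) auto
        moreover have "(1 + 2 * \<kappa>) * ((1 - \<kappa>) * t) = t + \<kappa> * (1 - 2 * \<kappa>) * t" by (simp add: algebra_simps)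
        moreover have "\<kappa> * (1 - 2 * \<kappa>) * t \<ge> 0" using \<kappa>0 True pos by simp
        ultimately show ?thesis using un by (simp add: algebra_simps)
      next
        case neg: False
        show ?thesis
        proof (cases "u \<ge> 0")
          case up: True
          have t': "(1 + \<kappa>) * t \<le> - u" using t neg by (simp add: algebra_simps)
          have "(1 - \<kappa>) * ((1 + \<kappa>) * t) \<le> (1 - \<kappa>) * (- u)" using t' True by (intro mult_left_mono) auto
          moreover have "(1 - \<kappa>) * ((1 + \<kappa>) * t) = t - \<kappa>\<^sup>2 * t" by (simp add: algebra_simps power2_eq_square)
          moreover have "\<kappa>\<^sup>2 * t \<le> 0" using neg by (intro mult_nonneg_nonpos) auto
          moreover have "\<kappa> * u \<ge> 0" using \<kappa>0 up by simp
          moreover have "(1 - \<kappa>) * (- u) = - u + \<kappa> * u" "2 * \<kappa> * \<bar>u\<bar> = 2 * (\<kappa> * u)"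
            using up by (simp_all add: left_diff_distrib)
          ultimately show ?thesis by linarith
        next
          case False
          have "2 * \<kappa> * \<bar>u\<bar> \<ge> 0" using \<kappa>0 by simp
          then show ?thesis using neg False by linarith
        qed
      qed
      then show "(norm h)^2 \<le> g0 + ?hi" by (simp add: t_def)
    qed
    then have 2: "measure H ?E \<le> gain_cdf (g0 + ?hi)"
      unfolding gain_cdf_def by (intro H.finite_measure_mono) measurable
    have e: "f g0 * ?lo = - (f g0 * u) - f g0 * (2 * \<kappa> * \<bar>u\<bar>)"
      "f g0 * ?hi = - (f g0 * u) + f g0 * (2 * \<kappa> * \<bar>u\<bar>)" by (simp_all add: algebra_simps)
    \<comment> \<open>Of the constant \<open>6 * L\<close>, a part \<open>4 * L\<close> is the
      quadratic error at a shift of size at most \<open>2 * \<kappa>\<close>, and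
      \<open>2 * L\<close> comes from moving the threshold in the linear term.\<close>
    have fk': "f g0 * (2 * \<kappa> * \<bar>u\<bar>) \<le> 2 * L * \<kappa>\<^sup>2" using fk by (simp add: power2_eq_square)
    have l: "gain_cdf g0 - f g0 * u - 6 * L * \<kappa>\<^sup>2 \<le> measure H ?E"
      using ab[of ?lo, THEN abs_le_D2] quad[of "-1"] fk' 1 unfolding e by simp
    have r: "measure H ?E \<le> gain_cdf g0 - f g0 * u + 6 * L * \<kappa>\<^sup>2"
      using ab[of ?hi, THEN abs_le_D1] quad[of 1] fk' 2 unfolding e by simp
    have "(6 * L + 4) * \<kappa>\<^sup>2 = 6 * L * \<kappa>\<^sup>2 + 4 * \<kappa>\<^sup>2" "\<kappa>\<^sup>2 \<ge> 0" by (simp_all add: algebra_simps)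
    with l r show ?thesis unfolding abs_le_iff by linarith
  next
    case False
    \<comment> \<open>For large fluctuations the trivial bound 1 on a difference of probabilities is
      absorbed by \<open>4 * \<kappa>\<^sup>2\<close>.\<close>
    then have k: "1 \<le> 2 * \<kappa>" by simp
    have "1 \<le> (2 * \<kappa>)^2" using one_le_power[OF k, of 2] by simp
    then have 1: "1 \<le> 4 * \<kappa>\<^sup>2" by (simp add: power_mult_distrib)
    have "\<bar>f g0 * u\<bar> \<le> L * \<kappa>" using f0 u \<kappa>0 by (simp add: abs_mult mult_mono)
    also have "L * \<kappa> * 1 \<le> L * \<kappa> * (2 * \<kappa>)" using k f0 \<kappa>0 by (intro mult_left_mono) auto
    finally have 2: "\<bar>f g0 * u\<bar> \<le> 2 * L * \<kappa>\<^sup>2" by (simp add: power2_eq_square mult_ac)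
    have 3: "\<bar>measure H ?E - gain_cdf g0\<bar> \<le> 1"
      using gain_cdf_bounds[of g0] H.prob_le_1[of ?E] measure_nonneg[of H ?E] by linarith
    have "(6 * L + 4) * \<kappa>\<^sup>2 = 6 * (L * \<kappa>\<^sup>2) + 4 * \<kappa>\<^sup>2" "L * \<kappa>\<^sup>2 \<ge> 0" using f0 by (simp_all add: algebra_simps)
    then show ?thesis using 1 2 3 by linarith
  qed
  moreover have "(6 * L + 4) * \<kappa>\<^sup>2 = (6 * L * K\<^sup>2 + 4 * K\<^sup>2) * w\<^sup>2"
    by (simp add: \<kappa>_def power_mult_distrib distrib_right mult.assoc)
  ultimately show ?thesis by (simp only: w_def u_def p_def)
qed

end

text \<open>The square root is not Lipschitz at 0, but differences against a fixed point
  \<open>g0 \<ge> lo\<close> are controlled, since sqrt g + sqrt g0 is at least sqrt lo. All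
  constants depend on \<open>lo\<close> and \<open>hi\<close> only.\<close>

lemma snr_coeff_bounds:
  fixes \<rho> lo hi g0 g :: real
  assumes \<rho>: "\<rho> > 0" and lo: "0 < lo" "lo \<le> g0" "g0 \<le> hi" and g: "0 \<le> g"
  shows "\<bar>sqrt g - sqrt g0\<bar> \<le> (1 / sqrt lo) * \<bar>g - g0\<bar>"
    "\<bar>1 / (1 + \<rho> * g) - 1 / (1 + \<rho> * g0)\<bar> \<le> \<rho> * \<bar>g - g0\<bar>"
    "\<bar>sqrt g / (1 + \<rho> * g) - sqrt g0 / (1 + \<rho> * g0)\<bar> \<le> (1 / sqrt lo + sqrt hi * \<rho>) * \<bar>g - g0\<bar>"
    "\<bar>g / (1 + \<rho> * g) - g0 / (1 + \<rho> * g0)\<bar> \<le> \<bar>g - g0\<bar>"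
proof -
  have g0: "g0 > 0" using lo by simp
  have pos: "1 + \<rho> * g \<ge> 1" "1 + \<rho> * g0 \<ge> 1" using \<rho> g g0 by auto
  have "(sqrt g - sqrt g0) * (sqrt g + sqrt g0) = g - g0"
    using g g0 by (simp add: algebra_simps)
  then have e: "\<bar>sqrt g - sqrt g0\<bar> * (sqrt g + sqrt g0) = \<bar>g - g0\<bar>"
    using g g0 by (metis abs_mult abs_of_nonneg add_nonneg_nonneg less_imp_le real_sqrt_ge_0_iff)
  have "\<bar>sqrt g - sqrt g0\<bar> * sqrt lo \<le> \<bar>sqrt g - sqrt g0\<bar> * (sqrt g + sqrt g0)"
    using lo g by (intro mult_left_mono) (auto intro: add_increasing)
  then show 1: "\<bar>sqrt g - sqrt g0\<bar> \<le> (1 / sqrt lo) * \<bar>g - g0\<bar>"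
    using lo e by (simp add: field_simps)
  have prod: "(1 + \<rho> * g) * (1 + \<rho> * g0) \<ge> 1" using mult_mono[of 1 "1 + \<rho> * g" 1 "1 + \<rho> * g0"] pos by simp
  then have ab: "\<bar>(1 + \<rho> * g) * (1 + \<rho> * g0)\<bar> = (1 + \<rho> * g) * (1 + \<rho> * g0)" by simp
  have "1 / (1 + \<rho> * g) - 1 / (1 + \<rho> * g0) = \<rho> * (g0 - g) / ((1 + \<rho> * g) * (1 + \<rho> * g0))"
    using pos by (simp add: field_simps)
  then have "\<bar>1 / (1 + \<rho> * g) - 1 / (1 + \<rho> * g0)\<bar> = \<rho> * \<bar>g - g0\<bar> / ((1 + \<rho> * g) * (1 + \<rho> * g0))"
    using \<rho> by (simp only: abs_divide ab) (simp add: abs_mult abs_minus_commute)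
  also have "\<dots> \<le> \<rho> * \<bar>g - g0\<bar> / 1" using prod \<rho> by (intro divide_left_mono) auto
  finally show 2: "\<bar>1 / (1 + \<rho> * g) - 1 / (1 + \<rho> * g0)\<bar> \<le> \<rho> * \<bar>g - g0\<bar>" by simp
  have "sqrt g / (1 + \<rho> * g) - sqrt g0 / (1 + \<rho> * g0) = (sqrt g - sqrt g0) * (1 / (1 + \<rho> * g)) + sqrt g0 * (1 / (1 + \<rho> * g) - 1 / (1 + \<rho> * g0))"
    by (simp add: divide_inverse algebra_simps)
  also have "\<bar>\<dots>\<bar> \<le> \<bar>sqrt g - sqrt g0\<bar> * (1 / (1 + \<rho> * g)) + sqrt g0 * \<bar>1 / (1 + \<rho> * g) - 1 / (1 + \<rho> * g0)\<bar>"
    using pos g0 by (intro order_trans[OF abs_triangle_ineq]) (simp add: abs_mult)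
  also have "\<dots> \<le> (1 / sqrt lo) * \<bar>g - g0\<bar> * 1 + sqrt hi * (\<rho> * \<bar>g - g0\<bar>)"
    using 1 2 pos lo g0 \<rho> by (intro add_mono mult_mono) auto
  finally show "\<bar>sqrt g / (1 + \<rho> * g) - sqrt g0 / (1 + \<rho> * g0)\<bar> \<le> (1 / sqrt lo + sqrt hi * \<rho>) * \<bar>g - g0\<bar>"
    by (simp add: algebra_simps)
  have "g / (1 + \<rho> * g) - g0 / (1 + \<rho> * g0) = (g - g0) / ((1 + \<rho> * g) * (1 + \<rho> * g0))"
    using pos by (simp add: field_simps)
  then have "\<bar>g / (1 + \<rho> * g) - g0 / (1 + \<rho> * g0)\<bar> = \<bar>g - g0\<bar> / ((1 + \<rho> * g) * (1 + \<rho> * g0))"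
    by (simp only: abs_divide ab)
  also have "\<dots> \<le> \<bar>g - g0\<bar> / 1" using prod by (intro divide_left_mono) auto
  finally show "\<bar>g / (1 + \<rho> * g) - g0 / (1 + \<rho> * g0)\<bar> \<le> \<bar>g - g0\<bar>" by simp
qed

text \<open>Only differences against the single point \<open>g0\<close> are bounded, which is all
  that freezing a coefficient there requires and is true of the square root.\<close>

definition lip_at :: "real \<Rightarrow> (real \<Rightarrow> real) \<Rightarrow> real \<Rightarrow> bool" where
  "lip_at K \<alpha> g0 \<longleftrightarrow> (\<forall>g\<ge>0. \<bar>\<alpha> g - \<alpha> g0\<bar> \<le> K * \<bar>g - g0\<bar>) \<and> \<bar>\<alpha> g0\<bar> \<le> K \<and> \<alpha> \<in> borel_measurable borel"

lemma lip_at_mono: "lip_at K \<alpha> g0 \<Longrightarrow> K \<le> K' \<Longrightarrow> lip_at K' \<alpha> g0"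
  unfolding lip_at_def by (meson abs_ge_zero mult_right_mono order_trans)

lemma lip_at_cmult:
  assumes "lip_at K \<alpha> g0"
  shows "lip_at (\<bar>c\<bar> * K) (\<lambda>g. c * \<alpha> g) g0"
proof -
  have "\<bar>c * \<alpha> g - c * \<alpha> g0\<bar> \<le> \<bar>c\<bar> * K * \<bar>g - g0\<bar>" if "g \<ge> 0" for g
  proof -
    have "\<bar>c * \<alpha> g - c * \<alpha> g0\<bar> = \<bar>c\<bar> * \<bar>\<alpha> g - \<alpha> g0\<bar>" by (simp add: abs_mult[symmetric] right_diff_distrib)
    also have "\<dots> \<le> \<bar>c\<bar> * (K * \<bar>g - g0\<bar>)" using assms that by (intro mult_left_mono) (auto simp: lip_at_def)
    finally show ?thesis by (simp add: mult.assoc)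
  qed
  then show ?thesis using assms by (auto simp: lip_at_def abs_mult mult_left_mono)
qed

text \<open>Coefficients of the two fluctuations after each error event is rescaled so that the gain
  enters as \<open>g - g0\<close>; the scaling puts \<open>(1 + \<rho> * g0) / \<rho>\<close> into
  the converse and \<open>1 / \<rho>\<close> into the angle test. The energy coefficient of the
  angle test is the constant \<open>- g0\<close>.\<close>

definition conv_lin :: "real \<Rightarrow> real \<Rightarrow> real \<Rightarrow> real" where
  "conv_lin \<rho> g0 g = (1 + \<rho> * g0) / \<rho> * (sqrt g / (1 + \<rho> * g))"
definition conv_energy :: "real \<Rightarrow> real \<Rightarrow> real \<Rightarrow> real" where
  "conv_energy \<rho> g0 g = - (1 + \<rho> * g0) * (g / (1 + \<rho> * g))"
definition ach_lin :: "real \<Rightarrow> real \<Rightarrow> real" where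
  "ach_lin \<rho> g = (1 / \<rho>) * sqrt g"

lemma ex_lip_at:
  assumes \<rho>: "\<rho> > 0" and lo: "0 < lo"
  shows "\<exists>K\<ge>0. \<forall>g0. lo \<le> g0 \<and> g0 \<le> hi \<longrightarrow> lip_at K (conv_lin \<rho> g0) g0 \<and> lip_at K (conv_energy \<rho> g0) g0
    \<and> lip_at K (ach_lin \<rho>) g0 \<and> lip_at K (\<lambda>_. - g0) g0"
proof -
  define K1 where "K1 = 1 / sqrt lo + sqrt \<bar>hi\<bar> * \<rho> + sqrt \<bar>hi\<bar> + \<bar>hi\<bar> + 1"
  define K where "K = ((1 + \<rho> * \<bar>hi\<bar>) / \<rho> + (1 + \<rho> * \<bar>hi\<bar>) + 1 / \<rho> + 1) * K1"
  have K1: "K1 \<ge> 0" using lo \<rho> by (simp add: K1_def)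
  have le: "c * K1 \<le> K" if "c \<le> (1 + \<rho> * \<bar>hi\<bar>) / \<rho> + (1 + \<rho> * \<bar>hi\<bar>) + 1 / \<rho> + 1" for c
    unfolding K_def using that K1 by (intro mult_right_mono)
  have nn: "0 \<le> (1 + \<rho> * \<bar>hi\<bar>) / \<rho>" "0 \<le> (1 + \<rho> * \<bar>hi\<bar>)" "0 \<le> 1 / \<rho>" using \<rho> by simp_all
  have "K \<ge> 0" using nn K1 by (simp add: K_def)
  moreover have "lip_at K (conv_lin \<rho> g0) g0 \<and> lip_at K (conv_energy \<rho> g0) g0 \<and> lip_at K (ach_lin \<rho>) g0 \<and> lip_at K (\<lambda>_. - g0) g0"
    if g0: "lo \<le> g0" "g0 \<le> hi" for g0
  proof -
    have hi: "\<bar>hi\<bar> = hi" "g0 > 0" "sqrt g0 \<le> sqrt hi" using g0 lo by auto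
    note b = snr_coeff_bounds[OF \<rho> lo g0]
    have terms: "0 \<le> 1 / sqrt lo" "0 \<le> sqrt hi * \<rho>" "0 \<le> sqrt hi" "0 \<le> hi" using lo \<rho> hi g0 by auto
    have up: "c * \<bar>g - g0\<bar> \<le> K1 * \<bar>g - g0\<bar>" if "c \<le> K1" for c g using that by (intro mult_right_mono) auto
    have d: "1 + \<rho> * g0 \<ge> 1" using \<rho> hi by simp
    have 1: "lip_at K1 (\<lambda>g. sqrt g / (1 + \<rho> * g)) g0" unfolding lip_at_def
    proof (intro conjI allI impI)
      fix g :: real assume g: "g \<ge> 0"
      show "\<bar>sqrt g / (1 + \<rho> * g) - sqrt g0 / (1 + \<rho> * g0)\<bar> \<le> K1 * \<bar>g - g0\<bar>"
        by (rule order_trans[OF b(3)[OF g] up]) (unfold K1_def hi(1), use terms in linarith)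
    next
      have "\<bar>sqrt g0 / (1 + \<rho> * g0)\<bar> \<le> sqrt g0" using d hi by (simp add: divide_le_eq)
      also have "\<dots> \<le> K1" unfolding K1_def hi(1) using terms hi(2,3) by linarith
      finally show "\<bar>sqrt g0 / (1 + \<rho> * g0)\<bar> \<le> K1" .
    qed measurable
    have 2: "lip_at K1 (\<lambda>g. g / (1 + \<rho> * g)) g0" unfolding lip_at_def
    proof (intro conjI allI impI)
      fix g :: real assume g: "g \<ge> 0"
      show "\<bar>g / (1 + \<rho> * g) - g0 / (1 + \<rho> * g0)\<bar> \<le> K1 * \<bar>g - g0\<bar>"
      proof -
        have "1 \<le> K1" unfolding K1_def hi(1) using terms by linarith
        from order_trans[OF b(4)[OF g]] up[OF this, of g] show ?thesis by simp
      qed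
    next
      have "\<bar>g0 / (1 + \<rho> * g0)\<bar> \<le> g0" using d hi by (simp add: divide_le_eq)
      also have "\<dots> \<le> K1" unfolding K1_def hi(1) using terms g0 by linarith
      finally show "\<bar>g0 / (1 + \<rho> * g0)\<bar> \<le> K1" .
    qed measurable
    have 3: "lip_at K1 sqrt g0" unfolding lip_at_def
    proof (intro conjI allI impI)
      fix g :: real assume g: "g \<ge> 0"
      show "\<bar>sqrt g - sqrt g0\<bar> \<le> K1 * \<bar>g - g0\<bar>"
        by (rule order_trans[OF b(1)[OF g] up]) (unfold K1_def hi(1), use terms in linarith)
    next
      have "\<bar>sqrt g0\<bar> = sqrt g0" using hi by simp
      then show "\<bar>sqrt g0\<bar> \<le> K1" unfolding K1_def hi(1) using terms hi(2,3) by linarith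
    qed measurable
    have 4: "lip_at K1 (\<lambda>_. - g0) g0"
    proof -
      have "g0 \<le> K1" unfolding K1_def hi(1) using terms g0 by linarith
      then show ?thesis unfolding lip_at_def using hi(2) K1 by simp
    qed
    have m: "\<rho> * g0 \<le> \<rho> * \<bar>hi\<bar>" using \<rho> g0 by (intro mult_left_mono) auto
    have "\<bar>(1 + \<rho> * g0) / \<rho>\<bar> \<le> (1 + \<rho> * \<bar>hi\<bar>) / \<rho>" using \<rho> m d by (simp add: divide_right_mono)
    moreover have "\<bar>- (1 + \<rho> * g0)\<bar> \<le> 1 + \<rho> * \<bar>hi\<bar>" using m d by simp
    moreover have "\<bar>1 / \<rho>\<bar> \<le> 1 / \<rho>" using \<rho> by simp
    ultimately show ?thesis
      using lip_at_mono[OF lip_at_cmult[OF 1, of "(1 + \<rho> * g0) / \<rho>"] le]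
        lip_at_mono[OF lip_at_cmult[OF 2, of "- (1 + \<rho> * g0)"] le]
        lip_at_mono[OF lip_at_cmult[OF 3, of "1 / \<rho>"] le]
        lip_at_mono[OF 4, of K] le[of 1] nn
      by (simp add: conv_lin_def[abs_def] conv_energy_def[abs_def] ach_lin_def[abs_def])
  qed
  ultimately show ?thesis by blast
qed

section \<open>Averaging the threshold event over the noise\<close>

lemma measurable_fluct [measurable]:
  "fluct_lin n x \<in> borel_measurable (cn_blk n)" "fluct_energy n \<in> borel_measurable (cn_blk n)"
  unfolding fluct_lin_def fluct_energy_def
  by (intro borel_measurable_divide borel_measurable_times borel_measurable_sum measurable_const
      measurable_compose[OF _ borel_measurable_Re] borel_measurable_diff borel_measurable_power borel_measurable_norm measurable_blk_component; simp)+

context fading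
begin

abbreviation "noise n \<equiv> noise_blk n :: (nat \<Rightarrow> complex^'r) measure"
abbreviation "chan n \<equiv> H \<Otimes>\<^sub>M noise n"

lemma pair_prob_space_noise: "pair_prob_space H (noise n)"
proof -
  interpret N: prob_space "noise n" by (rule prob_space_noise_blk)
  show ?thesis ..
qed

lemma prob_space_chan: "prob_space (chan n)"
proof -
  interpret PN: pair_prob_space H "noise n" by (rule pair_prob_space_noise)
  show ?thesis by (rule PN.P.prob_space_axioms)
qed

text \<open>For every nonzero \<open>h\<close> the projected noise has the same law, whatever the
  direction of \<open>h\<close>. Exchanging the integrals then leaves, for each fixed noise block, a
  probability over the gain alone, to which \<open>perturbed_threshold\<close> applies.\<close>

lemma prob_gain_rows:
  assumes E: "Measurable.pred (borel \<Otimes>\<^sub>M cn_blk n) (\<lambda>p. E (fst p) (snd p))"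
  shows "measure (chan n) {p \<in> space (chan n). E ((norm (fst p))^2) (rows_dir n (sgn (fst p)) (snd p))}
     = (\<integral>z. measure H {h. E ((norm h)^2) z} \<partial>cn_blk n)"
    and "(\<lambda>z. measure H {h. E ((norm h)^2) z}) \<in> borel_measurable (cn_blk n)"
proof -
  interpret N: prob_space "noise n" by (rule prob_space_noise_blk)
  interpret C: prob_space "cn_blk n" by (rule prob_space_cn_blk)
  interpret P: pair_sigma_finite H "cn_blk n" ..
  interpret PN: pair_prob_space H "noise n" by (rule pair_prob_space_noise)
  define F where "F h z = (if E ((norm h)^2) z then 1 else 0 :: ennreal)" for h :: "complex^'r" and z
  have EH: "Measurable.pred (H \<Otimes>\<^sub>M cn_blk n) (\<lambda>p. E ((norm (fst p))^2) (snd p))"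
    using measurable_compose[OF _ E, of "\<lambda>p. ((norm (fst p))^2, snd p)" "H \<Otimes>\<^sub>M cn_blk n"] by simp
  have F: "(\<lambda>(h, z). F h z) \<in> borel_measurable (H \<Otimes>\<^sub>M cn_blk n)"
    using EH unfolding F_def split_beta by measurable
  have EN: "Measurable.pred (chan n) (\<lambda>p. E ((norm (fst p))^2) (rows_dir n (sgn (fst p)) (snd p)))"
    using measurable_compose[OF _ E, of "\<lambda>p. ((norm (fst p))^2, rows_dir n (sgn (fst p)) (snd p))" "chan n"]
    by simp
  let ?S = "{p \<in> space (chan n). E ((norm (fst p))^2) (rows_dir n (sgn (fst p)) (snd p))}"
  have S: "?S \<in> sets (chan n)" using EN by (simp add: pred_def)
  have FN: "(\<lambda>p. F (fst p) (rows_dir n (sgn (fst p)) (snd p))) \<in> borel_measurable (chan n)"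
    using EN unfolding F_def by measurable
  have sec: "{h. E ((norm h)^2) z} \<in> sets H" if "z \<in> space (cn_blk n)" for z
  proof -
    have "Measurable.pred H (\<lambda>h. E ((norm h)^2) z)"
      using measurable_compose[OF measurable_Pair2'[OF that] EH] by simp
    then show ?thesis by (simp add: pred_def)
  qed
  have inner: "(\<integral>\<^sup>+h. F h z \<partial>H) = ennreal (measure H {h. E ((norm h)^2) z})" if "z \<in> space (cn_blk n)" for z
  proof -
    have "(\<integral>\<^sup>+h. F h z \<partial>H) = (\<integral>\<^sup>+h. indicator {h. E ((norm h)^2) z} h \<partial>H)"
      by (intro nn_integral_cong) (simp add: F_def indicator_def)
    then show ?thesis using sec[OF that] by (simp add: H.emeasure_eq_measure)
  qed
  have "(\<lambda>z. \<integral>\<^sup>+h. F h z \<partial>H) \<in> borel_measurable (cn_blk n)"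
    using F by (intro H.borel_measurable_nn_integral) (simp add: measurable_pair_swap_iff[of "\<lambda>(h, z). F h z"] split_beta)
  then have "(\<lambda>z. ennreal (measure H {h. E ((norm h)^2) z})) \<in> borel_measurable (cn_blk n)"
    by (rule measurable_cong[THEN iffD1, rotated]) (rule inner)
  then have "(\<lambda>z. enn2real (ennreal (measure H {h. E ((norm h)^2) z}))) \<in> borel_measurable (cn_blk n)"
    by measurable
  then show meas: "(\<lambda>z. measure H {h. E ((norm h)^2) z}) \<in> borel_measurable (cn_blk n)" by simp
  have "ennreal (measure (chan n) ?S) = emeasure (chan n) ?S"
    by (simp add: PN.emeasure_eq_measure)
  also have "\<dots> = (\<integral>\<^sup>+p. F (fst p) (rows_dir n (sgn (fst p)) (snd p)) \<partial>(chan n))"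
    by (subst nn_integral_indicator[OF S, symmetric]) (intro nn_integral_cong, simp add: F_def indicator_def)
  also have "\<dots> = (\<integral>\<^sup>+h. \<integral>\<^sup>+W. F h (rows_dir n (sgn h) W) \<partial>noise n \<partial>H)"
    using N.nn_integral_fst[OF FN, symmetric] by simp
  also have "\<dots> = (\<integral>\<^sup>+h. \<integral>\<^sup>+z. F h z \<partial>cn_blk n \<partial>H)"
  proof (rule nn_integral_cong_AE, rule AE_mp[OF AE_nonzero], rule AE_I2, intro impI)
    fix h assume "h \<in> space H" "h \<noteq> 0"
    then have "norm (sgn h) = 1" by (simp add: norm_sgn)
    moreover have "F h \<in> borel_measurable (cn_blk n)"
      using measurable_compose[OF measurable_Pair1'[OF \<open>h \<in> space H\<close>] F] by simp
    ultimately show "(\<integral>\<^sup>+W. F h (rows_dir n (sgn h) W) \<partial>noise n) = (\<integral>\<^sup>+z. F h z \<partial>cn_blk n)"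
      by (rule nn_integral_rows_dir)
  qed
  also have "\<dots> = (\<integral>\<^sup>+z. \<integral>\<^sup>+h. F h z \<partial>H \<partial>cn_blk n)"
    by (rule P.Fubini'[OF F, symmetric])
  also have "\<dots> = (\<integral>\<^sup>+z. ennreal (measure H {h. E ((norm h)^2) z}) \<partial>cn_blk n)"
    by (rule nn_integral_cong) (rule inner)
  also have "\<dots> = ennreal (\<integral>z. measure H {h. E ((norm h)^2) z} \<partial>cn_blk n)"
    by (intro nn_integral_eq_integral C.integrable_const_bound[of _ 1] meas) auto
  finally show "measure (chan n) ?S = (\<integral>z. measure H {h. E ((norm h)^2) z} \<partial>cn_blk n)"
    by (simp add: integral_nonneg)
qed

definition threshold_event ::
    "nat \<Rightarrow> (nat \<Rightarrow> complex) \<Rightarrow> (real \<Rightarrow> real) \<Rightarrow> (real \<Rightarrow> real) \<Rightarrow> real \<Rightarrow> ((complex^'r) \<times> (nat \<Rightarrow> complex^'r)) set" where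
  "threshold_event n x \<alpha> \<beta> g0 = {p \<in> space (chan n).
      (norm (fst p))^2 - g0 + (fluct_lin n x (rows_dir n (sgn (fst p)) (snd p)) * \<alpha> ((norm (fst p))^2)
        + fluct_energy n (rows_dir n (sgn (fst p)) (snd p)) * \<beta> ((norm (fst p))^2)) \<le> 0}"

text \<open>The constant of \<open>perturbed_threshold\<close> times n times the bound on the mean
  of 2 a^2 + 2 b^2, for the linear fluctuation a and the energy fluctuation b.\<close>

definition fluct_const :: "real \<Rightarrow> real \<Rightarrow> real \<Rightarrow> real" where
  "fluct_const L K \<rho> = (6 * L * K\<^sup>2 + 4 * K\<^sup>2) * (2 * (4 * \<rho>) + 2 * integral\<^sup>L cn1 (\<lambda>z. ((cmod z)^2 - 1)^2))"

text \<open>The mean-zero fluctuations do not contribute to first order, which is what makes the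
  \<open>1 / sqrt n\<close> dispersion term vanish.\<close>
lemma prob_threshold:
  assumes Q: "quadratic_at L g0" and K: "0 \<le> K" and \<alpha>: "lip_at K \<alpha> g0" and \<beta>: "lip_at K \<beta> g0"
    and n: "n > 0" and x: "(\<Sum>i<n. (cmod (x i))^2) \<le> real n * \<rho>"
  shows "\<bar>measure (chan n) (threshold_event n x \<alpha> \<beta> g0) - gain_cdf g0\<bar> \<le> fluct_const L K \<rho> / n"
proof -
  interpret C: prob_space "cn_blk n" by (rule prob_space_cn_blk)
  note m = fluct_moments[OF n x]
  let ?a = "fluct_lin n x" and ?b = "fluct_energy n"
  define E where "E g z \<longleftrightarrow> g - g0 + (?a z * \<alpha> g + ?b z * \<beta> g) \<le> 0" for g z
  have [measurable]: "\<alpha> \<in> borel_measurable borel" "\<beta> \<in> borel_measurable borel" using \<alpha> \<beta> by (auto simp: lip_at_def)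
  have pE: "Measurable.pred (borel \<Otimes>\<^sub>M cn_blk n) (\<lambda>p. E (fst p) (snd p))" unfolding E_def by measurable
  define \<theta> where "\<theta> z = measure H {h. E ((norm h)^2) z}" for z
  have [measurable]: "\<theta> \<in> borel_measurable (cn_blk n)" using prob_gain_rows(2)[OF pE] by (simp add: \<theta>_def[abs_def])
  have int\<theta>: "integrable (cn_blk n) \<theta>"
    by (rule C.integrable_const_bound[of _ 1]) (auto simp: \<theta>_def)
  define L' where "L' = 6 * L * K\<^sup>2 + 4 * K\<^sup>2"
  have L': "L' \<ge> 0" using Q K by (auto simp: L'_def quadratic_at_def)
  define lin where "lin z = gain_cdf g0 - (f g0 * \<alpha> g0 * ?a z + f g0 * \<beta> g0 * ?b z)" for z
  have lin: "integrable (cn_blk n) lin" "integral\<^sup>L (cn_blk n) lin = gain_cdf g0"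
    unfolding lin_def using m by (auto simp: C.prob_space)
  have bound: "\<bar>\<theta> z - lin z\<bar> \<le> L' * (2 * (?a z)^2 + 2 * (?b z)^2)" for z
  proof -
    have "\<bar>\<theta> z - lin z\<bar> \<le> L' * (\<bar>?a z\<bar> + \<bar>?b z\<bar>)^2"
      using perturbed_threshold[OF Q K, of \<alpha> \<beta> "?a z" "?b z"] \<alpha> \<beta>
      by (simp add: lip_at_def \<theta>_def E_def lin_def L'_def algebra_simps)
    also have "\<dots> \<le> L' * (2 * (?a z)^2 + 2 * (?b z)^2)"
    proof (rule mult_left_mono[OF _ L'])
      have "0 \<le> (\<bar>?a z\<bar> - \<bar>?b z\<bar>)^2" by simp
      then show "(\<bar>?a z\<bar> + \<bar>?b z\<bar>)^2 \<le> 2 * (?a z)^2 + 2 * (?b z)^2"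
        by (simp add: power2_eq_square algebra_simps)
    qed
    finally show ?thesis .
  qed
  have "\<bar>integral\<^sup>L (cn_blk n) \<theta> - gain_cdf g0\<bar> = \<bar>integral\<^sup>L (cn_blk n) (\<lambda>z. \<theta> z - lin z)\<bar>"
    using int\<theta> lin by simp
  also have "\<dots> \<le> integral\<^sup>L (cn_blk n) (\<lambda>z. \<bar>\<theta> z - lin z\<bar>)" by (rule integral_abs_bound)
  also have "\<dots> \<le> integral\<^sup>L (cn_blk n) (\<lambda>z. L' * (2 * (?a z)^2 + 2 * (?b z)^2))"
    using int\<theta> lin m bound by (intro integral_mono) auto
  also have "\<dots> = L' * (2 * integral\<^sup>L (cn_blk n) (\<lambda>z. (?a z)^2) + 2 * integral\<^sup>L (cn_blk n) (\<lambda>z. (?b z)^2))"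
    using m by simp
  also have "\<dots> \<le> L' * (2 * (4 * \<rho> / n) + 2 * (integral\<^sup>L cn1 (\<lambda>z. ((cmod z)^2 - 1)^2) / n))"
    using m(4) L' by (intro mult_left_mono add_mono) (simp_all add: m(8))
  also have "\<dots> = fluct_const L K \<rho> / n"
    by (simp add: fluct_const_def L'_def[symmetric] distrib_left add_divide_distrib)
  finally show ?thesis
    using prob_gain_rows(1)[OF pE] by (simp add: \<theta>_def[abs_def] E_def threshold_event_def)
qed

end

subsection \<open>Converse\<close>

text \<open>With this c, a complex Gaussian of variance 1 + \<rho> |h|^2 has density (1 - c) exp(c
  |y|^2) relative to CN(0,1).\<close>

definition out_coeff :: "real \<Rightarrow> complex^'r::finite \<Rightarrow> real" where
  "out_coeff \<rho> h = \<rho> * (norm h)^2 / (1 + \<rho> * (norm h)^2)"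

text \<open>Likelihood ratio of the capacity-achieving output distribution \<open>CN(0, I + \<rho> h h\<^sup>*)\<close> with respect
  to \<open>CN(0, I)\<close>.\<close>
definition out_dens :: "real \<Rightarrow> nat \<Rightarrow> complex^'r::finite \<Rightarrow> (nat \<Rightarrow> complex^'r) \<Rightarrow> real" where
  "out_dens \<rho> n h Y = (\<Prod>i<n. (1 - out_coeff \<rho> h) * exp (out_coeff \<rho> h * (cmod (cinner (sgn h) (Y i)))^2))"

lemma out_coeff:
  assumes "\<rho> > 0"
  shows "1 - out_coeff \<rho> h = 1 / (1 + \<rho> * (norm h)^2)" "out_coeff \<rho> h < 1"
proof -
  have *: "1 + \<rho> * (norm h)^2 > 0" using assms by (simp add: add_pos_nonneg)
  then show "1 - out_coeff \<rho> h = 1 / (1 + \<rho> * (norm h)^2)" by (simp add: out_coeff_def field_simps)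
  with * have "0 < 1 - out_coeff \<rho> h" by simp
  then show "out_coeff \<rho> h < 1" by simp
qed

lemma out_dens_nonneg: "\<rho> > 0 \<Longrightarrow> 0 \<le> out_dens \<rho> n h Y"
  unfolding out_dens_def using out_coeff(2)[of \<rho> h] by (intro prod_nonneg) auto

lemma cinner_sgn_self: "h \<noteq> 0 \<Longrightarrow> cinner (sgn h) h = complex_of_real (norm h)"
  by (simp add: sgn_div_norm cinner_simps cinner_self power2_eq_square)

lemma cinner_eq_sgn: "cinner h w = complex_of_real (norm h) * cinner (sgn h) w"
proof (cases "h = 0")
  case False
  then have "cinner h w = cinner (norm h *\<^sub>R sgn h) w" by (simp add: sgn_div_norm)
  then show ?thesis by (simp only: cinner_simps)
qed (simp add: cinner_def)

lemma chan_out_cinner_sgn: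
  assumes "h \<noteq> 0" "i < n"
  shows "cinner (sgn h) (chan_out n x h W i) = x i * complex_of_real (norm h) + rows_dir n (sgn h) W i"
  using assms by (simp add: chan_out_def cinner_simps cinner_sgn_self rows_dir_apply)

text \<open>The logarithm of the ratio of the two densities is at most n times ln (1 + \<rho> |h|^2)
  plus terms linear in the fluctuations. On the threshold event it stays below
  \<open>n * ln (1 + \<rho> * g0)\<close>.\<close>

lemma shift_dens_chan_out_le:
  fixes h :: "complex^'r::finite"
  assumes \<rho>: "\<rho> > 0" and g0: "g0 > 0" and n: "n > 0" and h: "h \<noteq> 0"
    and x: "(\<Sum>i<n. (cmod (x i))^2) \<le> real n * \<rho>"
    and ev: "(norm h)^2 - g0 + (fluct_lin n x (rows_dir n (sgn h) W) * conv_lin \<rho> g0 ((norm h)^2)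
        + fluct_energy n (rows_dir n (sgn h) W) * conv_energy \<rho> g0 ((norm h)^2)) \<le> 0"
  shows "shift_dens n x h (chan_out n x h W) \<le> (1 + \<rho> * g0) ^ n * out_dens \<rho> n h (chan_out n x h W)"
proof -
  define r where "r = norm h"
  define G where "G = r\<^sup>2"
  define \<theta> where "\<theta> = 1 + \<rho> * G"
  define \<theta>0 where "\<theta>0 = 1 + \<rho> * g0"
  define c where "c = out_coeff \<rho> h"
  define z where "z = rows_dir n (sgn h) W"
  define v where "v i = x i * complex_of_real r + z i" for i
  define a where "a = fluct_lin n x z"
  define b where "b = fluct_energy n z"
  have r: "r > 0" "sqrt G = r" using h by (simp_all add: r_def G_def)
  have \<theta>: "\<theta> \<ge> 1" "\<theta>0 > 1" using \<rho> g0 by (simp_all add: \<theta>_def \<theta>0_def G_def)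
  have c1: "1 - c = 1 / \<theta>" and cG: "c = \<rho> * G / \<theta>"
    using out_coeff(1)[OF \<rho>, of h] by (simp_all add: c_def \<theta>_def G_def r_def out_coeff_def)
  have na: "(\<Sum>i<n. 2 * Re (cnj (x i) * z i)) = n * a"
  proof -
    have "n * a = 2 * (\<Sum>i<n. Re (cnj (x i) * z i))" using n by (simp add: a_def fluct_lin_def)
    then show ?thesis by (simp only: sum_distrib_left)
  qed
  have nb: "(\<Sum>i<n. (cmod (z i))^2) = n * b + n" using n by (simp add: b_def fluct_energy_def sum_subtractf)
  let ?Y = "chan_out n x h W"
  let ?m = "\<lambda>i. \<chi> k. x i * h $ k"
  have cY: "cinner (sgn h) (?Y i) = v i" if "i < n" for i
    using chan_out_cinner_sgn[OF h that] by (simp add: v_def r_def z_def)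
  have tm: "2 * (?m i \<bullet> ?Y i) - (norm (?m i))^2 - c * (cmod (v i))^2
      = (1 - c) * ((cmod (x i))^2 * G + r * (2 * Re (cnj (x i) * z i))) - c * (cmod (z i))^2" if "i < n" for i
  proof -
    have 1: "?m i \<bullet> ?Y i = r * Re (cnj (x i) * v i)"
      using cinner_eq_sgn[of h "?Y i"] cY[OF that] by (simp add: inner_eq_Re_cinner cinner_simps r_def mult.left_commute distrib_left)
    have "complex_of_real ((norm (?m i))^2) = cnj (x i) * (x i * complex_of_real G)"
      unfolding cinner_self[symmetric] cinner_simps by (simp add: cinner_self G_def r_def mult.left_commute)
    also have "\<dots> = complex_of_real ((cmod (x i))^2 * G)" using complex_norm_square[of "x i"] by (simp add: mult_ac)
    finally have 2: "(norm (?m i))^2 = (cmod (x i))^2 * G" by (simp only: of_real_eq_iff)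
    show ?thesis unfolding 1 2 cmod_power2 v_def G_def by (simp add: algebra_simps power2_eq_square)
  qed
  have S: "(\<Sum>i<n. 2 * (?m i \<bullet> ?Y i) - (norm (?m i))^2) - (\<Sum>i<n. c * (cmod (v i))^2)
      = (1 - c) * ((\<Sum>i<n. (cmod (x i))^2) * G + r * (n * a)) - c * (n * b + n)"
  proof -
    have "(\<Sum>i<n. 2 * (?m i \<bullet> ?Y i) - (norm (?m i))^2) - (\<Sum>i<n. c * (cmod (v i))^2)
       = (\<Sum>i<n. (1 - c) * ((cmod (x i))^2 * G + r * (2 * Re (cnj (x i) * z i))) - c * (cmod (z i))^2)"
      unfolding sum_subtractf[symmetric] by (intro sum.cong refl tm) simp
    also have "\<dots> = (1 - c) * ((\<Sum>i<n. (cmod (x i))^2) * G + r * (\<Sum>i<n. 2 * Re (cnj (x i) * z i))) - c * (\<Sum>i<n. (cmod (z i))^2)"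
      by (simp only: sum_subtractf sum.distrib sum_distrib_left[symmetric] sum_distrib_right[symmetric])
    finally show ?thesis unfolding na nb .
  qed
  \<comment> \<open>The codeword energy has a nonnegative coefficient, so codewords below full power
    only decrease the ratio.\<close>
  have "(1 - c) * ((\<Sum>i<n. (cmod (x i))^2) * G) \<le> (1 / \<theta>) * ((n * \<rho>) * G)"
    unfolding c1 using x \<theta> by (intro mult_left_mono mult_right_mono) (auto simp: G_def)
  also have "\<dots> = c * n" by (simp add: cG)
  finally have S2: "(\<Sum>i<n. 2 * (?m i \<bullet> ?Y i) - (norm (?m i))^2) - (\<Sum>i<n. c * (cmod (v i))^2)
      \<le> n * ((1 - c) * r * a - c * b)"
    unfolding S by (simp add: algebra_simps)
  have "(1 - c) * r * a - c * b \<le> 1 - \<theta> / \<theta>0"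
  proof -
    \<comment> \<open>Multiplying the event by \<open>\<rho> / \<theta>0\<close> undoes the
      normalization of the coefficients and exposes the ratio
      \<open>\<theta> / \<theta>0\<close>.\<close>
    have "G - g0 + (a * (\<theta>0 / \<rho> * (r / \<theta>)) + b * (- \<theta>0 * (G / \<theta>))) \<le> 0"
      using ev r by (simp add: conv_lin_def conv_energy_def a_def b_def z_def \<theta>0_def \<theta>_def G_def r_def)
    then have "(\<rho> / \<theta>0) * (G - g0 + (a * (\<theta>0 / \<rho> * (r / \<theta>)) + b * (- \<theta>0 * (G / \<theta>)))) \<le> 0"
      using \<rho> \<theta> by (intro mult_nonneg_nonpos) auto
    also have "(\<rho> / \<theta>0) * (G - g0 + (a * (\<theta>0 / \<rho> * (r / \<theta>)) + b * (- \<theta>0 * (G / \<theta>))))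
        = \<rho> * (G - g0) / \<theta>0 + (1 / \<theta>) * r * a - (\<rho> * G / \<theta>) * b"
      using \<rho> \<theta> by (simp add: field_simps)
    also have "\<rho> * (G - g0) / \<theta>0 = \<theta> / \<theta>0 - 1"
      using \<theta> by (simp add: field_simps) (simp add: \<theta>_def \<theta>0_def algebra_simps)
    finally show ?thesis unfolding c1 by (simp add: cG)
  qed
  \<comment> \<open>The tangent of the logarithm at 1 gives the inequality in the direction needed
    and is exact where the gain equals \<open>g0\<close>.\<close>
  also have "1 - \<theta> / \<theta>0 \<le> - ln (\<theta> / \<theta>0)"
    using ln_le_minus_one[of "\<theta> / \<theta>0"] \<theta> by simp
  also have "- ln (\<theta> / \<theta>0) = ln \<theta>0 - ln \<theta>" using \<theta> by (simp add: ln_div)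
  finally have "n * ((1 - c) * r * a - c * b) \<le> n * (ln \<theta>0 - ln \<theta>)" by (intro mult_left_mono) auto
  with S2 have S3: "(\<Sum>i<n. 2 * (?m i \<bullet> ?Y i) - (norm (?m i))^2) \<le> n * ln \<theta>0 + (n * (- ln \<theta>) + (\<Sum>i<n. c * (cmod (v i))^2))"
    by (simp add: right_diff_distrib)
  have "shift_dens n x h ?Y = exp (\<Sum>i<n. 2 * (?m i \<bullet> ?Y i) - (norm (?m i))^2)"
    by (simp add: shift_dens_def exp_sum)
  also have "\<dots> \<le> exp (n * ln \<theta>0 + (n * (- ln \<theta>) + (\<Sum>i<n. c * (cmod (v i))^2)))" using S3 by simp
  also have "\<dots> = \<theta>0 ^ n * ((1 / \<theta>) ^ n * exp (\<Sum>i<n. c * (cmod (v i))^2))"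
  proof -
    have "exp (n * ln \<theta>0) = \<theta>0 ^ n" "exp (n * (- ln \<theta>)) = (1 / \<theta>) ^ n"
      using \<theta> by (simp_all add: exp_of_nat_mult exp_minus inverse_eq_divide power_one_over)
    then show ?thesis by (simp only: exp_add)
  qed
  also have "(1 / \<theta>) ^ n * exp (\<Sum>i<n. c * (cmod (v i))^2) = out_dens \<rho> n h ?Y"
    unfolding out_dens_def c_def[symmetric] c1 by (simp only: prod.distrib prod_constant card_lessThan) (simp add: exp_sum cY)
  finally show ?thesis by (simp add: \<theta>0_def)
qed

lemma measurable_out_dens [measurable (raw)]:
  fixes p :: "'b \<Rightarrow> complex^'r::finite"
  assumes [measurable]: "p \<in> borel_measurable M" "g \<in> measurable M (out_space n)"
  shows "(\<lambda>w. out_dens \<rho> n (p w) (g w)) \<in> borel_measurable M"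
proof -
  note measurable_out_dest[OF assms(2), measurable]
  show ?thesis unfolding out_dens_def out_coeff_def sgn_div_norm by measurable
qed

context fading
begin

lemma AE_fst_nonzero: "AE p in chan n. fst p \<noteq> 0"
proof -
  let ?B = "noise n"
  interpret N: prob_space ?B by (rule prob_space_noise_blk)
  have "emeasure (H \<Otimes>\<^sub>M ?B) ({0} \<times> space ?B) = emeasure H {0} * emeasure ?B (space ?B)"
    by (rule N.emeasure_pair_measure_Times) auto
  also have "emeasure H {0} = 0" using gain_no_atom[of 0] by simp
  finally have "emeasure (H \<Otimes>\<^sub>M ?B) ({0} \<times> space ?B) = 0" by simp
  then show ?thesis
    by (intro AE_I[of _ _ "{0} \<times> space ?B"]) (auto simp: space_pair_measure)
qed

text \<open>Change of measure: for each message the event of correct decoding with a small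
  likelihood ratio has probability at least the left-hand side. Under the auxiliary output law,
  which does not depend on the message, the decoding regions are disjoint, so these probabilities
  add up to at most \<open>(1 + \<rho> * g0) ^ n\<close>.\<close>

lemma converse:
  assumes \<rho>: "\<rho> > 0" and g0: "g0 > 0" and n: "n > 0" and code: "rx_code H \<rho> n M \<epsilon> c g"
    and Q: "quadratic_at L g0" and K: "0 \<le> K" "lip_at K (conv_lin \<rho> g0) g0" "lip_at K (conv_energy \<rho> g0) g0"
  shows "gain_cdf g0 - fluct_const L K \<rho> / n - \<epsilon> \<le> (1 + \<rho> * g0) ^ n / M"
proof -
  interpret N: prob_space "noise n" by (rule prob_space_noise_blk)
  interpret PN: pair_prob_space H "noise n" by (rule pair_prob_space_noise)
  let ?N = "chan n"
  define \<gamma> where "\<gamma> = (1 + \<rho> * g0) ^ n"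
  have \<gamma>: "\<gamma> > 0" using \<rho> g0 by (simp add: \<gamma>_def add_pos_pos)
  from code have M: "M \<ge> 1" and pow: "\<And>j. j < M \<Longrightarrow> (\<Sum>i<n. (cmod (c j i))^2) \<le> real n * \<rho>"
    and g[measurable]: "g \<in> measurable (out_space n \<Otimes>\<^sub>M borel) (count_space UNIV)"
    and err: "\<And>j. j < M \<Longrightarrow> measure ?N {p \<in> space ?N. g (chan_out n (c j) (fst p) (snd p), fst p) \<noteq> j} \<le> \<epsilon>"
    by (auto simp: rx_code_def)
  define T where "T j h Y \<longleftrightarrow> shift_dens n (c j) h Y \<le> \<gamma> * out_dens \<rho> n h Y" for j and h :: "complex^'r" and Y
  have dens[measurable]: "(\<lambda>Y. shift_dens n (c j) h Y) \<in> borel_measurable (out_space n)"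
    "(\<lambda>Y. out_dens \<rho> n h Y) \<in> borel_measurable (out_space n)"
    "(\<lambda>Y. g (Y, h)) \<in> measurable (out_space n) (count_space UNIV)" for h :: "complex^'r" and j
    by (auto intro!: measurable_shift_dens measurable_out_dens measurable_compose[OF _ g])
  have predT[measurable]: "Measurable.pred (out_space n) (T j h)" for j h
    using borel_measurable_le[OF dens(1)[of j h] borel_measurable_times[OF borel_measurable_const dens(2)[of h], of \<gamma>]]
    by (simp add: pred_def T_def)
  have predg[measurable]: "Measurable.pred (out_space n) (\<lambda>Y. g (Y, h) = j)" for h j
    using measurable_sets[OF dens(3)[of h], of "{j}"] by (simp add: pred_def vimage_def Int_def conj_commute)
  define CT where "CT j = {p \<in> space ?N. T j (fst p) (chan_out n (c j) (fst p) (snd p)) \<and> g (chan_out n (c j) (fst p) (snd p), fst p) = j}" for j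
  define W where "W j = {p \<in> space ?N. g (chan_out n (c j) (fst p) (snd p), fst p) \<noteq> j}" for j
  have [measurable]: "(\<lambda>p. snd p) \<in> measurable ?N (out_space n)"
    using measurable_snd[of H "noise n"] by simp
  have [measurable]: "(\<lambda>p. fst p) \<in> borel_measurable ?N"
    using measurable_fst[of H "noise n"] by simp
  have CT[measurable]: "CT j \<in> sets ?N" and W[measurable]: "W j \<in> sets ?N" for j
    unfolding CT_def W_def T_def by measurable
  have Mpos: "real M > 0" using M by simp
  have each: "gain_cdf g0 - fluct_const L K \<rho> / n - \<epsilon> \<le> measure ?N (CT j)" if j: "j < M" for j
  proof -
    let ?E = "threshold_event n (c j) (conv_lin \<rho> g0) (conv_energy \<rho> g0) g0"
    note nz = AE_fst_nonzero[of n]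
    have sub: "AE p in ?N. p \<in> ?E \<longrightarrow> p \<in> W j \<union> CT j"
      using nz
    proof (rule AE_mp, intro AE_I2 impI)
      fix p assume "p \<in> space ?N" "fst p \<noteq> 0" "p \<in> ?E"
      then have "T j (fst p) (chan_out n (c j) (fst p) (snd p))"
        unfolding T_def \<gamma>_def threshold_event_def using \<rho> g0 n pow[OF j] by (intro shift_dens_chan_out_le) auto
      then show "p \<in> W j \<union> CT j" using \<open>p \<in> space ?N\<close> by (auto simp: W_def CT_def)
    qed
    have "gain_cdf g0 - fluct_const L K \<rho> / n \<le> measure ?N ?E"
      using prob_threshold[OF Q K n pow[OF j]] by (simp add: abs_le_iff)
    also have "\<dots> \<le> measure ?N (W j \<union> CT j)"
      by (rule PN.P.finite_measure_mono_AE[OF sub]) measurable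
    also have "\<dots> \<le> measure ?N (W j) + measure ?N (CT j)" by (rule measure_Un_le) auto
    also have "measure ?N (W j) \<le> \<epsilon>" using err[OF j] by (simp add: W_def)
    finally show ?thesis by simp
  qed
  let ?q = "\<lambda>h j Y. ennreal (\<gamma> * out_dens \<rho> n h Y) * indicator {Y. g (Y, h) = j} Y"
  let ?pr = "\<lambda>(h::complex^'r) Y. \<Prod>i<n. ennreal ((1 - out_coeff \<rho> h) * exp (out_coeff \<rho> h * (cmod (cinner (sgn h) (Y i)))^2))"
  have em: "emeasure ?N (CT j) \<le> (\<integral>\<^sup>+h. \<integral>\<^sup>+Y. ?q h j Y \<partial>noise n \<partial>H)" if j: "j < M" for j
  proof -
    have "emeasure ?N (CT j) = (\<integral>\<^sup>+p. indicator {Y. T j (fst p) Y \<and> g (Y, fst p) = j} (chan_out n (c j) (fst p) (snd p)) \<partial>?N)"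
      by (subst nn_integral_indicator[OF CT, symmetric], intro nn_integral_cong) (simp add: CT_def indicator_def)
    also have "\<dots> = (\<integral>\<^sup>+h. \<integral>\<^sup>+w. indicator {Y. T j h Y \<and> g (Y, h) = j} (chan_out n (c j) h w) \<partial>noise n \<partial>H)"
    proof -
      have "(\<lambda>p. indicator {Y. T j (fst p) Y \<and> g (Y, fst p) = j} (chan_out n (c j) (fst p) (snd p)) :: ennreal) \<in> borel_measurable ?N"
        unfolding T_def indicator_def mem_Collect_eq by measurable
      from N.nn_integral_fst[OF this, symmetric] show ?thesis by simp
    qed
    also have "\<dots> = (\<integral>\<^sup>+h. \<integral>\<^sup>+Y. ennreal (shift_dens n (c j) h Y) * indicator {Y. T j h Y \<and> g (Y, h) = j} Y \<partial>noise n \<partial>H)"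
    proof (rule nn_integral_cong, rule nn_integral_chan_out)
      fix h :: "complex^'r"
      have [measurable]: "Measurable.pred (out_space n) (\<lambda>Y. T j h Y \<and> g (Y, h) = j)"
        by (rule pred_intros_logic(3)[OF predT predg])
      show "(\<lambda>Y. indicator {Y. T j h Y \<and> g (Y, h) = j} Y :: ennreal) \<in> borel_measurable (out_space n)"
        unfolding indicator_def mem_Collect_eq by measurable
    qed
    \<comment> \<open>On \<open>T j\<close> the codeword-dependent density is replaced by a multiple
      of the common one; from here on the message enters only through its decoding region.\<close>
    also have "\<dots> \<le> (\<integral>\<^sup>+h. \<integral>\<^sup>+Y. ?q h j Y \<partial>noise n \<partial>H)"
      by (intro nn_integral_mono) (auto simp: indicator_def T_def intro: ennreal_leI)
    finally show ?thesis .
  qed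
  have meas: "(\<lambda>p. ennreal (\<gamma> * out_dens \<rho> n (fst p) (snd p)) * indicator {Y. g (Y, fst p) = j} (snd p)) \<in> borel_measurable ?N" for j
    unfolding indicator_def mem_Collect_eq by measurable
  have meas1: "(\<lambda>Y. ?q h j Y) \<in> borel_measurable (noise n)" for j h
  proof -
    have [measurable]: "(\<lambda>Y. out_dens \<rho> n h Y) \<in> borel_measurable (noise n)" "(\<lambda>Y. g (Y, h)) \<in> measurable (noise n) (count_space UNIV)"
      using dens by simp_all
    show ?thesis unfolding indicator_def mem_Collect_eq by measurable
  qed
  have "(\<Sum>j<M. emeasure ?N (CT j)) \<le> (\<Sum>j<M. \<integral>\<^sup>+h. \<integral>\<^sup>+Y. ?q h j Y \<partial>noise n \<partial>H)"
    by (intro sum_mono em) simp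
  also have "\<dots> = (\<integral>\<^sup>+h. (\<Sum>j<M. \<integral>\<^sup>+Y. ?q h j Y \<partial>noise n) \<partial>H)"
    using N.borel_measurable_nn_integral_fst[OF meas] by (intro nn_integral_sum[symmetric]) simp
  also have "\<dots> \<le> (\<integral>\<^sup>+h. ennreal \<gamma> \<partial>H)"
  proof (rule nn_integral_mono_AE, rule AE_mp[OF AE_nonzero], intro AE_I2 impI)
    fix h :: "complex^'r" assume "h \<noteq> 0"
    have "(\<Sum>j<M. \<integral>\<^sup>+Y. ?q h j Y \<partial>noise n)
       = (\<integral>\<^sup>+Y. (\<Sum>j<M. ?q h j Y) \<partial>noise n)"
      by (rule nn_integral_sum[symmetric]) (rule meas1)
    also have "\<dots> \<le> (\<integral>\<^sup>+Y. ennreal \<gamma> * ?pr h Y \<partial>noise n)"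
    proof (rule nn_integral_mono)
      fix Y :: "nat \<Rightarrow> complex^'r"
      \<comment> \<open>The decoder outputs a single message, so at most one indicator is 1.\<close>
      have "(\<Sum>j<M. indicator {Y. g (Y, h) = j} Y :: ennreal) \<le> 1"
      proof -
        have "(\<Sum>j<M. indicator {Y. g (Y, h) = j} Y :: ennreal) = (\<Sum>j\<in>{..<M}. if j = g (Y, h) then 1 else 0)"
          by (intro sum.cong) (auto simp: indicator_def)
        then show ?thesis by (simp add: sum.delta)
      qed
      then have "ennreal (\<gamma> * out_dens \<rho> n h Y) * (\<Sum>j<M. indicator {Y. g (Y, h) = j} Y) \<le> ennreal (\<gamma> * out_dens \<rho> n h Y) * 1"
        by (intro mult_left_mono) auto
      also have "\<dots> = ennreal \<gamma> * ?pr h Y"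
        using \<gamma> out_coeff(2)[OF \<rho>, of h] out_dens_nonneg[OF \<rho>, of n h Y]
        by (subst prod_ennreal) (auto simp: ennreal_mult out_dens_def)
      finally show "(\<Sum>j<M. ?q h j Y)
          \<le> ennreal \<gamma> * ?pr h Y"
        by (simp add: sum_distrib_left)
    qed
    also have "\<dots> = ennreal \<gamma> * (\<integral>\<^sup>+Y. ?pr h Y \<partial>noise n)"
    proof (rule nn_integral_cmult)
      have [measurable]: "(\<lambda>Y. Y i) \<in> borel_measurable (noise n)" if "i < n" for i
        by (rule measurable_out_dest[OF measurable_ident_sets[OF sets_noise_blk] that])
      show "(\<lambda>Y. ?pr h Y) \<in> borel_measurable (noise n)"
        by measurable
    qed
    also have "\<dots> = ennreal \<gamma>"
      using \<open>h \<noteq> 0\<close> out_coeff(2)[OF \<rho>, of h] by (subst nn_integral_output_dens) (simp_all add: norm_sgn)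
    finally show "(\<Sum>j<M. \<integral>\<^sup>+Y. ?q h j Y \<partial>noise n) \<le> ennreal \<gamma>" .
  qed
  also have "\<dots> = ennreal \<gamma>" by (simp add: H.emeasure_space_1[simplified])
  finally have "(\<Sum>j<M. emeasure ?N (CT j)) \<le> ennreal \<gamma>" .
  then have "(\<Sum>j<M. measure ?N (CT j)) \<le> \<gamma>"
    using \<gamma> by (simp add: PN.P.emeasure_eq_measure)
  moreover have "(\<Sum>j<M. gain_cdf g0 - fluct_const L K \<rho> / n - \<epsilon>) \<le> (\<Sum>j<M. measure ?N (CT j))"
    by (intro sum_mono each) simp
  ultimately have "M * (gain_cdf g0 - fluct_const L K \<rho> / n - \<epsilon>) \<le> \<gamma>" by simp
  then show ?thesis using Mpos by (simp add: \<gamma>_def field_simps)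
qed

end

subsection \<open>Achievability\<close>

text \<open>An angle ignores scaling, so a Gaussian sample can be normalized to the prescribed
  energy without affecting its confusion probabilities.\<close>

lemma blk_match_scale:
  assumes "c \<noteq> 0"
  shows "blk_match n s (\<lambda>i. c * x i) Y = blk_match n s x Y"
proof -
  have e: "energy n (\<lambda>i. c * x i) = (cmod c)^2 * energy n x"
    by (simp add: energy_def norm_mult power_mult_distrib sum_distrib_left)
  have *: "(1 - s) * ((cmod c)^2 * E) * V < (cmod (cnj c * w))^2 \<longleftrightarrow> (1 - s) * E * V < (cmod w)^2" for E V w
  proof -
    have "(1 - s) * ((cmod c)^2 * E) * V = (cmod c)^2 * ((1 - s) * E * V)" "(cmod (cnj c * w))^2 = (cmod c)^2 * (cmod w)^2"
      by (simp_all add: norm_mult power_mult_distrib)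
    then show ?thesis using assms by (simp add: mult_less_cancel_left mult.assoc)
  qed
  show ?thesis unfolding blk_match_def e cdot_simps * ..
qed

text \<open>It suffices to try the true direction \<open>sgn h\<close>. There a failed test says
  that the energy of the output outside the line of \<open>x\<close> is at least the fraction
  \<open>1 / (1 + \<rho> * g0)\<close> of the whole.\<close>

lemma not_blk_match_chan_out:
  fixes h :: "complex^'r::finite"
  assumes \<rho>: "\<rho> > 0" and g0: "g0 > 0" and n: "n > 0" and h: "h \<noteq> 0"
    and x: "energy n x = real n * \<rho>"
    and fail: "\<not> blk_match n (1 / (1 + \<rho> * g0)) x (chan_out n x h W)"
  shows "(norm h)^2 - g0 + (fluct_lin n x (rows_dir n (sgn h) W) * ach_lin \<rho> ((norm h)^2)
        + fluct_energy n (rows_dir n (sgn h) W) * (- g0)) \<le> 0"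
proof -
  define r where "r = norm h"
  define \<theta>0 where "\<theta>0 = 1 + \<rho> * g0"
  define E where "E = real n * \<rho>"
  define z where "z = rows_dir n (sgn h) W"
  define v where "v i = complex_of_real r * x i + z i" for i
  define a where "a = fluct_lin n x z"
  define b where "b = fluct_energy n z"
  define q where "q = cdot n x z"
  have r: "r > 0" using h by (simp add: r_def)
  have \<theta>0: "\<theta>0 > 1" using \<rho> g0 by (simp add: \<theta>0_def)
  have E: "E > 0" using n \<rho> by (simp add: E_def)
  have na: "2 * Re q = n * a" using n by (simp add: a_def fluct_lin_def q_def cdot_def)
  have nb: "energy n z = n * b + n" using n by (simp add: b_def fluct_energy_def sum_subtractf energy_def)
  have v: "cdot n y (\<lambda>i. cinner (sgn h) (chan_out n x h W i)) = cdot n y v" for y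
    by (rule cdot_cong) (simp_all add: chan_out_cinner_sgn[OF h] v_def r_def z_def mult.commute)
  have ev: "energy n (\<lambda>i. cinner (sgn h) (chan_out n x h W i)) = energy n v"
    unfolding energy_def by (intro sum.cong) (simp_all add: chan_out_cinner_sgn[OF h] v_def r_def z_def mult.commute)
  have xv: "cdot n x v = complex_of_real (r * E) + q"
    unfolding v_def by (simp add: cdot_simps cdot_self x q_def E_def)
  have xv2: "(cmod (cdot n x v))^2 = (r * E)^2 + 2 * (r * E) * Re q + (cmod q)^2"
    unfolding xv cmod_power2 by (simp add: power2_eq_square algebra_simps)
  have vv: "energy n v = r\<^sup>2 * E + 2 * r * Re q + energy n z"
  proof -
    have "(cmod (v i))^2 = r\<^sup>2 * (cmod (x i))^2 + 2 * r * Re (cnj (x i) * z i) + (cmod (z i))^2" for i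
      unfolding v_def cmod_power2 by (simp add: power2_eq_square algebra_simps)
    then have "energy n v = r\<^sup>2 * energy n x + 2 * r * (\<Sum>i<n. Re (cnj (x i) * z i)) + energy n z"
      unfolding energy_def by (simp only: sum.distrib sum_distrib_left)
    then show ?thesis by (simp add: x E_def q_def cdot_def)
  qed
  have "(cmod (cdot n x v))^2 \<le> (1 - 1 / \<theta>0) * E * energy n v"
    using fail unfolding blk_match_def by (auto simp: not_less x \<theta>0_def E_def v ev dest!: spec[of _ "sgn h"])
  \<comment> \<open>The residual orthogonal to \<open>x\<close> contains no signal: it is that of
    the noise alone. Dropping \<open>cmod q\<close> squared leaves a condition linear in the
    fluctuations.\<close>
  moreover have "E * energy n v - (cmod (cdot n x v))^2 = E * energy n z - (cmod q)^2"
    unfolding xv2 vv by (simp add: power2_eq_square algebra_simps)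
  ultimately have *: "(cmod (cdot n x v))^2 \<le> (1 - 1 / \<theta>0) * E * energy n v"
    "E * energy n v - (cmod (cdot n x v))^2 = E * energy n z - (cmod q)^2" .
  have "E * energy n z \<ge> E * ((1 / \<theta>0) * energy n v)"
  proof -
    have "(1 - 1 / \<theta>0) * E * energy n v = E * energy n v - E * ((1 / \<theta>0) * energy n v)"
      by (simp add: left_diff_distrib)
    with * show ?thesis using zero_le_power2[of "cmod q"] by linarith
  qed
  then have "(1 / \<theta>0) * energy n v \<le> energy n z" using E by (rule mult_left_le_imp_le)
  then have "energy n v \<le> \<theta>0 * energy n z" using \<theta>0 by (simp add: field_simps)
  then have "real n * (r\<^sup>2 * \<rho> + r * a + b + 1) \<le> real n * (\<theta>0 * (b + 1))"
    unfolding vv using na nb by (simp add: E_def algebra_simps)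
  then have "r\<^sup>2 * \<rho> + r * a + b + 1 \<le> \<theta>0 * (b + 1)" by (rule mult_left_le_imp_le) (use n in simp)
  then have "(1 / \<rho>) * (\<rho> * (r\<^sup>2 - g0) + r * a - \<rho> * g0 * b) \<le> 0"
    using \<rho> by (intro mult_nonneg_nonpos) (auto simp: \<theta>0_def algebra_simps)
  also have "(1 / \<rho>) * (\<rho> * (r\<^sup>2 - g0) + r * a - \<rho> * g0 * b) = r\<^sup>2 - g0 + (a * ach_lin \<rho> (r\<^sup>2) + b * (- g0))"
    using \<rho> r by (simp add: ach_lin_def field_simps)
  finally show ?thesis by (simp add: a_def b_def z_def r_def)
qed

text \<open>Ties go to the largest index, so an error on message j requires that j itself fails or
  some later index matches; earlier codewords never matter. Without any match the output is
  0.\<close>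

fun last_match :: "nat \<Rightarrow> real \<Rightarrow> (nat \<Rightarrow> nat \<Rightarrow> complex) \<Rightarrow> nat \<Rightarrow> (nat \<Rightarrow> complex^'r::finite) \<Rightarrow> nat" where
  "last_match n s c 0 Y = 0"
| "last_match n s c (Suc m) Y = (if blk_match n s (c m) Y then m else last_match n s c m Y)"

lemma last_match_eq:
  "j < m \<Longrightarrow> blk_match n s (c j) Y \<Longrightarrow> (\<And>i. j < i \<Longrightarrow> i < m \<Longrightarrow> \<not> blk_match n s (c i) Y) \<Longrightarrow> last_match n s c m Y = j"
proof (induction m)
  case (Suc m)
  then show ?case by (cases "j = m") auto
qed simp

lemma pred_blk_match_out:
  "Measurable.pred (out_space n) (\<lambda>Y::nat \<Rightarrow> complex^'r::finite. blk_match n s x Y)"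
  by (rule measurable_blk_match) simp_all

lemma measurable_last_match:
  "last_match n s c m \<in> measurable (out_space n :: (nat \<Rightarrow> complex^'r::finite) measure) (count_space UNIV)"
proof (induction m)
  case (Suc m)
  note Suc[measurable] pred_blk_match_out[measurable]
  have "(\<lambda>Y. if blk_match n s (c m) Y then m else last_match n s c m Y) \<in> measurable (out_space n :: (nat \<Rightarrow> complex^'r) measure) (count_space UNIV)"
    by measurable
  then show ?case by simp
qed simp

text \<open>Used to rescale a sampled codeword to full power.\<close>

lemma AE_cn_energy_pos:
  assumes "n > 0"
  shows "AE x in cn_blk n. energy n x > 0"
proof -
  have g: "emeasure gauss1 {0} = 0"
    unfolding gauss1_def by (subst emeasure_density) (auto simp: nn_integral_indicator_singleton)
  have "emeasure cn1 {0} = (\<integral>\<^sup>+z. indicator {0} (Re z) * indicator {0} (Im z) \<partial>cn1)"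
  proof -
    have "emeasure cn1 {0} = (\<integral>\<^sup>+z. indicator {0} z \<partial>cn1)"
      by (rule nn_integral_indicator[symmetric]) simp
    then show ?thesis by (simp add: indicator_def complex_eq_iff of_bool_conj)
  qed
  also have "\<dots> = 0" by (subst nn_integral_cn1_prod) (auto simp: g)
  finally have "AE z in cn1. z \<noteq> 0" by (intro AE_I[of _ _ "{0}"]) auto
  then have "AE x in cn_blk n. x 0 \<noteq> 0"
    using assms by (intro AE_PiM_component prob_space_cn1) auto
  then show ?thesis
  proof (rule AE_mp, intro AE_I2 impI)
    fix x :: "nat \<Rightarrow> complex" assume "x 0 \<noteq> 0"
    then have "energy n x \<noteq> 0" using assms by (auto simp: energy_eq_0_iff)
    then show "energy n x > 0" using energy_nonneg[of n x] by linarith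
  qed
qed

text \<open>If more than M of the 2M row sums exceeded \<open>4 * real M * p\<close>, their total
  would exceed \<open>4 * real M ^ 2 * p\<close>. Keeping good rows passes from average to maximal
  error.\<close>

lemma expurgate:
  fixes A :: "nat \<Rightarrow> nat \<Rightarrow> real"
  assumes A: "\<And>i j. 0 \<le> A j i" and M: "M \<ge> 1" and p: "p > 0"
    and tot: "(\<Sum>i<2 * M. \<Sum>j<i. A j i) \<le> 4 * real M ^ 2 * p"
  shows "\<exists>e. (\<forall>j<M. e j < 2 * M) \<and> (\<forall>j<M. (\<Sum>i\<in>{j<..<M}. A (e j) (e i)) \<le> 4 * real M * p)"
proof -
  define B where "B j = (\<Sum>i\<in>{j<..<2 * M}. A j i)" for j
  define J where "J = {j. j < 2 * M \<and> B j \<le> 4 * real M * p}"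
  have fin: "finite J" by (simp add: J_def)
  have totB: "(\<Sum>j<2 * M. B j) \<le> 4 * real M ^ 2 * p"
  proof -
    have "(\<Sum>j<2 * M. B j) = (\<Sum>i<2 * M. \<Sum>j<i. A j i)"
      using sum.swap_restrict[of "{..<2 * M}" "{..<2 * M}" A "(<)"]
      by (simp add: B_def greaterThanLessThan_def greaterThan_def lessThan_def Int_def conj_commute cong: conj_cong)
    then show ?thesis using tot by simp
  qed
  have "card J \<ge> M"
  proof (rule ccontr)
    assume "\<not> card J \<ge> M"
    then have c: "card ({..<2 * M} - J) \<ge> M + 1"
    proof -
      have "J \<subseteq> {..<2 * M}" by (auto simp: J_def)
      from card_Diff_subset[OF fin this] \<open>\<not> card J \<ge> M\<close> show ?thesis by simp
    qed
    have "real (M + 1) * (4 * real M * p) \<le> real (card ({..<2 * M} - J)) * (4 * real M * p)"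
      using c p by (intro mult_right_mono) auto
    also have "\<dots> = (\<Sum>j\<in>{..<2 * M} - J. 4 * real M * p)" by simp
    also have "\<dots> \<le> (\<Sum>j\<in>{..<2 * M} - J. B j)" by (intro sum_mono) (auto simp: J_def)
    also have "\<dots> \<le> (\<Sum>j<2 * M. B j)"
      by (intro sum_mono2) (auto simp: B_def intro!: sum_nonneg A)
    also note totB
    finally have "4 * real M * p \<le> 0" by (simp add: power2_eq_square algebra_simps)
    then show False using M p by (simp add: mult_le_0_iff)
  qed
  \<comment> \<open>The kept indices are listed increasingly: a pair j < i stays ordered, so the new
    sums are part of the old ones. \<open>A\<close> need not be symmetric.\<close>
  obtain l where l: "sorted_wrt (<) l" "set l = J" "length l = card J"
    using finite_set_strict_sorted[OF fin] by blast
  define e where "e j = l ! j" for j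
  have eJ: "e j \<in> J" if "j < M" for j
    using that \<open>card J \<ge> M\<close> l nth_mem[of j l] by (simp add: e_def)
  have mono: "e i < e j" if "i < j" "j < M" for i j
    using that \<open>card J \<ge> M\<close> l sorted_wrt_nth_less[of "(<)" l i j] by (simp add: e_def)
  have "(\<Sum>i\<in>{j<..<M}. A (e j) (e i)) \<le> 4 * real M * p" if j: "j < M" for j
  proof -
    have inj: "inj_on e {j<..<M}" using mono by (intro inj_onI) (metis greaterThanLessThan_iff less_irrefl linorder_neqE_nat)
    have "(\<Sum>i\<in>{j<..<M}. A (e j) (e i)) = (\<Sum>k\<in>e ` {j<..<M}. A (e j) k)"
      by (simp add: sum.reindex[OF inj])
    also have "\<dots> \<le> B (e j)"
      unfolding B_def using mono eJ j by (intro sum_mono2) (auto simp: J_def A)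
    also have "\<dots> \<le> 4 * real M * p" using eJ[OF j] by (simp add: J_def)
    finally show ?thesis .
  qed
  then show ?thesis using eJ by (intro exI[of _ e]) (auto simp: J_def)
qed

section \<open>Choosing the codebook\<close>

context fading
begin

definition confusion :: "nat \<Rightarrow> real \<Rightarrow> (nat \<Rightarrow> complex) \<Rightarrow> (nat \<Rightarrow> complex) \<Rightarrow> real" where
  "confusion n s x x' = measure (chan n) {p \<in> space (chan n). blk_match n s x' (chan_out n x (fst p) (snd p))}"

lemma measurable_chan_out_pair:
  "(\<lambda>p. chan_out n x (fst p) (snd p)) \<in> measurable (chan n) (out_space n)"
  by (rule measurable_chan_out) simp_all

lemma sets_blk_match_chan:
  "{p \<in> space (chan n). blk_match n s x' (chan_out n x (fst p) (snd p))} \<in> sets (chan n)"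
  using measurable_compose[OF measurable_chan_out_pair pred_blk_match_out] by (simp add: pred_def)

text \<open>The Gaussian competitor is independent of the output, so after Fubini
  \<open>emeasure_blk_match_le\<close> applies to each fixed output.\<close>

lemma confusion_random:
  assumes s: "0 < s" "s < 1" and n: "CARD('r) < n"
  shows "confusion n s x \<in> borel_measurable (cn_blk n)"
    "integrable (cn_blk n) (confusion n s x)"
    "integral\<^sup>L (cn_blk n) (confusion n s x) \<le> 3 * real n ^ CARD('r) * s ^ (n - CARD('r))"
proof -
  let ?N = "chan n"
  interpret N: prob_space ?N by (rule prob_space_chan)
  interpret C: prob_space "cn_blk n" by (rule prob_space_cn_blk)
  interpret P: pair_sigma_finite "cn_blk n" ?N ..
  define F where "F y p = (if blk_match n s y (chan_out n x (fst p) (snd p)) then 1 else 0 :: ennreal)" for y and p :: "(complex^'r) \<times> (nat \<Rightarrow> complex^'r)"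
  have "Measurable.pred (cn_blk n \<Otimes>\<^sub>M ?N) (\<lambda>w. blk_match n s (fst w) (chan_out n x (fst (snd w)) (snd (snd w))))"
  proof (rule measurable_blk_match)
    show "(\<lambda>w. fst w i) \<in> borel_measurable (cn_blk n \<Otimes>\<^sub>M ?N)" if "i < n" for i
      by (rule measurable_compose[OF measurable_fst measurable_blk_component[OF that]])
    show "(\<lambda>w. chan_out n x (fst (snd w)) (snd (snd w))) \<in> measurable (cn_blk n \<Otimes>\<^sub>M ?N) (out_space n)"
      by (rule measurable_compose[OF measurable_snd measurable_chan_out_pair])
  qed
  then have F: "(\<lambda>(y, p). F y p) \<in> borel_measurable (cn_blk n \<Otimes>\<^sub>M ?N)"
    unfolding F_def split_beta by measurable
  have inner: "(\<integral>\<^sup>+p. F y p \<partial>?N) = ennreal (confusion n s x y)" for y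
  proof -
    have "(\<integral>\<^sup>+p. F y p \<partial>?N) = (\<integral>\<^sup>+p. indicator {p \<in> space ?N. blk_match n s y (chan_out n x (fst p) (snd p))} p \<partial>?N)"
      by (intro nn_integral_cong) (simp add: F_def indicator_def)
    then show ?thesis by (simp add: sets_blk_match_chan confusion_def N.emeasure_eq_measure)
  qed
  have "(\<lambda>y. \<integral>\<^sup>+p. F y p \<partial>?N) \<in> borel_measurable (cn_blk n)"
    using N.borel_measurable_nn_integral_fst[OF F] by simp
  then have "(\<lambda>y. enn2real (ennreal (confusion n s x y))) \<in> borel_measurable (cn_blk n)"
    unfolding inner by measurable
  then show m: "confusion n s x \<in> borel_measurable (cn_blk n)" by (simp add: confusion_def[abs_def])
  show int: "integrable (cn_blk n) (confusion n s x)"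
    by (rule C.integrable_const_bound[of _ 1]) (auto simp: m confusion_def)
  let ?p = "3 * real n ^ CARD('r) * s ^ (n - CARD('r))"
  have "ennreal (integral\<^sup>L (cn_blk n) (confusion n s x)) = (\<integral>\<^sup>+y. ennreal (confusion n s x y) \<partial>cn_blk n)"
    by (intro nn_integral_eq_integral[symmetric] int) (simp add: confusion_def)
  also have "\<dots> = (\<integral>\<^sup>+y. \<integral>\<^sup>+p. F y p \<partial>?N \<partial>cn_blk n)" by (simp add: inner)
  also have "\<dots> = (\<integral>\<^sup>+p. \<integral>\<^sup>+y. F y p \<partial>cn_blk n \<partial>?N)" by (rule P.Fubini'[OF F, symmetric])
  also have "\<dots> \<le> (\<integral>\<^sup>+p. ennreal ?p \<partial>?N)"
  proof (rule nn_integral_mono)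
    fix p :: "(complex^'r) \<times> (nat \<Rightarrow> complex^'r)" assume p: "p \<in> space ?N"
    define Y where "Y = chan_out n x (fst p) (snd p)"
    have Y: "Y \<in> space (out_space n)" using measurable_space[OF measurable_chan_out_pair p] by (simp add: Y_def)
    have "Measurable.pred (cn_blk n) (\<lambda>y. blk_match n s y Y)"
      using Y by (intro measurable_blk_match measurable_const measurable_blk_component)
    then have S: "{y \<in> space (cn_blk n). blk_match n s y Y} \<in> sets (cn_blk n)" by (simp add: pred_def)
    have "(\<integral>\<^sup>+y. F y p \<partial>cn_blk n) = (\<integral>\<^sup>+y. indicator {y \<in> space (cn_blk n). blk_match n s y Y} y \<partial>cn_blk n)"
      by (intro nn_integral_cong) (simp add: F_def indicator_def Y_def)
    also have "\<dots> = emeasure (cn_blk n) {y \<in> space (cn_blk n). blk_match n s y Y}" using S by simp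
    also have "\<dots> \<le> ennreal ?p" by (rule emeasure_blk_match_le[OF s n])
    finally show "(\<integral>\<^sup>+y. F y p \<partial>cn_blk n) \<le> ennreal ?p" .
  qed
  also have "\<dots> = ennreal ?p" by (simp add: N.emeasure_space_1)
  finally show "integral\<^sup>L (cn_blk n) (confusion n s x) \<le> ?p" using s by (simp add: ennreal_le_iff)
qed

text \<open>Random coding one codeword at a time: each new codeword is a sample whose total
  confusion with its predecessors is at most the mean, so the increments \<open>m * p\<close> sum to
  at most \<open>m\<^sup>2 * p\<close>.\<close>

lemma ex_codebook:
  assumes s: "0 < s" "s < 1" and n: "CARD('r) < n" and \<rho>: "\<rho> > 0"
    and p: "p = 3 * real n ^ CARD('r) * s ^ (n - CARD('r))"
  shows "\<exists>c. (\<forall>j<m. energy n (c j) = real n * \<rho>) \<and> (\<Sum>i<m. \<Sum>j<i. confusion n s (c j) (c i)) \<le> real m ^ 2 * p"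
proof (induction m)
  case 0
  then show ?case by simp
next
  case (Suc m)
  then obtain c where c: "\<And>j. j < m \<Longrightarrow> energy n (c j) = real n * \<rho>"
    "(\<Sum>i<m. \<Sum>j<i. confusion n s (c j) (c i)) \<le> real m ^ 2 * p" by auto
  interpret C: prob_space "cn_blk n" by (rule prob_space_cn_blk)
  have n0: "n > 0" using n by simp
  have p0: "p \<ge> 0" using s by (simp add: p)
  note cr = confusion_random[OF s n]
  define \<phi> where "\<phi> y = (\<Sum>j<m. confusion n s (c j) y)" for y
  have int: "integrable (cn_blk n) \<phi>" unfolding \<phi>_def using cr(2) by auto
  have "integral\<^sup>L (cn_blk n) \<phi> = (\<Sum>j<m. integral\<^sup>L (cn_blk n) (confusion n s (c j)))"
    unfolding \<phi>_def using cr(2) by simp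
  also have "\<dots> \<le> (\<Sum>j<m. p)" unfolding p by (intro sum_mono cr(3))
  finally have le: "integral\<^sup>L (cn_blk n) \<phi> \<le> m * p" by simp
  \<comment> \<open>A sample not exceeding the mean must also be nonzero to be rescaled; otherwise
    the mean would be exceeded almost everywhere.\<close>
  have "\<exists>y. energy n y > 0 \<and> \<phi> y \<le> m * p"
  proof (rule ccontr)
    assume "\<not> ?thesis"
    then have *: "energy n y > 0 \<Longrightarrow> m * p < \<phi> y" for y by force
    have "AE y in cn_blk n. m * p < \<phi> y"
      by (rule AE_mp[OF AE_cn_energy_pos[OF n0]]) (auto intro: *)
    then have "integral\<^sup>L (cn_blk n) (\<lambda>_. m * p) < integral\<^sup>L (cn_blk n) \<phi>"
      using int by (intro C.integral_less_AE_space) (auto simp: C.emeasure_space_1)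
    then show False using le by (simp add: C.prob_space)
  qed
  then obtain y where y: "energy n y > 0" "\<phi> y \<le> m * p" by blast
  define k where "k = sqrt (real n * \<rho> / energy n y)"
  have k: "k > 0" using y n0 \<rho> by (simp add: k_def)
  define x where "x i = complex_of_real k * y i" for i
  have ex: "energy n x = real n * \<rho>"
  proof -
    have "energy n x = k\<^sup>2 * energy n y"
      using k by (simp add: energy_def x_def norm_mult power_mult_distrib sum_distrib_left)
    also have "k\<^sup>2 = real n * \<rho> / energy n y" using y \<rho> by (simp add: k_def)
    finally show ?thesis using y by simp
  qed
  have conf: "confusion n s w x = confusion n s w y" for w
    unfolding confusion_def x_def using k by (simp add: blk_match_scale)
  have "(\<Sum>i<Suc m. \<Sum>j<i. confusion n s ((c(m := x)) j) ((c(m := x)) i)) = (\<Sum>i<m. \<Sum>j<i. confusion n s (c j) (c i)) + \<phi> y"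
    by (simp add: \<phi>_def conf)
  also have "\<dots> \<le> real m ^ 2 * p + m * p" using c(2) y(2) by simp
  also have "\<dots> \<le> real (Suc m) ^ 2 * p" using p0 by (simp add: power2_eq_square algebra_simps)
  finally show ?case using c(1) ex by (intro exI[of _ "c(m := x)"]) (auto simp: less_Suc_eq)
qed

text \<open>The threshold event accounts for the sent codeword failing its test, the expurgated sum
  for a later one passing. The factor 12 is 4 from expurgation times 3 from the confusion
  bound.\<close>

lemma achievability:
  assumes \<rho>: "\<rho> > 0" and g0: "g0 > 0" and n: "CARD('r) < n" and M: "M \<ge> 1"
    and Q: "quadratic_at L g0" and K: "0 \<le> K" "lip_at K (ach_lin \<rho>) g0" "lip_at K (\<lambda>_. - g0) g0"
    and \<epsilon>: "gain_cdf g0 + fluct_const L K \<rho> / n + 12 * real M * real n ^ CARD('r) / (1 + \<rho> * g0) ^ (n - CARD('r)) \<le> \<epsilon>"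
  shows "\<exists>c g. no_code H \<rho> n M \<epsilon> c g"
proof -
  let ?N = "chan n"
  interpret N: prob_space ?N by (rule prob_space_chan)
  define s where "s = 1 / (1 + \<rho> * g0)"
  have s: "0 < s" "s < 1" using \<rho> g0 by (simp_all add: s_def add_pos_pos)
  define p where "p = 3 * real n ^ CARD('r) * s ^ (n - CARD('r))"
  have n0: "n > 0" using n by simp
  have p0: "p > 0" using s n0 by (simp add: p_def)
  obtain c where c: "\<And>j. j < 2 * M \<Longrightarrow> energy n (c j) = real n * \<rho>"
    "(\<Sum>i<2 * M. \<Sum>j<i. confusion n s (c j) (c i)) \<le> real (2 * M) ^ 2 * p"
    using ex_codebook[OF s n \<rho> p_def, of "2 * M"] by auto
  obtain e where e: "\<And>j. j < M \<Longrightarrow> e j < 2 * M"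
    "\<And>j. j < M \<Longrightarrow> (\<Sum>i\<in>{j<..<M}. confusion n s (c (e j)) (c (e i))) \<le> 4 * real M * p"
    using expurgate[of "\<lambda>j i. confusion n s (c j) (c i)" M p] c(2) M p0 by (auto simp: confusion_def power_mult_distrib)
  define d where "d j = c (e j)" for j
  have d: "energy n (d j) = real n * \<rho>" if "j < M" for j using c(1) e(1) that by (simp add: d_def)
  have "no_code H \<rho> n M \<epsilon> d (last_match n s d M)"
    unfolding no_code_def
  proof (intro conjI allI impI)
    show "1 \<le> M" by (rule M)
    show "last_match n s d M \<in> measurable (out_space n) (count_space UNIV)" by (rule measurable_last_match)
    fix j assume j: "j < M"
    show "(\<Sum>i<n. (cmod (d j i))^2) \<le> real n * \<rho>" using d[OF j] by (simp add: energy_def)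
    let ?E = "threshold_event n (d j) (ach_lin \<rho>) ((\<lambda>_. - g0)) g0"
    define D where "D i = {p \<in> space ?N. blk_match n s (d i) (chan_out n (d j) (fst p) (snd p))}" for i
    have Dm: "D i \<in> sets ?N" for i unfolding D_def by (rule sets_blk_match_chan)
    have [measurable]: "(\<lambda>p. snd p) \<in> measurable ?N (out_space n)" "(\<lambda>p. fst p) \<in> borel_measurable ?N"
      using measurable_snd[of H "noise n"] measurable_fst[of H "noise n"] by simp_all
    have Em: "?E \<in> sets ?N" unfolding threshold_event_def ach_lin_def by measurable
    show "measure ?N {p \<in> space ?N. last_match n s d M (chan_out n (d j) (fst p) (snd p)) \<noteq> j} \<le> \<epsilon>" (is "measure ?N ?err \<le> \<epsilon>")
    proof -
      have sub: "?err \<subseteq> (space ?N - D j) \<union> (\<Union>i\<in>{j<..<M}. D i)"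
      proof (intro subsetI, rule ccontr)
        fix p assume p: "p \<in> ?err" "p \<notin> (space ?N - D j) \<union> (\<Union>i\<in>{j<..<M}. D i)"
        define Y where "Y = chan_out n (d j) (fst p) (snd p)"
        have "blk_match n s (d j) Y" using p by (simp add: D_def Y_def)
        moreover have "\<not> blk_match n s (d i) Y" if "j < i" "i < M" for i
          using p that by (simp add: D_def Y_def)
        ultimately have "last_match n s d M Y = j" by (rule last_match_eq[OF j])
        then show False using p(1) by (simp add: Y_def)
      qed
      have nD: "AE p in ?N. p \<in> space ?N - D j \<longrightarrow> p \<in> ?E"
        using AE_fst_nonzero
      proof (rule AE_mp, intro AE_I2 impI)
        fix p assume "p \<in> space ?N" "fst p \<noteq> 0" "p \<in> space ?N - D j"
        then show "p \<in> ?E" unfolding threshold_event_def D_def s_def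
          using not_blk_match_chan_out[OF \<rho> g0 n0 _ d[OF j]] by auto
      qed
      have "measure ?N ?err \<le> measure ?N ((space ?N - D j) \<union> (\<Union>i\<in>{j<..<M}. D i))"
        using Dm by (intro N.finite_measure_mono sub) auto
      also have "\<dots> \<le> measure ?N (space ?N - D j) + measure ?N (\<Union>i\<in>{j<..<M}. D i)"
        using Dm by (intro measure_Un_le) auto
      also have "measure ?N (space ?N - D j) \<le> measure ?N ?E"
        by (rule N.finite_measure_mono_AE[OF nD Em])
      also have "measure ?N ?E \<le> gain_cdf g0 + fluct_const L K \<rho> / n"
        using prob_threshold[OF Q K n0, of "d j" \<rho>] d[OF j] unfolding energy_def by (simp add: abs_le_iff)
      also have "measure ?N (\<Union>i\<in>{j<..<M}. D i) \<le> (\<Sum>i\<in>{j<..<M}. measure ?N (D i))"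
        using Dm by (intro measure_UNION_le) auto
      also have "\<dots> \<le> 4 * real M * p" using e(2)[OF j] by (simp add: D_def confusion_def d_def)
      also have "4 * real M * p = 12 * real M * real n ^ CARD('r) / (1 + \<rho> * g0) ^ (n - CARD('r))"
        by (simp add: p_def s_def power_divide)
      finally show ?thesis using \<epsilon> by simp
    qed
  qed
  then show ?thesis by blast
qed

end

subsection \<open>Asymptotics\<close>

context fading
begin

text \<open>The strict inequality in the outage event becomes a non-strict one because the gain has
  no atoms.\<close>

lemma outage_F_eq:
  assumes \<rho>: "\<rho> > 0"
  shows "outage_F H \<rho> R = gain_cdf ((exp R - 1) / \<rho>)"
proof -
  let ?y = "(exp R - 1) / \<rho>"
  have e: "ln (1 + (norm h)^2 * \<rho>) < R \<longleftrightarrow> (norm h)^2 < ?y" for h :: "complex^'r"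
  proof -
    have "1 + (norm h)^2 * \<rho> > 0" using \<rho> by (simp add: add_pos_nonneg)
    then have "ln (1 + (norm h)^2 * \<rho>) < R \<longleftrightarrow> 1 + (norm h)^2 * \<rho> < exp R"
      by (metis exp_less_cancel_iff exp_ln)
    then show ?thesis using \<rho> by (auto simp: field_simps)
  qed
  have "AE h in H. (norm h)^2 \<noteq> ?y"
    using gain_no_atom[of ?y] by (intro AE_I[of _ _ "{h. (norm h)^2 = ?y}"]) (simp_all add: subset_iff)
  then have "measure H {h. (norm h)^2 < ?y} = measure H {h. (norm h)^2 \<le> ?y}"
    by (intro H.finite_measure_eq_AE) auto
  then show ?thesis by (simp add: outage_F_def e gain_cdf_def)
qed

lemma outage_F_mono:
  assumes "\<rho> > 0" "R \<le> R'"
  shows "outage_F H \<rho> R \<le> outage_F H \<rho> R'"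
  unfolding outage_F_eq[OF assms(1)] gain_cdf_def
proof (rule H.finite_measure_mono)
  have "(exp R - 1) / \<rho> \<le> (exp R' - 1) / \<rho>" using assms by (intro divide_right_mono) auto
  then show "{h. (norm h)^2 \<le> (exp R - 1) / \<rho>} \<subseteq> {h::complex^'r. (norm h)^2 \<le> (exp R' - 1) / \<rho>}" by auto
qed measurable

lemma outage_F_nonpos:
  assumes "\<rho> > 0" "R \<le> 0"
  shows "outage_F H \<rho> R = 0"
proof -
  have "0 \<le> ln (1 + (norm h)^2 * \<rho>)" for h :: "complex^'r" using assms by simp
  then have "{h \<in> space H. ln (1 + (norm h)^2 * \<rho>) < R} = {}" using assms by (auto simp: not_less intro: order_trans)
  then show ?thesis unfolding outage_F_def by (simp only: measure_empty)
qed

lemma ex_outage_F_gt: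
  assumes \<rho>: "\<rho> > 0" and \<epsilon>: "\<epsilon> < 1"
  shows "\<exists>R. outage_F H \<rho> R > \<epsilon>"
proof -
  let ?A = "\<lambda>k::nat. {h::complex^'r. (norm h)^2 \<le> real k}"
  have "(\<lambda>k. measure H (?A k)) \<longlonglongrightarrow> measure H (\<Union>k. ?A k)"
    by (intro H.finite_Lim_measure_incseq) (auto simp: incseq_def intro: order_trans)
  also have "(\<Union>k. ?A k) = space H" by (auto intro: real_arch_simple)
  finally have "(\<lambda>k. gain_cdf (real k)) \<longlonglongrightarrow> 1" by (simp add: gain_cdf_def H.prob_space[simplified])
  then have "\<forall>\<^sub>F k in sequentially. gain_cdf (real k) > \<epsilon>" by (rule order_tendstoD) (rule \<epsilon>)
  then obtain k where k: "gain_cdf (real k) > \<epsilon>" by (auto simp: eventually_sequentially)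
  have "(exp (ln (1 + real k * \<rho>)) - 1) / \<rho> = real k" using \<rho> by (simp add: add_pos_nonneg)
  then have "outage_F H \<rho> (ln (1 + real k * \<rho>)) > \<epsilon>" using k by (simp add: outage_F_eq[OF \<rho>])
  then show ?thesis ..
qed

text \<open>By monotonicity the outage probability is at most \<open>\<epsilon>\<close> to the left
  of the supremum and at least \<open>\<epsilon>\<close> to its right; continuity closes the gap.
  Positivity holds since nonpositive rates have no outage.\<close>

lemma C_eps_props:
  assumes \<rho>: "\<rho> > 0" and \<epsilon>: "0 < \<epsilon>" "\<epsilon> < 1" and cont: "isCont (outage_F H \<rho>) (C_eps H \<rho> \<epsilon>)"
  shows "outage_F H \<rho> (C_eps H \<rho> \<epsilon>) = \<epsilon>" "C_eps H \<rho> \<epsilon> > 0"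
proof -
  let ?F = "outage_F H \<rho>" and ?S = "{R. outage_F H \<rho> R \<le> \<epsilon>}"
  define C where "C = C_eps H \<rho> \<epsilon>"
  obtain R0 where R0: "?F R0 > \<epsilon>" using ex_outage_F_gt[OF \<rho> \<epsilon>(2)] by blast
  have ub: "R \<le> R0" if "R \<in> ?S" for R
    using that R0 outage_F_mono[OF \<rho>, of R0 R] by force
  have "0 \<in> ?S" using outage_F_nonpos[OF \<rho> order_refl] \<epsilon> by simp
  then have ne: "?S \<noteq> {}" by blast
  have bdd: "bdd_above ?S" using ub by (intro bdd_aboveI) auto
  have CS: "C = Sup ?S" by (simp add: C_def C_eps_def)
  have below: "?F R \<le> \<epsilon>" if "R < C" for R
  proof -
    have "R < Sup ?S" using that by (simp only: CS)
    from less_cSupD[OF ne this] obtain R' where "R' \<in> ?S" "R < R'" by blast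
    then show ?thesis using outage_F_mono[OF \<rho>, of R R'] by auto
  qed
  have above: "?F R \<ge> \<epsilon>" if "R > C" for R
  proof (rule ccontr)
    assume "\<not> ?F R \<ge> \<epsilon>"
    then have "R \<in> ?S" by simp
    then have "R \<le> C" using cSup_upper[OF _ bdd] by (simp add: CS)
    then show False using that by simp
  qed
  have lim: "(?F \<longlongrightarrow> ?F C) (at C)" using cont by (simp add: C_def isCont_def)
  have "?F C \<le> \<epsilon>"
  proof (rule tendsto_upperbound)
    show "(?F \<longlongrightarrow> ?F C) (at_left C)" by (rule tendsto_mono[OF at_le lim]) simp
    show "\<forall>\<^sub>F R in at_left C. ?F R \<le> \<epsilon>" by (auto simp: eventually_at_filter below)
  qed simp
  moreover have "?F C \<ge> \<epsilon>"
  proof (rule tendsto_lowerbound)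
    show "(?F \<longlongrightarrow> ?F C) (at_right C)" by (rule tendsto_mono[OF at_le lim]) simp
    show "\<forall>\<^sub>F R in at_right C. \<epsilon> \<le> ?F R" by (auto simp: eventually_at_filter above)
  qed simp
  ultimately show FC: "?F (C_eps H \<rho> \<epsilon>) = \<epsilon>" by (simp add: C_def)
  show "C_eps H \<rho> \<epsilon> > 0"
    using FC outage_F_nonpos[OF \<rho>, of "C_eps H \<rho> \<epsilon>"] \<epsilon> by (cases "C_eps H \<rho> \<epsilon> \<le> 0") auto
qed

end

section \<open>From code bounds to rates\<close>

lemma no_code_imp_rx_code:
  fixes g :: "(nat \<Rightarrow> complex^'r::finite) \<Rightarrow> nat"
  assumes "no_code H \<rho> n M \<epsilon> c g"
  shows "rx_code H \<rho> n M \<epsilon> c (\<lambda>p. g (fst p))"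
proof -
  have "g \<in> measurable (out_space n) (count_space UNIV)" using assms by (simp add: no_code_def)
  then have "(\<lambda>p. g (fst p)) \<in> measurable (out_space n \<Otimes>\<^sub>M (borel :: (complex^'r) measure)) (count_space UNIV)"
    by (rule measurable_compose[OF measurable_fst])
  then show ?thesis using assms by (simp add: no_code_def rx_code_def)
qed

lemma Rstar_no_le_rx: "Rstar_no H \<rho> n \<epsilon> \<le> Rstar_rx H \<rho> n \<epsilon>"
  unfolding Rstar_no_def Rstar_rx_def by (rule Sup_subset_mono) (blast intro: no_code_imp_rx_code)

text \<open>Half the slope survives on both sides near \<open>c\<close>; this converts a rate shift
  into a probability margin.\<close>

lemma linear_growth_at_derivative:
  fixes F :: "real \<Rightarrow> real"
  assumes "(F has_real_derivative d) (at c)" "d > 0"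
  obtains \<delta> where "\<delta> > 0" "\<And>t. 0 < t \<Longrightarrow> t < \<delta> \<Longrightarrow> F c + d / 2 * t \<le> F (c + t) \<and> F (c - t) \<le> F c - d / 2 * t"
proof -
  have "(\<lambda>h. (F (c + h) - F c) / h) \<midarrow>0\<rightarrow> d" using DERIV_D[OF assms(1)] .
  from LIM_D[OF this, of "d / 2"] assms(2) obtain \<delta> where \<delta>: "\<delta> > 0"
    "\<And>h. h \<noteq> 0 \<Longrightarrow> norm (h - 0) < \<delta> \<Longrightarrow> norm ((F (c + h) - F c) / h - d) < d / 2" by auto
  show thesis
  proof (rule that[OF \<delta>(1)])
    fix t :: real assume t: "0 < t" "t < \<delta>"
    have "\<bar>(F (c + t) - F c) / t - d\<bar> < d / 2" "\<bar>(F (c + - t) - F c) / - t - d\<bar> < d / 2"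
      using \<delta>(2)[of t] \<delta>(2)[of "- t"] t unfolding real_norm_def by simp_all
    then have "d / 2 < (F (c + t) - F c) / t" "d / 2 < (F (c + - t) - F c) / - t" by linarith+
    then show "F c + d / 2 * t \<le> F (c + t) \<and> F (c - t) \<le> F c - d / 2 * t"
      using t by (simp add: field_simps)
  qed
qed

lemma ereal_abs_diff_le:
  "ereal (c - k) \<le> X \<Longrightarrow> X \<le> ereal (c + k) \<Longrightarrow> \<bar>X - ereal c\<bar> \<le> ereal k"
  by (cases X) auto

theorem theorem9:
  fixes H :: "(complex^'r::finite) measure" and \<rho> \<epsilon> :: real
  assumes "prob_space H" and "sets H = sets borel"
    and "\<rho> > 0" and "0 < \<epsilon>" and "\<epsilon> < 1"
    and "\<exists>f f'. (\<forall>x. f x \<ge> 0) \<and>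
           distributed H lborel (\<lambda>h. (norm h)^2) (\<lambda>x. ennreal (f x)) \<and>
           (\<forall>x>0. (f has_real_derivative f' x) (at x)) \<and> continuous_on {0<..} f'"
    and "\<exists>d>0. (outage_F H \<rho> has_real_derivative d) (at (C_eps H \<rho> \<epsilon>))"
  shows "(\<exists>K. \<forall>\<^sub>F n in sequentially.
            \<bar>Rstar_no H \<rho> n \<epsilon> - ereal (C_eps H \<rho> \<epsilon>)\<bar> \<le> ereal (K * ln (real n) / real n))
       \<and> (\<exists>K. \<forall>\<^sub>F n in sequentially.
            \<bar>Rstar_rx H \<rho> n \<epsilon> - ereal (C_eps H \<rho> \<epsilon>)\<bar> \<le> ereal (K * ln (real n) / real n))"
proof -
  note \<rho> = \<open>\<rho> > 0\<close>
  obtain f f' where ff: "\<forall>x. f x \<ge> 0" "distributed H lborel (\<lambda>h. (norm h)^2) (\<lambda>x. ennreal (f x))"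
    "\<forall>x>0. (f has_real_derivative f' x) (at x)" "continuous_on {0<..} f'"
    using assms(6) by blast
  interpret fading H f f'
  proof (rule fading.intro)
    show "prob_space H" "sets H = sets borel" by fact+
    show "distributed H lborel (\<lambda>h. (norm h)^2) (\<lambda>x. ennreal (f x))" "continuous_on {0<..} f'" by fact+
    show "f x \<ge> 0" for x using ff(1) by simp
    show "(f has_real_derivative f' x) (at x)" if "x > 0" for x using ff(3) that by simp
  qed
  obtain d where d: "d > 0" "(outage_F H \<rho> has_real_derivative d) (at (C_eps H \<rho> \<epsilon>))"
    using assms(7) by blast
  define C where "C = C_eps H \<rho> \<epsilon>"
  note CP = C_eps_props[OF \<rho> assms(4,5) DERIV_isCont[OF d(2)]]
  have FC: "outage_F H \<rho> C = \<epsilon>" and C: "C > 0" using CP by (simp_all add: C_def)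
  obtain \<delta> where \<delta>: "\<delta> > 0" "\<And>t. 0 < t \<Longrightarrow> t < \<delta> \<Longrightarrow> \<epsilon> + d / 2 * t \<le> outage_F H \<rho> (C + t) \<and> outage_F H \<rho> (C - t) \<le> \<epsilon> - d / 2 * t"
    using linear_growth_at_derivative[OF d(2) d(1)] unfolding C_def[symmetric] FC by blast
  define G where "G R = (exp R - 1) / \<rho>" for R
  define g where "g = G C"
  have g: "g > 0" using C \<rho> by (simp add: g_def G_def)
  have G1: "1 + \<rho> * G R = exp R" for R using \<rho> by (simp add: G_def)
  obtain L where L: "\<And>g0. \<bar>g0 - g\<bar> \<le> g / 4 \<Longrightarrow> quadratic_at L g0" using ex_quadratic_at[OF g] by blast
  obtain K where K: "K \<ge> 0" "\<And>g0. g / 2 \<le> g0 \<Longrightarrow> g0 \<le> 2 * g \<Longrightarrow> lip_at K (conv_lin \<rho> g0) g0 \<and> lip_at K (conv_energy \<rho> g0) g0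
    \<and> lip_at K (ach_lin \<rho>) g0 \<and> lip_at K (\<lambda>_. - g0) g0"
    using ex_lip_at[OF \<rho>, of "g / 2" "2 * g"] g by auto
  define Lc where "Lc = fluct_const L K \<rho>"
  define r where "r = CARD('r)"
  \<comment> \<open>The coefficient of ln n lost in the lower bound: r + 1 from the power of n
    dividing \<open>X\<close>, 1 from the rate shift, and r C + ln 24, a constant loss absorbed
    since ln n \<ge> 1. The upper bound needs only 2.\<close>
  define Ka where "Ka = real r + 2 + real r * C + ln 24"
  have Ka: "Ka \<ge> 2" using C by (simp add: Ka_def)
  let ?x = "\<lambda>n::nat. ln (real n) / real n"
  have x0: "?x \<longlonglongrightarrow> 0" by (rule lim_ln_over_n)
  have Gp: "(\<lambda>n. G (C + ?x n)) \<longlonglongrightarrow> G (C + 0)" "(\<lambda>n. G (C - ?x n)) \<longlonglongrightarrow> G (C - 0)"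
    unfolding G_def by (intro tendsto_intros x0; use \<rho> in simp)+
  have ev_ln: "\<forall>\<^sub>F n in sequentially. ln (real n) \<ge> c" for c
    by (rule filterlim_at_top[THEN iffD1, rule_format]) (rule filterlim_compose[OF ln_at_top filterlim_real_sequentially])
  have "\<forall>\<^sub>F n in sequentially. ?x n < \<delta>" using order_tendstoD(2)[OF x0 \<delta>(1)] .
  \<comment> \<open>Ensures that the rate left after all losses is nonnegative, so that at least one
    message remains after rounding.\<close>
  moreover have "\<forall>\<^sub>F n in sequentially. ?x n < C / Ka" using order_tendstoD(2)[OF x0, of "C / Ka"] C Ka by simp
  moreover have "\<forall>\<^sub>F n in sequentially. dist (G (C + ?x n)) g < g / 4"
    using tendstoD[OF Gp(1), of "g / 4"] g by (simp add: g_def)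
  moreover have "\<forall>\<^sub>F n in sequentially. dist (G (C - ?x n)) g < g / 4"
    using tendstoD[OF Gp(2), of "g / 4"] g by (simp add: g_def)
  moreover note ev_ln[of 1] ev_ln[of "(Lc + 1) * 2 / d"] eventually_gt_at_top[of r]
  ultimately have bounds: "\<forall>\<^sub>F n in sequentially. ereal (C - Ka * ln (real n) / real n) \<le> Rstar_no H \<rho> n \<epsilon>
      \<and> Rstar_rx H \<rho> n \<epsilon> \<le> ereal (C + Ka * ln (real n) / real n)"
  proof eventually_elim
    case (elim n)
    define x where "x = ln (real n) / real n"
    have n: "n > 0" using elim by simp
    have lnn: "ln (real n) \<ge> 1" and nx: "real n * x = ln (real n)" using elim n by (simp_all add: x_def)
    have "0 < ln (real n)" using lnn by linarith
    then have x: "0 < x" "x < \<delta>" using elim(1) n unfolding x_def by (simp_all only: divide_pos_pos of_nat_0_less_iff)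
    \<comment> \<open>The rate shift pays for the threshold error \<open>Lc / n\<close> and leaves a
      surplus 1/n. The converse turns the surplus into a factor n on M, the achievability part
      spends it on confusion.\<close>
    have dl: "(Lc + 1) / n \<le> d / 2 * x"
    proof -
      have "Lc + 1 \<le> d / 2 * ln (real n)" using elim(6) d(1) by (simp add: field_simps)
      then have "(Lc + 1) / n \<le> d / 2 * ln (real n) / n" using n by (intro divide_right_mono) auto
      then show ?thesis by (simp add: x_def)
    qed
    have near: "G (C + x) > 0" "\<bar>G (C + x) - g\<bar> \<le> g / 4" "g / 2 \<le> G (C + x)" "G (C + x) \<le> 2 * g"
      "G (C - x) > 0" "\<bar>G (C - x) - g\<bar> \<le> g / 4" "g / 2 \<le> G (C - x)" "G (C - x) \<le> 2 * g"
      using elim(3,4) g unfolding dist_real_def x_def[symmetric] by linarith+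
    have up: "Rstar_rx H \<rho> n \<epsilon> \<le> ereal (C + Ka * ln (real n) / real n)"
      unfolding Rstar_rx_def
    proof (rule Sup_least, safe)
      fix M c g assume code: "rx_code H \<rho> n M \<epsilon> c g"
      have M: "M \<ge> 1" using code by (simp add: rx_code_def)
      have "gain_cdf (G (C + x)) - Lc / n - \<epsilon> \<le> (1 + \<rho> * G (C + x)) ^ n / M"
        unfolding Lc_def using near K by (intro converse[OF \<rho> _ n code] L) auto
      moreover have "gain_cdf (G (C + x)) \<ge> \<epsilon> + d / 2 * x"
        using \<delta>(2)[OF x] by (simp add: outage_F_eq[OF \<rho>] G_def)
      ultimately have "1 / n \<le> exp (C + x) ^ n / M" using dl unfolding G1 by (simp add: add_divide_distrib)
      then have "real M \<le> n * exp (C + x) ^ n" using M n by (simp add: field_simps)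
      then have "ln (real M) \<le> ln (n * exp (C + x) ^ n)" using M by simp
      also have "\<dots> = ln n + n * (C + x)" using n by (simp add: ln_mult ln_realpow)
      also have "\<dots> = n * C + 2 * ln n" using nx by (simp add: distrib_left)
      also have "\<dots> \<le> n * C + Ka * ln n" using Ka lnn by (intro add_left_mono mult_right_mono) auto
      finally have "ln (real M) / n \<le> (n * C + Ka * ln n) / n" using n by (intro divide_right_mono) auto
      then show "ereal (ln (real M) / real n) \<le> ereal (C + Ka * ln (real n) / real n)"
        using n by (simp add: add_divide_distrib)
    qed
    \<comment> \<open>Solves for the real code size at which the confusion term of
      \<open>achievability\<close> equals 1/n.\<close>
    define X where "X = exp (C - x) ^ (n - r) / (12 * real n ^ (r + 1))"
    define M where "M = nat \<lfloor>X\<rfloor>"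
    have X0: "X > 0" using n by (simp add: X_def)
    have lnX: "ln X - ln 2 \<ge> n * C - Ka * ln n"
    proof -
      define Q where "Q = real (r + 1) * ln n"
      define P where "P = (r * C + ln 24) * ln n"
      have "ln X = real (n - r) * (C - x) - (ln 12 + Q)"
        unfolding X_def Q_def using n by (simp add: ln_div ln_mult ln_realpow distrib_right)
      moreover have "real (n - r) * (C - x) = n * C - r * C - ln n + r * x"
        using elim(7) nx by (simp add: of_nat_diff algebra_simps)
      moreover have "r * x \<ge> 0" using x by simp
      moreover have "ln 12 + ln 2 = ln (24::real)" using ln_mult[of 12 "2::real"] by simp
      moreover have "r * C + ln 24 \<le> P"
        unfolding P_def using mult_left_mono[OF lnn, of "r * C + ln 24"] C by simp
      moreover have "Ka * ln n = Q + ln n + P"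
        by (simp add: Ka_def P_def Q_def algebra_simps)
      ultimately show ?thesis by linarith
    qed
    have "Ka * ln n \<le> n * C"
    proof -
      have "Ka * x \<le> C" using elim(2) Ka by (simp add: x_def field_simps)
      then have "n * (Ka * x) \<le> n * C" by (intro mult_left_mono) auto
      then show ?thesis using nx by (simp add: mult.left_commute)
    qed
    then have "ln X \<ge> ln 2" using lnX by linarith
    \<comment> \<open>Rounding down then keeps at least half of \<open>X\<close>, the source of the
      ln 2 inside ln 24.\<close>
    then have X2: "X \<ge> 2" using X0 by simp
    have M: "M \<ge> 1" "real M \<le> X" "X / 2 \<le> real M"
    proof -
      have "real M = of_int \<lfloor>X\<rfloor>" using X2 by (simp add: M_def)
      moreover have "of_int \<lfloor>X\<rfloor> \<le> X" "X < of_int \<lfloor>X\<rfloor> + 1" by linarith+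
      ultimately show "real M \<le> X" "X / 2 \<le> real M" using X2 by linarith+
      then show "M \<ge> 1" using X2 by linarith
    qed
    have "\<exists>c g. no_code H \<rho> n M \<epsilon> c g"
    proof (rule achievability[where ?g0.0 = "G (C - x)" and L = L and K = K])
      have "12 * real M * real n ^ CARD('r) / exp (C - x) ^ (n - CARD('r)) \<le> 12 * X * real n ^ CARD('r) / exp (C - x) ^ (n - CARD('r))"
        using M by (intro divide_right_mono mult_right_mono mult_left_mono) auto
      also have "\<dots> = 1 / n" using n by (simp add: X_def r_def)
      finally have "12 * real M * real n ^ CARD('r) / exp (C - x) ^ (n - CARD('r)) \<le> 1 / n" .
      moreover have "gain_cdf (G (C - x)) \<le> \<epsilon> - d / 2 * x"
        using \<delta>(2)[OF x] by (simp add: outage_F_eq[OF \<rho>] G_def)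
      ultimately show "gain_cdf (G (C - x)) + fluct_const L K \<rho> / n + 12 * real M * real n ^ CARD('r) / (1 + \<rho> * G (C - x)) ^ (n - CARD('r)) \<le> \<epsilon>"
        using dl unfolding G1 Lc_def[symmetric] add_divide_distrib by linarith
    qed (use near K \<rho> M(1) L elim(7) in \<open>auto simp: r_def\<close>)
    then have "ereal (ln (real M) / real n) \<le> Rstar_no H \<rho> n \<epsilon>"
      unfolding Rstar_no_def by (intro Sup_upper) auto
    moreover have "C - Ka * ln (real n) / real n \<le> ln (real M) / real n"
    proof -
      have "ln (X / 2) \<le> ln (real M)" using M X0 by simp
      then have "n * C - Ka * ln n \<le> ln (real M)" using lnX X0 by (simp add: ln_div)
      then have "(n * C - Ka * ln n) / n \<le> ln (real M) / n" using n by (intro divide_right_mono) auto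
      then show ?thesis using n by (simp add: diff_divide_distrib)
    qed
    ultimately show ?case using up by (meson ereal_less_eq(3) order_trans)
  qed
  have "\<forall>\<^sub>F n in sequentially. \<bar>Rstar_no H \<rho> n \<epsilon> - ereal C\<bar> \<le> ereal (Ka * ln (real n) / real n)"
    using bounds
  proof eventually_elim
    case (elim n)
    then have "Rstar_no H \<rho> n \<epsilon> \<le> ereal (C + Ka * ln (real n) / real n)"
      using Rstar_no_le_rx order_trans by blast
    with elim show ?case by (intro ereal_abs_diff_le) simp_all
  qed
  moreover have "\<forall>\<^sub>F n in sequentially. \<bar>Rstar_rx H \<rho> n \<epsilon> - ereal C\<bar> \<le> ereal (Ka * ln (real n) / real n)"
    using bounds
  proof eventually_elim
    case (elim n)
    then have "ereal (C - Ka * ln (real n) / real n) \<le> Rstar_rx H \<rho> n \<epsilon>"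
      using Rstar_no_le_rx order_trans by blast
    with elim show ?case by (intro ereal_abs_diff_le) simp_all
  qed
  ultimately show ?thesis unfolding C_def by blast
qed

end
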